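(* Let $\mathcal{C}$ be a smashing triangulated category that satisfies the following Brown representability property: any cohomological functor $\mathcal{C}^{op}\to \mathrm{Ab}$ that respects products (i.e. converts small $\mathcal{C}$-coproducts into products of abelian groups) is representable. Then for a weight structure $w$ on $\mathcal{C}$ there exists a $t$-structure $t$ on $\mathcal{C}$ adjacent to $w$ if and only if $w$ is smashing. Moreover, the heart of $t$ (if $t$ exists) is equivalent to the category of all those additive functors $\underline{Hw}^{op}\to \mathrm{Ab}$ that respect products, where $\underline{Hw}$ is the heart of $w$.
   Context: Conventions: all products and coproducts are small; $X\perp Y$ means $\mathcal{C}(X,Y)=0$, and for classes $D,E$ of objects $D\perp E$ means $X\perp Y$ for all $X\in D$, $Y\in E$. A triangulated category is smashing if it has all small coproducts. A cohomological functor is a contravariant additive functor to an abelian category converting distinguished triangles into long exact sequences. A weight structure $w=(\mathcal{C}_{w\le 0},\mathcal{C}_{w\ge 0})$ on $\mathcal{C}$ is a pair of classes of objects closed under retracts such that $\mathcal{C}_{w\le 0}\subset \mathcal{C}_{w\le 0}[1]$, $\mathcal{C}_{w\ge 0}[1]\subset \mathcal{C}_{w\ge 0}$, $\mathcal{C}_{w\le 0}\perp \mathcal{C}_{w\ge 0}[1]$, and every object $M$ fits into a distinguished triangle $L_wM\to M\to R_wM\to L_wM[1]$ with $L_wM\in \mathcal{C}_{w\le 0}$, $R_wM\in\mathcal{C}_{w\ge 0}[1]$. Its heart $\underline{Hw}$ is the full subcategory with object class $\mathcal{C}_{w\le 0}\cap \mathcal{C}_{w\ge 0}$. $w$ is smashing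 if $\mathcal{C}$ is smashing and $\mathcal{C}_{w\ge 0}$ is closed under $\mathcal{C}$-coproducts. A $t$-structure $t=(\mathcal{C}_{t\le 0},\mathcal{C}_{t\ge 0})$ on $\mathcal{C}$ (homological convention) is a pair of classes of objects closed under isomorphism such that $\mathcal{C}_{t\le 0}\subset \mathcal{C}_{t\le 0}[1]$, $\mathcal{C}_{t\ge 0}[1]\subset \mathcal{C}_{t\ge 0}$, $\mathcal{C}_{t\ge 0}[1]\perp \mathcal{C}_{t\le 0}$, and every object $M$ fits into a distinguished triangle $L_tM\to M\to R_tM\to L_tM[1]$ with $L_tM\in \mathcal{C}_{t\ge 0}$, $R_tM\in\mathcal{C}_{t\le 0}[-1]$. Its heart is the full subcategory with object class $\mathcal{C}_{t\le 0}\cap \mathcal{C}_{t\ge 0}$. $t$ is (left) adjacent to $w$ if $\mathcal{C}_{t\ge 0}=\mathcal{C}_{w\ge 0}$. *)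

theory Defs
  imports "HOL-Algebra.Product_Groups"
begin

section \<open>Smallness\<close>

text \<open>
  The distinction between sets and proper classes is expressed relative to a type \<open>'u\<close> that
  plays the role of a Grothendieck universe containing the natural numbers: its cardinality is
  a strongly inaccessible cardinal, and a set of arbitrary type is small iff its cardinality is
  strictly below that of \<open>'u\<close>. Every small set is then equipollent to a small set of elements
  of \<open>'u\<close>, so small families may be indexed by subsets of \<open>'u\<close> and small groups may be taken
  with carriers in \<open>'u\<close>.
\<close>

definition small :: "'u itself \<Rightarrow> 'a set \<Rightarrow> bool" where
  "small _ A \<longleftrightarrow> A \<prec> (UNIV :: 'u set)"

definition universe :: "'u itself \<Rightarrow> bool" where
  "universe U \<longleftrightarrow>
     small U (UNIV :: nat set) \<and>
     (\<forall>A :: 'u set. small U A \<longrightarrow> small U (Pow A)) \<and>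
     (\<forall>(I :: 'u set) (A :: 'u \<Rightarrow> 'u set).
        small U I \<and> (\<forall>i\<in>I. small U (A i)) \<longrightarrow> small U (\<Union>i\<in>I. A i))"


section \<open>Categories, functors and natural transformations\<close>

text \<open>\<open>Comp C g f\<close> is the composite of \<open>f\<close> followed by \<open>g\<close>.\<close>

record ('o, 'm) cat =
  Ob :: "'o set"
  Arr :: "'m set"
  Dom :: "'m \<Rightarrow> 'o"
  Cod :: "'m \<Rightarrow> 'o"
  Idn :: "'o \<Rightarrow> 'm"
  Comp :: "'m \<Rightarrow> 'm \<Rightarrow> 'm"  (infixl "\<cdot>\<index>" 70)

definition Hom :: "('o, 'm, 'x) cat_scheme \<Rightarrow> 'o \<Rightarrow> 'o \<Rightarrow> 'm set" where
  "Hom C X Y = {f \<in> Arr C. Dom C f = X \<and> Cod C f = Y}"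

locale category =
  fixes C :: "('o, 'm, 'x) cat_scheme" (structure)
  assumes Dom_in_Ob: "f \<in> Arr C \<Longrightarrow> Dom C f \<in> Ob C"
    and Cod_in_Ob: "f \<in> Arr C \<Longrightarrow> Cod C f \<in> Ob C"
    and Idn_in_Hom: "X \<in> Ob C \<Longrightarrow> Idn C X \<in> Hom C X X"
    and Comp_in_Hom: "\<lbrakk>f \<in> Hom C X Y; g \<in> Hom C Y Z\<rbrakk> \<Longrightarrow> g \<cdot> f \<in> Hom C X Z"
    and Comp_Idn_left: "f \<in> Hom C X Y \<Longrightarrow> Idn C Y \<cdot> f = f"
    and Comp_Idn_right: "f \<in> Hom C X Y \<Longrightarrow> f \<cdot> Idn C X = f"
    and Comp_assoc:
      "\<lbrakk>f \<in> Hom C X Y; g \<in> Hom C Y Z; h \<in> Hom C Z W\<rbrakk> \<Longrightarrow> (h \<cdot> g) \<cdot> f = h \<cdot> (g \<cdot> f)"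

definition locally_small :: "'u itself \<Rightarrow> ('o, 'm, 'x) cat_scheme \<Rightarrow> bool" where
  "locally_small U C \<longleftrightarrow> (\<forall>X\<in>Ob C. \<forall>Y\<in>Ob C. small U (Hom C X Y))"

definition is_isomorphism :: "('o, 'm, 'x) cat_scheme \<Rightarrow> 'm \<Rightarrow> bool" where
  "is_isomorphism C f \<longleftrightarrow> f \<in> Arr C \<and>
     (\<exists>g \<in> Hom C (Cod C f) (Dom C f).
        Comp C g f = Idn C (Dom C f) \<and> Comp C f g = Idn C (Cod C f))"

definition isomorphic_in :: "('o, 'm, 'x) cat_scheme \<Rightarrow> 'o \<Rightarrow> 'o \<Rightarrow> bool" where
  "isomorphic_in C X Y \<longleftrightarrow> (\<exists>f \<in> Hom C X Y. is_isomorphism C f)"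

definition closed_under_isomorphism :: "('o, 'm, 'x) cat_scheme \<Rightarrow> 'o set \<Rightarrow> bool" where
  "closed_under_isomorphism C D \<longleftrightarrow>
     (\<forall>X\<in>Ob C. \<forall>Y\<in>D. isomorphic_in C X Y \<longrightarrow> X \<in> D)"

definition closed_under_retracts :: "('o, 'm, 'x) cat_scheme \<Rightarrow> 'o set \<Rightarrow> bool" where
  "closed_under_retracts C D \<longleftrightarrow>
     (\<forall>X\<in>Ob C. \<forall>M\<in>D.
        (\<exists>i \<in> Hom C X M. \<exists>p \<in> Hom C M X. Comp C p i = Idn C X) \<longrightarrow> X \<in> D)"

definition is_coproduct ::
  "('o, 'm, 'x) cat_scheme \<Rightarrow> 'i set \<Rightarrow> ('i \<Rightarrow> 'o) \<Rightarrow> 'o \<Rightarrow> ('i \<Rightarrow> 'm) \<Rightarrow> bool" where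
  "is_coproduct C I X S \<iota> \<longleftrightarrow>
     (\<forall>i\<in>I. X i \<in> Ob C) \<and> S \<in> Ob C \<and> (\<forall>i\<in>I. \<iota> i \<in> Hom C (X i) S) \<and>
     (\<forall>Z\<in>Ob C. \<forall>f. (\<forall>i\<in>I. f i \<in> Hom C (X i) Z) \<longrightarrow>
        (\<exists>!u. u \<in> Hom C S Z \<and> (\<forall>i\<in>I. Comp C u (\<iota> i) = f i)))"

definition has_small_coproducts :: "'u itself \<Rightarrow> ('o, 'm, 'x) cat_scheme \<Rightarrow> bool" where
  "has_small_coproducts U C \<longleftrightarrow>
     (\<forall>(I :: 'u set) X. small U I \<and> (\<forall>i\<in>I. X i \<in> Ob C) \<longrightarrow> (\<exists>S \<iota>. is_coproduct C I X S \<iota>))"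

definition closed_under_small_coproducts ::
  "'u itself \<Rightarrow> ('o, 'm, 'x) cat_scheme \<Rightarrow> 'o set \<Rightarrow> bool" where
  "closed_under_small_coproducts U C D \<longleftrightarrow>
     (\<forall>(I :: 'u set) X S \<iota>.
        small U I \<and> is_coproduct C I X S \<iota> \<and> (\<forall>i\<in>I. X i \<in> D) \<longrightarrow> S \<in> D)"

record ('o, 'm, 'p, 'n) functr =
  FOb :: "'o \<Rightarrow> 'p"
  FArr :: "'m \<Rightarrow> 'n"

definition is_functor ::
  "('o, 'm, 'x) cat_scheme \<Rightarrow> ('p, 'n, 'y) cat_scheme \<Rightarrow> ('o, 'm, 'p, 'n) functr \<Rightarrow> bool" where
  "is_functor A B F \<longleftrightarrow>
     (\<forall>X\<in>Ob A. FOb F X \<in> Ob B) \<and>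
     (\<forall>X\<in>Ob A. \<forall>Y\<in>Ob A. \<forall>f \<in> Hom A X Y. FArr F f \<in> Hom B (FOb F X) (FOb F Y)) \<and>
     (\<forall>X\<in>Ob A. FArr F (Idn A X) = Idn B (FOb F X)) \<and>
     (\<forall>X\<in>Ob A. \<forall>Y\<in>Ob A. \<forall>Z\<in>Ob A. \<forall>f \<in> Hom A X Y. \<forall>g \<in> Hom A Y Z.
        FArr F (Comp A g f) = Comp B (FArr F g) (FArr F f))"

definition id_functor :: "('o, 'm, 'o, 'm) functr" where
  "id_functor = \<lparr>FOb = id, FArr = id\<rparr>"

definition comp_functor ::
  "('p, 'n, 'q, 'k) functr \<Rightarrow> ('o, 'm, 'p, 'n) functr \<Rightarrow> ('o, 'm, 'q, 'k) functr" where
  "comp_functor G F = \<lparr>FOb = FOb G \<circ> FOb F, FArr = FArr G \<circ> FArr F\<rparr>"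

definition is_nat_trans ::
  "('o, 'm, 'x) cat_scheme \<Rightarrow> ('p, 'n, 'y) cat_scheme \<Rightarrow>
   ('o, 'm, 'p, 'n) functr \<Rightarrow> ('o, 'm, 'p, 'n) functr \<Rightarrow> ('o \<Rightarrow> 'n) \<Rightarrow> bool" where
  "is_nat_trans A B F G \<eta> \<longleftrightarrow>
     (\<forall>X\<in>Ob A. \<eta> X \<in> Hom B (FOb F X) (FOb G X)) \<and>
     (\<forall>X\<in>Ob A. \<forall>Y\<in>Ob A. \<forall>f \<in> Hom A X Y.
        Comp B (\<eta> Y) (FArr F f) = Comp B (FArr G f) (\<eta> X))"

definition nat_isomorphic ::
  "('o, 'm, 'x) cat_scheme \<Rightarrow> ('p, 'n, 'y) cat_scheme \<Rightarrow>
   ('o, 'm, 'p, 'n) functr \<Rightarrow> ('o, 'm, 'p, 'n) functr \<Rightarrow> bool" where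
  "nat_isomorphic A B F G \<longleftrightarrow>
     (\<exists>\<eta>. is_nat_trans A B F G \<eta> \<and> (\<forall>X\<in>Ob A. is_isomorphism B (\<eta> X)))"

definition equivalent_categories ::
  "('o, 'm, 'x) cat_scheme \<Rightarrow> ('p, 'n, 'y) cat_scheme \<Rightarrow> bool" where
  "equivalent_categories A B \<longleftrightarrow>
     (\<exists>F G. is_functor A B F \<and> is_functor B A G \<and>
        nat_isomorphic A A (comp_functor G F) id_functor \<and>
        nat_isomorphic B B (comp_functor F G) id_functor)"

text \<open>
  The category whose objects are a given collection \<open>P\<close> of functors from \<open>A\<close> to \<open>B\<close> and whose
  morphisms are all natural transformations. Components are normalised to \<open>undefined\<close> outside
  of \<open>Ob A\<close>, so that equality of morphisms is equality of natural transformations.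
\<close>

definition functor_category ::
  "('o, 'm, 'x) cat_scheme \<Rightarrow> ('p, 'n, 'y) cat_scheme \<Rightarrow> ('o, 'm, 'p, 'n) functr set \<Rightarrow>
   (('o, 'm, 'p, 'n) functr,
    ('o, 'm, 'p, 'n) functr \<times> ('o, 'm, 'p, 'n) functr \<times> ('o \<Rightarrow> 'n)) cat" where
  "functor_category A B P =
     \<lparr>Ob = P,
      Arr = {(F, G, \<eta>). F \<in> P \<and> G \<in> P \<and> is_nat_trans A B F G \<eta> \<and> \<eta> \<in> extensional (Ob A)},
      Dom = (\<lambda>(F, G, \<eta>). F),
      Cod = (\<lambda>(F, G, \<eta>). G),
      Idn = (\<lambda>F. (F, F, \<lambda>X\<in>Ob A. Idn B (FOb F X))),
      Comp = (\<lambda>(G', H, \<theta>) (F, G, \<eta>). (F, H, \<lambda>X\<in>Ob A. Comp B (\<theta> X) (\<eta> X)))\<rparr>"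


section \<open>Additive categories\<close>

record ('o, 'm) addcat = "('o, 'm) cat" +
  Add :: "'m \<Rightarrow> 'm \<Rightarrow> 'm"
  Zero :: "'o \<Rightarrow> 'o \<Rightarrow> 'm"

definition hom_group :: "('o, 'm, 'x) addcat_scheme \<Rightarrow> 'o \<Rightarrow> 'o \<Rightarrow> 'm monoid" where
  "hom_group C X Y = \<lparr>carrier = Hom C X Y, mult = Add C, one = Zero C X Y\<rparr>"

definition Neg :: "('o, 'm, 'x) addcat_scheme \<Rightarrow> 'm \<Rightarrow> 'm" where
  "Neg C f = inv\<^bsub>hom_group C (Dom C f) (Cod C f)\<^esub> f"

locale preadditive_category = category C
  for C :: "('o, 'm, 'x) addcat_scheme" (structure) +
  assumes hom_comm_group: "\<lbrakk>X \<in> Ob C; Y \<in> Ob C\<rbrakk> \<Longrightarrow> comm_group (hom_group C X Y)"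
    and Comp_Add_left:
      "\<lbrakk>f \<in> Hom C X Y; g \<in> Hom C Y Z; h \<in> Hom C Y Z\<rbrakk> \<Longrightarrow>
         Add C g h \<cdot> f = Add C (g \<cdot> f) (h \<cdot> f)"
    and Comp_Add_right:
      "\<lbrakk>f \<in> Hom C X Y; g \<in> Hom C X Y; h \<in> Hom C Y Z\<rbrakk> \<Longrightarrow>
         h \<cdot> Add C f g = Add C (h \<cdot> f) (h \<cdot> g)"

definition is_zero_object :: "('o, 'm, 'x) cat_scheme \<Rightarrow> 'o \<Rightarrow> bool" where
  "is_zero_object C N \<longleftrightarrow> N \<in> Ob C \<and>
     (\<forall>X\<in>Ob C. (\<exists>!f. f \<in> Hom C N X) \<and> (\<exists>!f. f \<in> Hom C X N))"

locale additive_category = preadditive_category C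
  for C :: "('o, 'm, 'x) addcat_scheme" (structure) +
  assumes ex_zero_object: "\<exists>N. is_zero_object C N"
    and ex_biproduct:
      "\<lbrakk>X \<in> Ob C; Y \<in> Ob C\<rbrakk> \<Longrightarrow>
        \<exists>S\<in>Ob C. \<exists>i \<in> Hom C X S. \<exists>j \<in> Hom C Y S. \<exists>p \<in> Hom C S X. \<exists>q \<in> Hom C S Y.
          p \<cdot> i = Idn C X \<and> q \<cdot> j = Idn C Y \<and>
          p \<cdot> j = Zero C Y X \<and> q \<cdot> i = Zero C X Y \<and>
          Add C (i \<cdot> p) (j \<cdot> q) = Idn C S"

definition op_category :: "('o, 'm, 'x) addcat_scheme \<Rightarrow> ('o, 'm) addcat" where
  "op_category C =
     \<lparr>Ob = Ob C, Arr = Arr C, Dom = Cod C, Cod = Dom C, Idn = Idn C,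
      Comp = (\<lambda>g f. Comp C f g), Add = Add C, Zero = (\<lambda>X Y. Zero C Y X)\<rparr>"

definition full_subcategory :: "('o, 'm, 'x) addcat_scheme \<Rightarrow> 'o set \<Rightarrow> ('o, 'm) addcat" where
  "full_subcategory C D =
     \<lparr>Ob = Ob C \<inter> D, Arr = {f \<in> Arr C. Dom C f \<in> D \<and> Cod C f \<in> D},
      Dom = Dom C, Cod = Cod C, Idn = Idn C, Comp = Comp C, Add = Add C, Zero = Zero C\<rparr>"

definition is_additive_functor ::
  "('o, 'm, 'x) addcat_scheme \<Rightarrow> ('p, 'n, 'y) addcat_scheme \<Rightarrow>
   ('o, 'm, 'p, 'n) functr \<Rightarrow> bool" where
  "is_additive_functor A B F \<longleftrightarrow> is_functor A B F \<and>
     (\<forall>X\<in>Ob A. \<forall>Y\<in>Ob A. \<forall>f \<in> Hom A X Y. \<forall>g \<in> Hom A X Y.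
        FArr F (Add A f g) = Add B (FArr F f) (FArr F g))"

text \<open>
  The category of small abelian groups (written multiplicatively, as in HOL-Algebra) with
  carrier in the universe. A morphism is a triple of domain, codomain and underlying map, the
  latter being normalised to \<open>undefined\<close> outside of the carrier of the domain.
\<close>

type_synonym 'u ab_arrow = "'u monoid \<times> 'u monoid \<times> ('u \<Rightarrow> 'u)"

abbreviation ab_map :: "'u ab_arrow \<Rightarrow> 'u \<Rightarrow> 'u" where
  "ab_map a \<equiv> snd (snd a)"

definition Ab :: "('u monoid, 'u ab_arrow) addcat" where
  "Ab =
     \<lparr>Ob = {G. comm_group G \<and> small TYPE('u) (carrier G)},
      Arr = {(G, H, f). comm_group G \<and> small TYPE('u) (carrier G) \<and>
                        comm_group H \<and> small TYPE('u) (carrier H) \<and>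
                        f \<in> hom G H \<inter> extensional (carrier G)},
      Dom = (\<lambda>(G, H, f). G),
      Cod = (\<lambda>(G, H, f). H),
      Idn = (\<lambda>G. (G, G, \<lambda>x\<in>carrier G. x)),
      Comp = (\<lambda>(H', K, g) (G, H, f). (G, K, \<lambda>x\<in>carrier G. g (f x))),
      Add = (\<lambda>(G, H, f) (G', H', g). (G, H, \<lambda>x\<in>carrier G. f x \<otimes>\<^bsub>H\<^esub> g x)),
      Zero = (\<lambda>G H. (G, H, \<lambda>x\<in>carrier G. \<one>\<^bsub>H\<^esub>))\<rparr>"

text \<open>
  A contravariant functor \<open>H\<close> from \<open>C\<close> to \<open>Ab\<close> respects products if for every small
  \<open>C\<close>-coproduct the canonical map from its value on the coproduct to the product of the values
  is an isomorphism.
\<close>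

definition respects_products ::
  "('o, 'm, 'x) addcat_scheme \<Rightarrow> ('o, 'm, 'u monoid, 'u ab_arrow) functr \<Rightarrow> bool" where
  "respects_products C H \<longleftrightarrow>
     (\<forall>(I :: 'u set) X S \<iota>. small TYPE('u) I \<and> is_coproduct C I X S \<iota> \<longrightarrow>
        (\<lambda>x. \<lambda>i\<in>I. ab_map (FArr H (\<iota> i)) x)
          \<in> iso (FOb H S) (product_group I (\<lambda>i. FOb H (X i))))"

text \<open>
  Since hom-sets need not have elements in \<open>'u\<close>, representability by \<open>M\<close> is stated as the
  existence of a natural family of group isomorphisms from \<open>H X\<close> to the hom-group \<open>C(X, M)\<close>.
\<close>

definition representable ::
  "('o, 'm, 'x) addcat_scheme \<Rightarrow> ('o, 'm, 'u monoid, 'u ab_arrow) functr \<Rightarrow> bool" where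
  "representable C H \<longleftrightarrow>
     (\<exists>M\<in>Ob C. \<exists>\<phi>.
        (\<forall>X\<in>Ob C. \<phi> X \<in> iso (FOb H X) (hom_group C X M)) \<and>
        (\<forall>X\<in>Ob C. \<forall>Y\<in>Ob C. \<forall>f \<in> Hom C X Y. \<forall>y \<in> carrier (FOb H Y).
           \<phi> X (ab_map (FArr H f) y) = Comp C (\<phi> Y y) f))"


section \<open>Triangulated categories\<close>

text \<open>
  \<open>Tri\<close> is the set of distinguished triangles, a triangle \<open>X \<rightarrow> Y \<rightarrow> Z \<rightarrow> X[1]\<close> being given
  by its three morphisms. The shift is an automorphism of the category.
\<close>

record ('o, 'm) tricat = "('o, 'm) addcat" +
  Shift :: "('o, 'm, 'o, 'm) functr"
  Tri :: "('m \<times> 'm \<times> 'm) set"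

definition shift_ob :: "('o, 'm, 'x) tricat_scheme \<Rightarrow> int \<Rightarrow> 'o \<Rightarrow> 'o" where
  "shift_ob C n =
     (if 0 \<le> n then FOb (Shift C) ^^ nat n
      else inv_into (Ob C) (FOb (Shift C)) ^^ nat (- n))"

definition shift_arr :: "('o, 'm, 'x) tricat_scheme \<Rightarrow> int \<Rightarrow> 'm \<Rightarrow> 'm" where
  "shift_arr C n =
     (if 0 \<le> n then FArr (Shift C) ^^ nat n
      else inv_into (Arr C) (FArr (Shift C)) ^^ nat (- n))"

definition is_triangle ::
  "('o, 'm, 'x) tricat_scheme \<Rightarrow> 'o \<Rightarrow> 'o \<Rightarrow> 'o \<Rightarrow> 'm \<times> 'm \<times> 'm \<Rightarrow> bool" where
  "is_triangle C X Y Z = (\<lambda>(f, g, h).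
     f \<in> Hom C X Y \<and> g \<in> Hom C Y Z \<and> h \<in> Hom C Z (shift_ob C 1 X))"

definition distinguished ::
  "('o, 'm, 'x) tricat_scheme \<Rightarrow> 'o \<Rightarrow> 'o \<Rightarrow> 'o \<Rightarrow> 'm \<Rightarrow> 'm \<Rightarrow> 'm \<Rightarrow> bool" where
  "distinguished C X Y Z f g h \<longleftrightarrow> (f, g, h) \<in> Tri C \<and> is_triangle C X Y Z (f, g, h)"

locale triangulated_category = additive_category C
  for C :: "('o, 'm, 'x) tricat_scheme" (structure) +
  assumes shift_additive: "is_additive_functor C C (Shift C)"
    and shift_bij_Ob: "bij_betw (FOb (Shift C)) (Ob C) (Ob C)"
    and shift_bij_Arr: "bij_betw (FArr (Shift C)) (Arr C) (Arr C)"
    and Tri_triangle: "t \<in> Tri C \<Longrightarrow> \<exists>X Y Z. is_triangle C X Y Z t"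
    and Tri_isomorphism:
      "\<lbrakk>distinguished C X Y Z f g h; is_triangle C X' Y' Z' (f', g', h');
        a \<in> Hom C X X'; b \<in> Hom C Y Y'; c \<in> Hom C Z Z';
        is_isomorphism C a; is_isomorphism C b; is_isomorphism C c;
        b \<cdot> f = f' \<cdot> a; c \<cdot> g = g' \<cdot> b; shift_arr C 1 a \<cdot> h = h' \<cdot> c\<rbrakk>
       \<Longrightarrow> (f', g', h') \<in> Tri C"
    and Tri_identity:
      "\<lbrakk>X \<in> Ob C; is_zero_object C N\<rbrakk>
       \<Longrightarrow> (Idn C X, Zero C X N, Zero C N (shift_ob C 1 X)) \<in> Tri C"
    and Tri_completion:
      "f \<in> Hom C X Y \<Longrightarrow> \<exists>Z g h. distinguished C X Y Z f g h"
    and Tri_rotation: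
      "is_triangle C X Y Z (f, g, h) \<Longrightarrow>
         (f, g, h) \<in> Tri C \<longleftrightarrow> (g, h, Neg C (shift_arr C 1 f)) \<in> Tri C"
    and Tri_morphism:
      "\<lbrakk>distinguished C X Y Z f g h; distinguished C X' Y' Z' f' g' h';
        a \<in> Hom C X X'; b \<in> Hom C Y Y'; b \<cdot> f = f' \<cdot> a\<rbrakk>
       \<Longrightarrow> \<exists>c \<in> Hom C Z Z'. c \<cdot> g = g' \<cdot> b \<and> shift_arr C 1 a \<cdot> h = h' \<cdot> c"
    and Tri_octahedron:
      "\<lbrakk>distinguished C X Y A f u u'; distinguished C Y Z B g v v';
        distinguished C X Z E (g \<cdot> f) w w'\<rbrakk>
       \<Longrightarrow> \<exists>s t. distinguished C A E B s t (shift_arr C 1 u \<cdot> v') \<and>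
             s \<cdot> u = w \<cdot> g \<and> w' \<cdot> s = u' \<and> t \<cdot> w = v \<and> v' \<cdot> t = shift_arr C 1 f \<cdot> w'"

definition smashing_triangulated :: "'u itself \<Rightarrow> ('o, 'm, 'x) tricat_scheme \<Rightarrow> bool" where
  "smashing_triangulated U C \<longleftrightarrow>
     triangulated_category C \<and> locally_small U C \<and> has_small_coproducts U C"

definition exact_pair :: "'u ab_arrow \<Rightarrow> 'u ab_arrow \<Rightarrow> bool" where
  "exact_pair a b \<longleftrightarrow> Cod Ab a = Dom Ab b \<and>
     ab_map a ` carrier (Dom Ab a) = kernel (Dom Ab b) (Cod Ab b) (ab_map b)"

text \<open>
  Exactness of the long sequence
  \<open>\<dots> \<rightarrow> H(X[n+1]) \<rightarrow> H(Z[n]) \<rightarrow> H(Y[n]) \<rightarrow> H(X[n]) \<rightarrow> H(Z[n-1]) \<rightarrow> \<dots>\<close>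
  at the terms involving \<open>Z[n]\<close>, \<open>Y[n]\<close> and \<open>X[n]\<close>.
\<close>

definition is_cohomological ::
  "('o, 'm, 'x) tricat_scheme \<Rightarrow> ('o, 'm, 'u monoid, 'u ab_arrow) functr \<Rightarrow> bool" where
  "is_cohomological C H \<longleftrightarrow>
     is_additive_functor (op_category C) Ab H \<and>
     (\<forall>(f, g, h) \<in> Tri C. \<forall>n.
        exact_pair (FArr H (shift_arr C n h)) (FArr H (shift_arr C n g)) \<and>
        exact_pair (FArr H (shift_arr C n g)) (FArr H (shift_arr C n f)) \<and>
        exact_pair (FArr H (shift_arr C n f)) (FArr H (shift_arr C (n - 1) h)))"

definition brown_representability :: "'u itself \<Rightarrow> ('o, 'm, 'x) tricat_scheme \<Rightarrow> bool" where
  "brown_representability U C \<longleftrightarrow>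
     (\<forall>H :: ('o, 'm, 'u monoid, 'u ab_arrow) functr.
        is_cohomological C H \<and> respects_products C H \<longrightarrow> representable C H)"


section \<open>Weight structures and t-structures\<close>

definition orthogonal :: "('o, 'm, 'x) addcat_scheme \<Rightarrow> 'o set \<Rightarrow> 'o set \<Rightarrow> bool" where
  "orthogonal C D E \<longleftrightarrow> (\<forall>X\<in>D. \<forall>Y\<in>E. Hom C X Y = {Zero C X Y})"

text \<open>\<open>shift_class C n D\<close> is the class \<open>D[n]\<close>.\<close>

definition shift_class :: "('o, 'm, 'x) tricat_scheme \<Rightarrow> int \<Rightarrow> 'o set \<Rightarrow> 'o set" where
  "shift_class C n D = shift_ob C n ` D"

definition weight_structure ::
  "('o, 'm, 'x) tricat_scheme \<Rightarrow> 'o set \<Rightarrow> 'o set \<Rightarrow> bool" where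
  "weight_structure C Wle Wge \<longleftrightarrow>
     Wle \<subseteq> Ob C \<and> Wge \<subseteq> Ob C \<and>
     closed_under_retracts C Wle \<and> closed_under_retracts C Wge \<and>
     Wle \<subseteq> shift_class C 1 Wle \<and> shift_class C 1 Wge \<subseteq> Wge \<and>
     orthogonal C Wle (shift_class C 1 Wge) \<and>
     (\<forall>M\<in>Ob C. \<exists>L\<in>Wle. \<exists>R\<in>shift_class C 1 Wge. \<exists>f g h. distinguished C L M R f g h)"

definition smashing_weight_structure ::
  "'u itself \<Rightarrow> ('o, 'm, 'x) tricat_scheme \<Rightarrow> 'o set \<Rightarrow> 'o set \<Rightarrow> bool" where
  "smashing_weight_structure U C Wle Wge \<longleftrightarrow>
     weight_structure C Wle Wge \<and> smashing_triangulated U C \<and>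
     closed_under_small_coproducts U C Wge"

definition t_structure ::
  "('o, 'm, 'x) tricat_scheme \<Rightarrow> 'o set \<Rightarrow> 'o set \<Rightarrow> bool" where
  "t_structure C Tle Tge \<longleftrightarrow>
     Tle \<subseteq> Ob C \<and> Tge \<subseteq> Ob C \<and>
     closed_under_isomorphism C Tle \<and> closed_under_isomorphism C Tge \<and>
     Tle \<subseteq> shift_class C 1 Tle \<and> shift_class C 1 Tge \<subseteq> Tge \<and>
     orthogonal C (shift_class C 1 Tge) Tle \<and>
     (\<forall>M\<in>Ob C. \<exists>L\<in>Tge. \<exists>R\<in>shift_class C (-1) Tle. \<exists>f g h. distinguished C L M R f g h)"

text \<open>The heart of a weight structure or of a t-structure.\<close>

definition heart :: "('o, 'm, 'x) tricat_scheme \<Rightarrow> 'o set \<Rightarrow> 'o set \<Rightarrow> ('o, 'm) addcat" where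
  "heart C Cle Cge = full_subcategory C (Cle \<inter> Cge)"

definition adjacent :: "'o set \<times> 'o set \<Rightarrow> 'o set \<times> 'o set \<Rightarrow> bool" where
  "adjacent t w \<longleftrightarrow> snd t = snd w"

definition product_preserving_presheaves ::
  "'u itself \<Rightarrow> ('o, 'm, 'x) addcat_scheme \<Rightarrow>
   (('o, 'm, 'u monoid, 'u ab_arrow) functr,
    ('o, 'm, 'u monoid, 'u ab_arrow) functr \<times> ('o, 'm, 'u monoid, 'u ab_arrow) functr \<times>
      ('o \<Rightarrow> 'u ab_arrow)) cat" where
  "product_preserving_presheaves _ A =
     functor_category (op_category A) Ab
       {F. is_additive_functor (op_category A) Ab F \<and> respects_products A F}"

end

theory Submission
  imports Defs
begin

text \<open>
  Write \<open>A\<close> for the class \<open>C\<^sub>w\<^sub>\<ge>\<^sub>0\<close>. If a \<open>t\<close>-structure adjacent to \<open>w\<close> exists, then \<open>A\<close> is the class of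
  objects without nonzero morphisms to \<open>C\<^sub>t\<^sub>\<le>\<^sub>0[-1]\<close>, and such a class is closed under coproducts; so
  \<open>w\<close> is smashing.
  
  Everything else rests on a Brown representability theorem for \<open>A\<close> alone
  (\<open>aisle_brown_representability\<close>): if \<open>w\<close> is smashing, every additive contravariant functor \<open>G\<close> from
  \<open>A\<close> to abelian groups that is half exact on the triangles with all three vertices in \<open>A\<close> and
  respects products is represented by an object of \<open>A\<close>. The point is that the left Kan extension
  \<open>H\<close> of \<open>G\<close> along the inclusion of \<open>A\<close> in \<open>C\<close> is cohomological and respects products. An element of
  \<open>H X\<close> is a class of pairs of a morphism \<open>e : X \<rightarrow> A'\<close> with \<open>A'\<close> in \<open>A\<close> and an element \<open>t\<close> of
  \<open>G A'\<close>. Weight decompositions make \<open>A\<close> weakly reflective, so these classes form a small group, and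
  the amalgamation of objects of \<open>A\<close> along triangles shows that the class of \<open>(e, t)\<close> vanishes iff
  \<open>t\<close> is the restriction of some element along a morphism \<open>k\<close> with \<open>k \<cdot> e = 0\<close>
  (\<open>pair_class_eq_one\<close>). With this criterion exactness and the behaviour on coproducts become short
  diagram chases. Brown representability on \<open>C\<close> yields an object \<open>L\<close> that represents \<open>H\<close>; it is a
  retract of its weak reflection, hence lies in \<open>A\<close>, and \<open>H\<close> restricts to \<open>G\<close> on \<open>A\<close>.
  
  Applied to the functors \<open>C(-, M)\<close>, the theorem gives a right adjoint of the inclusion of \<open>A\<close>. Since
  \<open>A\<close> is closed under extensions and the shift, the cones of the counits have no nonzero morphisms
  from \<open>A\<close> (\<open>coreflection_cone\<close>), and this is the \<open>t\<close>-structure.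
  
  For the heart, a functor \<open>F\<close> on the heart \<open>Hw\<close> of \<open>w\<close> is extended to \<open>A\<close> by sending \<open>X\<close> to the group
  of natural transformations from \<open>C(-, X)\<close>, restricted to \<open>Hw\<close>, to \<open>F\<close>. Every \<open>X\<close> in \<open>A\<close> has a cover
  \<open>P \<rightarrow> X\<close> with \<open>P\<close> in \<open>Hw\<close> and fiber in \<open>A\<close>, and every morphism from \<open>Hw\<close> to \<open>X\<close> lifts to \<open>P\<close>. From
  this and the fact that coproducts of triangles are distinguished, the extension is half exact and
  respects products. Its representing object lies in the heart of \<open>t\<close>, because the extension vanishes
  on \<open>A[1]\<close>; so restricting represented functors to \<open>Hw\<close> is essentially surjective
  (\<open>heart_presheaf_representable\<close>). Two successive covers present every object of \<open>A\<close> by \<open>Hw\<close>, which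
  gives full faithfulness (\<open>restricted_transformation_lift\<close>).
\<close>

section \<open>Elementary facts on preadditive categories\<close>

lemma Hom_iff: "f \<in> Hom C X Y \<longleftrightarrow> f \<in> Arr C \<and> Dom C f = X \<and> Cod C f = Y"
  by (simp add: Hom_def)

lemma (in category) Hom_Ob: "f \<in> Hom C X Y \<Longrightarrow> X \<in> Ob C \<and> Y \<in> Ob C"
  using Dom_in_Ob Cod_in_Ob by (auto simp: Hom_def)

definition Sub :: "('o, 'm, 'x) addcat_scheme \<Rightarrow> 'm \<Rightarrow> 'm \<Rightarrow> 'm" where
  "Sub C f g = Add C f (Neg C g)"

context preadditive_category
begin

lemma hom_group_simps [simp]:
  "carrier (hom_group C X Y) = Hom C X Y" "mult (hom_group C X Y) = Add C"
  "one (hom_group C X Y) = Zero C X Y"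
  by (simp_all add: hom_group_def)

lemma hom_group_ops:
  assumes "X \<in> Ob C" "Y \<in> Ob C"
  shows Zero_Hom: "Zero C X Y \<in> Hom C X Y"
    and "f \<in> Hom C X Y \<Longrightarrow> g \<in> Hom C X Y \<Longrightarrow> Add C f g \<in> Hom C X Y"
    and "f \<in> Hom C X Y \<Longrightarrow> Add C f (Zero C X Y) = f"
    and "f \<in> Hom C X Y \<Longrightarrow> Add C (Zero C X Y) f = f"
    and "f \<in> Hom C X Y \<Longrightarrow> Neg C f \<in> Hom C X Y"
    and "f \<in> Hom C X Y \<Longrightarrow> Add C f (Neg C f) = Zero C X Y"
    and "f \<in> Hom C X Y \<Longrightarrow> Add C (Neg C f) f = Zero C X Y"
    and "f \<in> Hom C X Y \<Longrightarrow> g \<in> Hom C X Y \<Longrightarrow> Add C f g = Zero C X Y \<Longrightarrow> f = Neg C g"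
    and "f \<in> Hom C X Y \<Longrightarrow> g \<in> Hom C X Y \<Longrightarrow> Add C f g = Add C g f"
    and "f \<in> Hom C X Y \<Longrightarrow> g \<in> Hom C X Y \<Longrightarrow> h \<in> Hom C X Y \<Longrightarrow>
          Add C (Add C f g) h = Add C f (Add C g h)"
    and "f \<in> Hom C X Y \<Longrightarrow> Neg C (Neg C f) = f"
    and "f \<in> Hom C X Y \<Longrightarrow> Add C f f = f \<Longrightarrow> f = Zero C X Y"
proof -
  interpret G: comm_group "hom_group C X Y" by (rule hom_comm_group[OF assms])
  have N: "Neg C f = inv\<^bsub>hom_group C X Y\<^esub> f" if "f \<in> Hom C X Y" for f
    using that by (simp add: Neg_def Hom_def)
  note simps = G.one_closed G.m_closed G.r_one G.l_one G.inv_closed G.r_inv G.l_inv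
    G.m_comm G.m_assoc G.inv_inv
  show "Zero C X Y \<in> Hom C X Y" using G.one_closed by simp
  show "f \<in> Hom C X Y \<Longrightarrow> g \<in> Hom C X Y \<Longrightarrow> Add C f g \<in> Hom C X Y"
    using G.m_closed by simp
  show "f \<in> Hom C X Y \<Longrightarrow> Add C f (Zero C X Y) = f" using G.r_one by simp
  show "f \<in> Hom C X Y \<Longrightarrow> Add C (Zero C X Y) f = f" using G.l_one by simp
  show NC: "f \<in> Hom C X Y \<Longrightarrow> Neg C f \<in> Hom C X Y" for f using N G.inv_closed by simp
  show "f \<in> Hom C X Y \<Longrightarrow> Add C f (Neg C f) = Zero C X Y" using N G.r_inv by simp
  show "f \<in> Hom C X Y \<Longrightarrow> Add C (Neg C f) f = Zero C X Y" using N G.l_inv by simp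
  show "f \<in> Hom C X Y \<Longrightarrow> g \<in> Hom C X Y \<Longrightarrow> Add C f g = Zero C X Y \<Longrightarrow> f = Neg C g"
    using N G.inv_equality[of f g] by simp
  show "f \<in> Hom C X Y \<Longrightarrow> g \<in> Hom C X Y \<Longrightarrow> Add C f g = Add C g f" using G.m_comm by simp
  show "f \<in> Hom C X Y \<Longrightarrow> g \<in> Hom C X Y \<Longrightarrow> h \<in> Hom C X Y \<Longrightarrow>
          Add C (Add C f g) h = Add C f (Add C g h)" using G.m_assoc by simp
  show "f \<in> Hom C X Y \<Longrightarrow> Neg C (Neg C f) = f" using N NC G.inv_inv by simp
  show "f \<in> Hom C X Y \<Longrightarrow> Add C f f = f \<Longrightarrow> f = Zero C X Y"
    using G.r_cancel_one by simp
qed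

lemma Add_Hom: "f \<in> Hom C X Y \<Longrightarrow> g \<in> Hom C X Y \<Longrightarrow> Add C f g \<in> Hom C X Y"
  using hom_group_ops(2) Hom_Ob by metis

lemma Neg_Hom: "f \<in> Hom C X Y \<Longrightarrow> Neg C f \<in> Hom C X Y"
  using hom_group_ops(5) Hom_Ob by metis

lemma Sub_Hom: "f \<in> Hom C X Y \<Longrightarrow> g \<in> Hom C X Y \<Longrightarrow> Sub C f g \<in> Hom C X Y"
  by (simp add: Sub_def Add_Hom Neg_Hom)

lemma Neg_Neg: "f \<in> Hom C X Y \<Longrightarrow> Neg C (Neg C f) = f"
  using hom_group_ops(11) Hom_Ob by metis

lemma Add_Zero: "f \<in> Hom C X Y \<Longrightarrow> Add C f (Zero C X Y) = f"
  using hom_group_ops(3) Hom_Ob by metis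

lemma Zero_Add: "f \<in> Hom C X Y \<Longrightarrow> Add C (Zero C X Y) f = f"
  using hom_group_ops(4) Hom_Ob by metis

lemma Add_assoc: "f \<in> Hom C X Y \<Longrightarrow> g \<in> Hom C X Y \<Longrightarrow> h \<in> Hom C X Y \<Longrightarrow>
          Add C (Add C f g) h = Add C f (Add C g h)"
  using hom_group_ops(10) Hom_Ob by metis

lemma Add_comm: "f \<in> Hom C X Y \<Longrightarrow> g \<in> Hom C X Y \<Longrightarrow> Add C f g = Add C g f"
  using hom_group_ops(9) Hom_Ob by metis

lemma Add_Sub: "f \<in> Hom C X Y \<Longrightarrow> g \<in> Hom C X Y \<Longrightarrow> Add C (Sub C f g) g = f"
  unfolding Sub_def
  by (metis Add_assoc Hom_Ob Neg_Hom hom_group_ops(3) hom_group_ops(7))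

lemma Sub_Zero_iff: "f \<in> Hom C X Y \<Longrightarrow> g \<in> Hom C X Y \<Longrightarrow> Sub C f g = Zero C X Y \<longleftrightarrow> f = g"
  unfolding Sub_def by (metis Hom_Ob Neg_Hom Neg_Neg hom_group_ops(6) hom_group_ops(8))

lemma Zero_Comp:
  assumes "f \<in> Hom C X Y" "Z \<in> Ob C" shows "Zero C Y Z \<cdot> f = Zero C X Z"
proof -
  have Z: "Zero C Y Z \<in> Hom C Y Z" using assms Hom_Ob Zero_Hom by metis
  have "Add C (Zero C Y Z \<cdot> f) (Zero C Y Z \<cdot> f) = Zero C Y Z \<cdot> f"
    using Comp_Add_left[OF assms(1) Z Z] Add_Zero[OF Z] by simp
  then show ?thesis using hom_group_ops(12)[of X Z] Comp_in_Hom[OF assms(1) Z] Hom_Ob assms by metis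
qed

lemma Comp_Zero:
  assumes "f \<in> Hom C X Y" "W \<in> Ob C" shows "f \<cdot> Zero C W X = Zero C W Y"
proof -
  have Z: "Zero C W X \<in> Hom C W X" using assms Hom_Ob Zero_Hom by metis
  have "Add C (f \<cdot> Zero C W X) (f \<cdot> Zero C W X) = f \<cdot> Zero C W X"
    using Comp_Add_right[OF Z Z assms(1)] Add_Zero[OF Z] by simp
  then show ?thesis using hom_group_ops(12)[of W Y] Comp_in_Hom[OF Z assms(1)] Hom_Ob assms by metis
qed

lemma Comp_Neg: assumes "f \<in> Hom C X Y" "g \<in> Hom C Y Z" shows "g \<cdot> Neg C f = Neg C (g \<cdot> f)"
proof -
  have "Add C (g \<cdot> Neg C f) (g \<cdot> f) = g \<cdot> Add C (Neg C f) f"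
    using Comp_Add_right[OF Neg_Hom[OF assms(1)] assms(1,2)] by simp
  also have "\<dots> = Zero C X Z" using hom_group_ops(7) Comp_Zero assms Hom_Ob by metis
  finally show ?thesis using hom_group_ops(8) Comp_in_Hom[OF assms]
      Comp_in_Hom[OF Neg_Hom[OF assms(1)] assms(2)] assms Hom_Ob by metis
qed

lemma Neg_Comp: assumes "f \<in> Hom C X Y" "g \<in> Hom C Y Z" shows "Neg C g \<cdot> f = Neg C (g \<cdot> f)"
proof -
  have "Add C (Neg C g \<cdot> f) (g \<cdot> f) = Add C (Neg C g) g \<cdot> f"
    using Comp_Add_left[OF assms(1) Neg_Hom[OF assms(2)] assms(2)] by simp
  also have "\<dots> = Zero C X Z" using hom_group_ops(7) Zero_Comp assms Hom_Ob by metis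
  finally show ?thesis using hom_group_ops(8) Comp_in_Hom[OF assms]
      Comp_in_Hom[OF assms(1) Neg_Hom[OF assms(2)]] assms Hom_Ob by metis
qed

lemma Comp_Sub: "f \<in> Hom C X Y \<Longrightarrow> g \<in> Hom C X Y \<Longrightarrow> h \<in> Hom C Y Z \<Longrightarrow>
    h \<cdot> Sub C f g = Sub C (h \<cdot> f) (h \<cdot> g)"
  unfolding Sub_def using Comp_Add_right Neg_Hom Comp_Neg by metis

lemma Sub_Comp: "f \<in> Hom C X Y \<Longrightarrow> g \<in> Hom C Y Z \<Longrightarrow> h \<in> Hom C Y Z \<Longrightarrow>
    Sub C g h \<cdot> f = Sub C (g \<cdot> f) (h \<cdot> f)"
  unfolding Sub_def using Comp_Add_left Neg_Hom Neg_Comp by metis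

lemma zero_object_Hom:
  assumes "is_zero_object C N"
  shows "X \<in> Ob C \<Longrightarrow> f \<in> Hom C N X \<Longrightarrow> f = Zero C N X"
    and "X \<in> Ob C \<Longrightarrow> f \<in> Hom C X N \<Longrightarrow> f = Zero C X N"
  using assms Zero_Hom unfolding is_zero_object_def by metis+

lemma zero_objectI:
  assumes "N \<in> Ob C" "Idn C N = Zero C N N" shows "is_zero_object C N"
proof -
  have "f = Zero C N X" if "f \<in> Hom C N X" "X \<in> Ob C" for f X
    using Comp_Idn_right[OF that(1)] Comp_Zero[OF that(1) assms(1)] assms(2) by simp
  moreover have "f = Zero C X N" if "f \<in> Hom C X N" "X \<in> Ob C" for f X
    using Comp_Idn_left[OF that(1)] Zero_Comp[OF that(1) assms(1)] assms(2) by simp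
  ultimately show ?thesis unfolding is_zero_object_def using assms(1) Zero_Hom by metis
qed

end

section \<open>Weak cokernels and distinguished triangles\<close>

text \<open>
  One half of the exactness of a triangle, which suffices because an additive functor that turns such
  pairs into exact pairs is cohomological. The notion is invariant under the shift without any change
  of sign. This isolates the sign in the rotation axiom from all later arguments.
\<close>
definition weak_cokernel_pair :: "('o, 'm, 'x) addcat_scheme \<Rightarrow> 'm \<Rightarrow> 'm \<Rightarrow> bool" where
  "weak_cokernel_pair C f g \<longleftrightarrow> f \<in> Arr C \<and> g \<in> Arr C \<and> Cod C f = Dom C g \<and>
     Comp C g f = Zero C (Dom C f) (Cod C g) \<and>
     (\<forall>W\<in>Ob C. \<forall>m \<in> Hom C (Dom C g) W. Comp C m f = Zero C (Dom C f) W \<longrightarrow>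
        (\<exists>m' \<in> Hom C (Cod C g) W. m = Comp C m' g))"

lemma weak_cokernel_pair_factor:
  assumes "weak_cokernel_pair C f g" "category C" "m \<in> Hom C Y W" "g \<in> Hom C Y Z" "f \<in> Hom C X Y"
    "Comp C m f = Zero C X W"
  obtains m' where "m' \<in> Hom C Z W" "m = Comp C m' g"
proof -
  have "W \<in> Ob C" using assms(2,3) category.Hom_Ob by metis
  then show ?thesis using assms that unfolding weak_cokernel_pair_def Hom_def by fastforce
qed

context triangulated_category
begin

abbreviation "T \<equiv> FOb (Shift C)"
abbreviation "Ta \<equiv> FArr (Shift C)"

lemma shift_1 [simp]: "shift_ob C 1 = T" "shift_arr C 1 = Ta"
  by (auto simp: shift_ob_def shift_arr_def)

lemma T_Ob: "X \<in> Ob C \<Longrightarrow> T X \<in> Ob C"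
  using shift_bij_Ob bij_betwE by metis

lemma is_functor_shift: "is_functor C C (Shift C)"
  using shift_additive by (simp add: is_additive_functor_def)

lemma Ta_Hom: "f \<in> Hom C X Y \<Longrightarrow> Ta f \<in> Hom C (T X) (T Y)"
  using is_functor_shift Hom_Ob unfolding is_functor_def by metis

lemma Ta_Idn: "X \<in> Ob C \<Longrightarrow> Ta (Idn C X) = Idn C (T X)"
  using is_functor_shift unfolding is_functor_def by metis

lemma Ta_Comp: "f \<in> Hom C X Y \<Longrightarrow> g \<in> Hom C Y Z \<Longrightarrow> Ta (g \<cdot> f) = Ta g \<cdot> Ta f"
  using is_functor_shift Hom_Ob unfolding is_functor_def by metis

lemma Ta_Add: "f \<in> Hom C X Y \<Longrightarrow> g \<in> Hom C X Y \<Longrightarrow> Ta (Add C f g) = Add C (Ta f) (Ta g)"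
  using shift_additive Hom_Ob unfolding is_additive_functor_def by metis

lemma Ta_Zero: assumes "X \<in> Ob C" "Y \<in> Ob C" shows "Ta (Zero C X Y) = Zero C (T X) (T Y)"
  using Ta_Add[OF Zero_Hom Zero_Hom, OF assms assms] Ta_Hom[OF Zero_Hom[OF assms]]
    Add_Zero[OF Zero_Hom[OF assms]] hom_group_ops(12)[OF T_Ob T_Ob, OF assms] by simp

lemma Ta_full: assumes "X \<in> Ob C" "Y \<in> Ob C" "g \<in> Hom C (T X) (T Y)"
  obtains f where "f \<in> Hom C X Y" "Ta f = g"
proof -
  obtain f where f: "f \<in> Arr C" "Ta f = g"
    using shift_bij_Arr assms(3) unfolding Hom_def bij_betw_def by (metis (no_types, lifting) image_iff mem_Collect_eq)
  have D: "f \<in> Hom C (Dom C f) (Cod C f)" using f by (simp add: Hom_def)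
  have "T (Dom C f) = T X" "T (Cod C f) = T Y"
    using Ta_Hom[OF D] f assms(3) by (auto simp: Hom_def)
  then have "Dom C f = X" "Cod C f = Y"
    using shift_bij_Ob assms Hom_Ob[OF D] unfolding bij_betw_def inj_on_def by auto
  then show ?thesis using that D f by blast
qed

lemma Ta_inj: "f \<in> Hom C X Y \<Longrightarrow> g \<in> Hom C X' Y' \<Longrightarrow> Ta f = Ta g \<Longrightarrow> f = g"
  using shift_bij_Arr unfolding Hom_def bij_betw_def inj_on_def by auto

lemma T_surj: assumes "X \<in> Ob C" obtains X' where "X' \<in> Ob C" "T X' = X"
  using assms shift_bij_Ob unfolding bij_betw_def by (metis image_iff)

lemma distinguishedD:
  assumes "distinguished C X Y Z f g h"
  shows "f \<in> Hom C X Y" "g \<in> Hom C Y Z" "h \<in> Hom C Z (T X)"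
  using assms by (auto simp: distinguished_def is_triangle_def)

lemma rotate:
  assumes "distinguished C X Y Z f g h"
  shows "distinguished C Y Z (T X) g h (Neg C (Ta f))"
  using assms Tri_rotation[of X Y Z f g h] distinguishedD[OF assms] Neg_Hom Ta_Hom
  by (auto simp: distinguished_def is_triangle_def)

lemma rotate_back:
  assumes "f \<in> Hom C X Y" "distinguished C Y Z (T X) g h (Neg C (Ta f))"
  shows "distinguished C X Y Z f g h"
  using assms Tri_rotation[of X Y Z f g h] distinguishedD[OF assms(2)]
  by (auto simp: distinguished_def is_triangle_def)

lemma zero_obj: obtains N where "is_zero_object C N" "N \<in> Ob C"
  using ex_zero_object unfolding is_zero_object_def by metis

lemma T_zero_object: assumes "is_zero_object C N" shows "is_zero_object C (T N)"
proof (rule zero_objectI)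
  have N: "N \<in> Ob C" using assms by (simp add: is_zero_object_def)
  show "T N \<in> Ob C" using T_Ob N .
  have "Idn C N = Zero C N N" using zero_object_Hom(1)[OF assms N] Idn_in_Hom N by metis
  then show "Idn C (T N) = Zero C (T N) (T N)" using Ta_Idn[OF N] Ta_Zero[OF N N] by simp
qed

lemma identity_triangle:
  assumes "X \<in> Ob C" "is_zero_object C N"
  shows "distinguished C X X N (Idn C X) (Zero C X N) (Zero C N (T X))"
proof -
  have N: "N \<in> Ob C" using assms by (simp add: is_zero_object_def)
  show ?thesis using Tri_identity[OF assms] Zero_Hom N T_Ob assms Idn_in_Hom
    by (auto simp: distinguished_def is_triangle_def)
qed

lemma coidentity_triangle:
  assumes X: "X \<in> Ob C" and N: "is_zero_object C N"
  shows "distinguished C N X X (Zero C N X) (Idn C X) (Zero C X (T N))"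
proof (rule rotate_back)
  have NO: "N \<in> Ob C" using N by (simp add: is_zero_object_def)
  show "Zero C N X \<in> Hom C N X" using Zero_Hom NO X .
  have "Neg C (Ta (Zero C N X)) = Zero C (T N) (T X)"
    by (rule zero_object_Hom(1)[OF T_zero_object[OF N]]) (simp_all add: T_Ob X NO Neg_Hom Ta_Hom Zero_Hom)
  then show "distinguished C X X (T N) (Idn C X) (Zero C X (T N)) (Neg C (Ta (Zero C N X)))"
    using identity_triangle[OF X T_zero_object[OF N]] by simp
qed

lemma triangle_Comp:
  assumes D: "distinguished C X Y Z f g h" shows "g \<cdot> f = Zero C X Z"
proof -
  obtain N where N: "is_zero_object C N" "N \<in> Ob C" by (rule zero_obj)
  have f: "f \<in> Hom C X Y" and g: "g \<in> Hom C Y Z" using distinguishedD[OF D] by auto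
  have X: "X \<in> Ob C" and Z: "Z \<in> Ob C" using f g Hom_Ob by auto
  have "\<exists>c\<in>Hom C N Z. c \<cdot> Zero C X N = g \<cdot> f \<and> shift_arr C 1 (Idn C X) \<cdot> Zero C N (T X) = h \<cdot> c"
    by (rule Tri_morphism[OF identity_triangle[OF X N(1)] D]) (simp_all add: Idn_in_Hom X f)
  then show ?thesis using Comp_Zero X by force
qed

lemma triangle_factor_right:
  assumes D: "distinguished C X Y Z f g h" and m: "m \<in> Hom C Y W" "m \<cdot> f = Zero C X W"
  obtains m' where "m' \<in> Hom C Z W" "m = m' \<cdot> g"
proof -
  obtain N where N: "is_zero_object C N" "N \<in> Ob C" by (rule zero_obj)
  have f: "f \<in> Hom C X Y" using distinguishedD[OF D] by auto
  have X: "X \<in> Ob C" and W: "W \<in> Ob C" using f m Hom_Ob by auto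
  have "\<exists>c\<in>Hom C Z W. c \<cdot> g = Idn C W \<cdot> m \<and> shift_arr C 1 (Zero C X N) \<cdot> h = Zero C W (T N) \<cdot> c"
    by (rule Tri_morphism[OF D coidentity_triangle[OF W N(1)]])
       (use m Zero_Comp[OF Zero_Hom[OF X N(2)] W] X N Zero_Hom in auto)
  then show ?thesis using that Comp_Idn_left[OF m(1)] by metis
qed

text \<open>
  The dual of \<open>triangle_factor_right\<close> needs the shift: a triangle with third vertex \<open>0\<close> is rotated
  so that the axiom on morphisms of triangles produces the factorization after applying the shift.
\<close>
lemma triangle_factor_left:
  assumes D: "distinguished C X Y Z f g h" and n: "n \<in> Hom C W Y" "g \<cdot> n = Zero C W Z"
  obtains n' where "n' \<in> Hom C W X" "n = f \<cdot> n'"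
proof -
  obtain N where N: "is_zero_object C N" "N \<in> Ob C" by (rule zero_obj)
  have f: "f \<in> Hom C X Y" and g: "g \<in> Hom C Y Z" using distinguishedD[OF D] by auto
  have X: "X \<in> Ob C" and W: "W \<in> Ob C" and Z: "Z \<in> Ob C" using f g n Hom_Ob by auto
  have "\<exists>c\<in>Hom C (T W) (T X). c \<cdot> Zero C N (T W) = h \<cdot> Zero C N Z \<and>
      shift_arr C 1 n \<cdot> Neg C (Ta (Idn C W)) = Neg C (Ta f) \<cdot> c"
    by (rule Tri_morphism[OF rotate[OF identity_triangle[OF W N(1)]] rotate[OF D]])
       (use n Zero_Comp[OF Zero_Hom[OF W N(2)] Z] Z N Zero_Hom in auto)
  then obtain c where c: "c \<in> Hom C (T W) (T X)" "Ta n \<cdot> Neg C (Ta (Idn C W)) = Neg C (Ta f) \<cdot> c"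
    by auto
  obtain n' where n': "n' \<in> Hom C W X" "Ta n' = c" using Ta_full[OF W X c(1)] .
  have "Neg C (Ta n) = Neg C (Ta (f \<cdot> n'))"
    using c(2) Comp_Neg[OF Ta_Hom Ta_Hom, OF Idn_in_Hom[OF W] n(1)] Comp_Idn_right[OF Ta_Hom[OF n(1)]]
      Ta_Idn[OF W] Neg_Comp[OF c(1) Ta_Hom[OF f]] Ta_Comp[OF n'(1) f] n'(2) by simp
  then have "Ta n = Ta (f \<cdot> n')" using Neg_Neg Ta_Hom n(1) Comp_in_Hom[OF n'(1) f] by metis
  then show ?thesis using that n'(1) Ta_inj n(1) Comp_in_Hom[OF n'(1) f] by metis
qed

lemma triangle_weak_cokernel: "distinguished C X Y Z f g h \<Longrightarrow> weak_cokernel_pair C f g"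
  using triangle_factor_right triangle_Comp distinguishedD
  unfolding weak_cokernel_pair_def by (smt (verit) Hom_iff)

lemma weak_cokernel_Neg:
  assumes w: "weak_cokernel_pair C f (Neg C g)" and f: "f \<in> Hom C X Y" and g: "g \<in> Hom C Y Z"
  shows "weak_cokernel_pair C f g"
proof -
  have X: "X \<in> Ob C" "Z \<in> Ob C" using f g Hom_Ob by auto
  have "Neg C g \<cdot> f = Zero C X Z" using w f Neg_Hom[OF g] unfolding weak_cokernel_pair_def Hom_def by auto
  then have "g \<cdot> f = Zero C X Z"
    by (metis Neg_Comp f g Comp_in_Hom X Zero_Hom Neg_Neg hom_group_ops(6) Zero_Add Neg_Hom)
  moreover have "\<exists>m' \<in> Hom C Z W. m = m' \<cdot> g" if m: "m \<in> Hom C Y W" "m \<cdot> f = Zero C X W" for m W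
  proof -
    obtain m' where m': "m' \<in> Hom C Z W" "m = m' \<cdot> Neg C g"
      using weak_cokernel_pair_factor[OF w category_axioms m(1) Neg_Hom[OF g] f m(2)] .
    then have "m = Neg C m' \<cdot> g" using Comp_Neg[OF g m'(1)] Neg_Comp[OF g m'(1)] by simp
    then show ?thesis using Neg_Hom[OF m'(1)] by blast
  qed
  ultimately show ?thesis using f g unfolding weak_cokernel_pair_def by (auto simp: Hom_def)
qed

lemma triangle_weak_cokernels:
  assumes "distinguished C X Y Z f g h"
  shows "weak_cokernel_pair C f g" "weak_cokernel_pair C g h" "weak_cokernel_pair C h (Ta f)"
proof -
  show "weak_cokernel_pair C f g" "weak_cokernel_pair C g h"
    using triangle_weak_cokernel assms rotate by blast+
  show "weak_cokernel_pair C h (Ta f)"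
    by (rule weak_cokernel_Neg) (use triangle_weak_cokernel[OF rotate[OF rotate[OF assms]]]
        distinguishedD[OF assms] Ta_Hom in auto)
qed

lemma weak_cokernel_shift:
  assumes f: "f \<in> Hom C X Y" and g: "g \<in> Hom C Y Z"
  shows "weak_cokernel_pair C (Ta f) (Ta g) \<longleftrightarrow> weak_cokernel_pair C f g"
proof -
  have O: "X \<in> Ob C" "Y \<in> Ob C" "Z \<in> Ob C" using f g Hom_Ob by auto
  have Tf: "Ta f \<in> Hom C (T X) (T Y)" and Tg: "Ta g \<in> Hom C (T Y) (T Z)" using f g Ta_Hom by auto
  have z: "Ta m \<cdot> Ta f = Zero C (T X) (T W) \<longleftrightarrow> m \<cdot> f = Zero C X W" if m: "m \<in> Hom C Y W" for m W
    using Ta_Comp[OF f m] Ta_Zero[OF O(1)] Ta_inj[OF Comp_in_Hom[OF f m] Zero_Hom[OF O(1)]] Hom_Ob[OF m] by metis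
  have fac: "(\<exists>m' \<in> Hom C (T Z) (T W). Ta m = m' \<cdot> Ta g) \<longleftrightarrow> (\<exists>m' \<in> Hom C Z W. m = m' \<cdot> g)"
    if m: "m \<in> Hom C Y W" for m W
  proof
    assume "\<exists>m' \<in> Hom C (T Z) (T W). Ta m = m' \<cdot> Ta g"
    then obtain m' where m': "m' \<in> Hom C (T Z) (T W)" "Ta m = m' \<cdot> Ta g" by blast
    obtain n where n: "n \<in> Hom C Z W" "Ta n = m'" using Ta_full[OF O(3) _ m'(1)] Hom_Ob[OF m] by blast
    then have "m = n \<cdot> g" using Ta_inj[OF m Comp_in_Hom[OF g n(1)]] Ta_Comp[OF g n(1)] m' by simp
    then show "\<exists>m' \<in> Hom C Z W. m = m' \<cdot> g" using n by blast
  next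
    assume "\<exists>m' \<in> Hom C Z W. m = m' \<cdot> g"
    then show "\<exists>m' \<in> Hom C (T Z) (T W). Ta m = m' \<cdot> Ta g" using Ta_Comp[OF g] Ta_Hom by blast
  qed
  have all: "(\<forall>W\<in>Ob C. \<forall>m \<in> Hom C (T Y) W. m \<cdot> Ta f = Zero C (T X) W \<longrightarrow> (\<exists>m' \<in> Hom C (T Z) W. m = m' \<cdot> Ta g))
     \<longleftrightarrow> (\<forall>W\<in>Ob C. \<forall>m \<in> Hom C Y W. m \<cdot> f = Zero C X W \<longrightarrow> (\<exists>m' \<in> Hom C Z W. m = m' \<cdot> g))" (is "?L = ?R")
  proof
    assume L: ?L
    show ?R
      by (intro ballI impI) (use L z fac T_Ob Ta_Hom in metis)
  next
    assume R: ?R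
    show ?L
    proof (intro ballI impI)
      fix W m assume W: "W \<in> Ob C" and m: "m \<in> Hom C (T Y) W" and mz: "m \<cdot> Ta f = Zero C (T X) W"
      obtain W' where W': "W' \<in> Ob C" "T W' = W" using T_surj[OF W] .
      obtain n where n: "n \<in> Hom C Y W'" "Ta n = m" using Ta_full[OF O(2) W'(1)] m W' by blast
      show "\<exists>m' \<in> Hom C (T Z) W. m = m' \<cdot> Ta g"
        using R W' n mz z[OF n(1)] fac[OF n(1)] by metis
    qed
  qed
  have e: "Dom C f = X" "Cod C f = Y" "Dom C g = Y" "Cod C g = Z" "f \<in> Arr C" "g \<in> Arr C"
    "Dom C (Ta f) = T X" "Cod C (Ta f) = T Y" "Dom C (Ta g) = T Y" "Cod C (Ta g) = T Z"
    "Ta f \<in> Arr C" "Ta g \<in> Arr C"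
    using f g Tf Tg by (auto simp: Hom_def)
  show ?thesis unfolding weak_cokernel_pair_def using all z[OF g] by (simp add: e)
qed

lemma shift_arr_Arr: "f \<in> Arr C \<Longrightarrow> shift_arr C n f \<in> Arr C"
proof -
  assume f: "f \<in> Arr C"
  have 1: "(Ta ^^ k) f \<in> Arr C" for k
    by (induction k) (use f shift_bij_Arr in \<open>auto dest: bij_betwE\<close>)
  have 2: "(inv_into (Arr C) Ta ^^ k) f \<in> Arr C" for k
    by (induction k) (use f shift_bij_Arr in \<open>auto simp: bij_betw_def intro!: inv_into_into\<close>)
  show ?thesis using 1 2 by (simp add: shift_arr_def)
qed

lemma shift_arr_Suc:
  assumes "f \<in> Arr C" shows "Ta (shift_arr C n f) = shift_arr C (n + 1) f"
proof (cases "0 \<le> n")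
  case True
  then have "nat (n + 1) = Suc (nat n)" by simp
  then show ?thesis using True by (simp add: shift_arr_def)
next
  case False
  then obtain k where k: "nat (- n) = Suc k" "nat (- (n + 1)) = k"
    using not0_implies_Suc[of "nat (- n)"] by fastforce
  let ?i = "inv_into (Arr C) Ta"
  have "(?i ^^ k) f \<in> Arr C" for k
    by (induction k) (use assms shift_bij_Arr in \<open>auto simp: bij_betw_def intro!: inv_into_into\<close>)
  then have e: "Ta (?i ((?i ^^ k) f)) = (?i ^^ k) f"
    using shift_bij_Arr unfolding bij_betw_def by (metis f_inv_into_f)
  show ?thesis
  proof (cases "n + 1 = 0")
    case True
    then show ?thesis using False k e by (simp add: shift_arr_def)
  next
    case F: False
    then show ?thesis using False k e by (simp add: shift_arr_def)
  qed
qed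

lemma shift_arr_0: "shift_arr C 0 f = f" by (simp add: shift_arr_def)

lemma Arr_shift_Dom_Cod:
  assumes "f \<in> Arr C" shows "Dom C (Ta f) = T (Dom C f)" "Cod C (Ta f) = T (Cod C f)"
  using Ta_Hom[of f "Dom C f" "Cod C f"] assms by (auto simp: Hom_def)

lemma weak_cokernel_shift_Arr:
  assumes "f \<in> Arr C" "g \<in> Arr C"
  shows "weak_cokernel_pair C (Ta f) (Ta g) \<longleftrightarrow> weak_cokernel_pair C f g"
proof (cases "Cod C f = Dom C g")
  case True
  then show ?thesis using weak_cokernel_shift[of f "Dom C f" "Dom C g" g "Cod C g"] assms by (simp add: Hom_def)
next
  case False
  then have "T (Cod C f) \<noteq> T (Dom C g)"
    using shift_bij_Ob assms Dom_in_Ob Cod_in_Ob unfolding bij_betw_def inj_on_def by auto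
  then show ?thesis using False assms Arr_shift_Dom_Cod by (simp add: weak_cokernel_pair_def)
qed

text \<open>
  The negative powers of the shift are defined through an inverse function on arrows, so the claim is
  moved along the integers one step at a time in both directions.
\<close>
lemma weak_cokernel_shift_arr:
  assumes "weak_cokernel_pair C f g"
  shows "weak_cokernel_pair C (shift_arr C n f) (shift_arr C n g)"
proof -
  have A: "f \<in> Arr C" "g \<in> Arr C" using assms by (auto simp: weak_cokernel_pair_def)
  have s: "weak_cokernel_pair C (shift_arr C (n+1) f) (shift_arr C (n+1) g) \<longleftrightarrow>
    weak_cokernel_pair C (shift_arr C n f) (shift_arr C n g)" for n
    using weak_cokernel_shift_Arr shift_arr_Suc A shift_arr_Arr by metis
  show ?thesis
  proof (induction n rule: int_induct[where k = 0])
    case base then show ?case using assms by (simp add: shift_arr_0)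
  next
    case (step1 i) then show ?case using s by simp
  next
    case (step2 i) then show ?case using s[of "i - 1"] by simp
  qed
qed

end

section \<open>Small sets, small abelian groups and presheaves\<close>

lemma small_image: "small U A \<Longrightarrow> small U (f ` A)"
  unfolding small_def by (rule lesspoll_trans1[OF image_lepoll])

lemma small_inj_on: "inj_on f A \<Longrightarrow> f ` A \<subseteq> B \<Longrightarrow> small U B \<Longrightarrow> small U A"
  unfolding small_def by (rule lesspoll_trans1[of _ B]) (auto simp: lepoll_def)

lemma universe_infinite:
  assumes "universe (U :: 'u itself)" shows "infinite (UNIV :: 'u set)"
proof -
  have "(UNIV :: nat set) \<prec> (UNIV :: 'u set)" using assms by (simp add: universe_def small_def)
  then show ?thesis by (meson infinite_UNIV_nat lesspoll_def lepoll_def finite_imageD finite_subset)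
qed

lemma small_finite:
  assumes "universe (U :: 'u itself)" "finite A" shows "small U A"
proof -
  have "A \<prec> (UNIV :: 'u set)" using finite_lesspoll_infinite universe_infinite assms by blast
  then show ?thesis by (simp add: small_def)
qed

text \<open>
  A small set is identified with a set of elements of the universe by an arbitrary injection; the
  target type of this constant is the universe.
\<close>
definition small_emb :: "'a set \<Rightarrow> 'a \<Rightarrow> 'u" where
  "small_emb S = (SOME e. inj_on e S)"

lemma small_emb_inj:
  assumes "small TYPE('u) S" shows "inj_on (small_emb S :: 'a \<Rightarrow> 'u) S"
proof -
  have "\<exists>e :: 'a \<Rightarrow> 'u. inj_on e S"
    using assms unfolding small_def lesspoll_def lepoll_def by blast
  then show ?thesis unfolding small_emb_def by (rule someI_ex)
qed

definition small_copy :: "'g monoid \<Rightarrow> 'u monoid" where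
  "small_copy G = (let e = small_emb (carrier G); d = inv_into (carrier G) e in
     \<lparr>carrier = e ` carrier G, mult = (\<lambda>x y. e (d x \<otimes>\<^bsub>G\<^esub> d y)), one = e \<one>\<^bsub>G\<^esub>\<rparr>)"

abbreviation copy_map :: "'g monoid \<Rightarrow> 'g \<Rightarrow> 'u" where
  "copy_map G \<equiv> small_emb (carrier G)"

abbreviation copy_inv :: "'g monoid \<Rightarrow> 'u \<Rightarrow> 'g" where
  "copy_inv G \<equiv> inv_into (carrier G) (copy_map G)"

lemma small_copy:
  fixes G :: "'g monoid"
  assumes "comm_group G" "small TYPE('u) (carrier G)"
  shows small_copy_group: "comm_group (small_copy G :: 'u monoid)"
    and small_copy_small: "small TYPE('u) (carrier (small_copy G :: 'u monoid))"
    and small_copy_iso: "copy_map G \<in> iso G (small_copy G :: 'u monoid)"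
    and small_copy_carrier: "carrier (small_copy G :: 'u monoid) = copy_map G ` carrier G"
    and copy_inv_copy_map: "x \<in> carrier G \<Longrightarrow> copy_inv G (copy_map G x :: 'u) = x"
proof -
  interpret G: comm_group G by fact
  have inj: "inj_on (copy_map G :: 'g \<Rightarrow> 'u) (carrier G)" by (rule small_emb_inj[OF assms(2)])
  show c: "carrier (small_copy G :: 'u monoid) = copy_map G ` carrier G"
    by (simp add: small_copy_def Let_def)
  show iso: "copy_map G \<in> iso G (small_copy G :: 'u monoid)"
    using inj by (auto simp: iso_def hom_def bij_betw_def small_copy_def Let_def)
  have "small_copy G\<lparr>one := copy_map G \<one>\<^bsub>G\<^esub>\<rparr> = (small_copy G :: 'u monoid)"
    by (simp add: small_copy_def Let_def)
  then show "comm_group (small_copy G :: 'u monoid)"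
    using G.iso_imp_img_comm_group[OF iso] by simp
  show "small TYPE('u) (carrier (small_copy G :: 'u monoid))"
    unfolding c by (rule small_image[OF assms(2)])
  show "x \<in> carrier G \<Longrightarrow> copy_inv G (copy_map G x :: 'u) = x"
    using inj by simp
qed

lemma small_copy_mult:
  fixes G :: "'g monoid"
  assumes "comm_group G" "small TYPE('u) (carrier G)" "x \<in> carrier G" "y \<in> carrier G"
  shows "(copy_map G x :: 'u) \<otimes>\<^bsub>small_copy G\<^esub> copy_map G y = copy_map G (x \<otimes>\<^bsub>G\<^esub> y)"
  using small_copy_iso[OF assms(1,2)] assms(3,4) hom_mult[of "copy_map G" G "small_copy G :: 'u monoid" x y]
  by (simp add: iso_def)

lemma small_copy_one:
  fixes G :: "'g monoid"
  shows "\<one>\<^bsub>small_copy G\<^esub> = (copy_map G \<one>\<^bsub>G\<^esub> :: 'u)"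
  by (simp add: small_copy_def Let_def)

lemma Hom_Ab:
  "a \<in> Hom Ab G H \<longleftrightarrow> G \<in> Ob Ab \<and> H \<in> Ob Ab \<and>
     (\<exists>f. a = (G, H, f) \<and> f \<in> hom G H \<and> f \<in> extensional (carrier G))"
  by (cases a) (auto simp: Ab_def Hom_def)

lemma Ob_Ab: "(G :: 'u monoid) \<in> Ob Ab \<longleftrightarrow> comm_group G \<and> small TYPE('u) (carrier G)"
  by (simp add: Ab_def)

lemma Hom_op: "Hom (op_category C) X Y = Hom C Y X"
  by (auto simp: op_category_def Hom_def)

lemma Hom_full: "Hom (full_subcategory C D) X Y = (if X \<in> D \<and> Y \<in> D then Hom C X Y else {})"
  by (auto simp: full_subcategory_def Hom_def)

lemma op_category_simps [simp]:
  "Ob (op_category C) = Ob C" "Idn (op_category C) = Idn C" "Comp (op_category C) g f = Comp C f g"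
  "Add (op_category C) = Add C"
  by (simp_all add: op_category_def)

lemma full_subcategory_simps [simp]:
  "Ob (full_subcategory C D) = Ob C \<inter> D" "Idn (full_subcategory C D) = Idn C"
  "Comp (full_subcategory C D) = Comp C" "Add (full_subcategory C D) = Add C"
  by (simp_all add: full_subcategory_def)

lemma Ab_simps [simp]:
  "Idn Ab G = (G, G, \<lambda>x\<in>carrier G. x)"
  "Comp Ab (H', K, g) (G, H, f) = (G, K, \<lambda>x\<in>carrier G. g (f x))"
  "Add Ab (G, H, f) (G', H', g) = (G, H, \<lambda>x\<in>carrier G. f x \<otimes>\<^bsub>H\<^esub> g x)"
  "Dom Ab (G, H, f) = G" "Cod Ab (G, H, f) = H"
  by (simp_all add: Ab_def)

text \<open>
  An additive contravariant functor on the full subcategory with object class \<open>D\<close>, given by its groups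
  and restriction maps. The groups are small, but their elements may have any type; this allows
  hom-groups, quotient groups and groups of natural transformations to be used without re-encoding.
\<close>
locale presheaf = preadditive_category C
  for C :: "('o, 'm, 'x) addcat_scheme" (structure) +
  fixes U :: "'u itself" and D :: "'o set" and G :: "'o \<Rightarrow> 'g monoid" and r :: "'m \<Rightarrow> 'g \<Rightarrow> 'g"
  assumes D_Ob: "D \<subseteq> Ob C"
    and G_comm: "X \<in> D \<Longrightarrow> comm_group (G X)"
    and G_small: "X \<in> D \<Longrightarrow> small U (carrier (G X))"
    and r_hom: "\<lbrakk>f \<in> Hom C X Y; X \<in> D; Y \<in> D\<rbrakk> \<Longrightarrow> r f \<in> hom (G Y) (G X)"
    and r_Idn: "\<lbrakk>X \<in> D; x \<in> carrier (G X)\<rbrakk> \<Longrightarrow> r (Idn C X) x = x"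
    and r_Comp: "\<lbrakk>f \<in> Hom C X Y; g \<in> Hom C Y Z; X \<in> D; Y \<in> D; Z \<in> D; z \<in> carrier (G Z)\<rbrakk> \<Longrightarrow>
      r (g \<cdot> f) z = r f (r g z)"
    and r_Add: "\<lbrakk>f \<in> Hom C X Y; g \<in> Hom C X Y; X \<in> D; Y \<in> D; y \<in> carrier (G Y)\<rbrakk> \<Longrightarrow>
      r (Add C f g) y = r f y \<otimes>\<^bsub>G X\<^esub> r g y"
begin

lemma G_group: "X \<in> D \<Longrightarrow> group (G X)"
  using G_comm comm_group.axioms(2) by blast

lemma r_closed: "\<lbrakk>f \<in> Hom C X Y; X \<in> D; Y \<in> D; y \<in> carrier (G Y)\<rbrakk> \<Longrightarrow> r f y \<in> carrier (G X)"
  by (rule hom_in_carrier[OF r_hom])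

lemma r_mult: "\<lbrakk>f \<in> Hom C X Y; X \<in> D; Y \<in> D; y \<in> carrier (G Y); z \<in> carrier (G Y)\<rbrakk> \<Longrightarrow>
    r f (y \<otimes>\<^bsub>G Y\<^esub> z) = r f y \<otimes>\<^bsub>G X\<^esub> r f z"
  by (rule hom_mult[OF r_hom])

lemma r_group_hom: "\<lbrakk>f \<in> Hom C X Y; X \<in> D; Y \<in> D\<rbrakk> \<Longrightarrow> group_hom (G Y) (G X) (r f)"
  by (simp add: r_hom G_group group_hom.intro group_hom_axioms.intro)

lemma r_one: "\<lbrakk>f \<in> Hom C X Y; X \<in> D; Y \<in> D\<rbrakk> \<Longrightarrow> r f \<one>\<^bsub>G Y\<^esub> = \<one>\<^bsub>G X\<^esub>"
  using r_group_hom group_hom.hom_one by metis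

lemma r_inv: "\<lbrakk>f \<in> Hom C X Y; X \<in> D; Y \<in> D; y \<in> carrier (G Y)\<rbrakk> \<Longrightarrow>
    r f (inv\<^bsub>G Y\<^esub> y) = inv\<^bsub>G X\<^esub> r f y"
  using r_group_hom group_hom.hom_inv by metis

lemma r_Zero:
  assumes "X \<in> D" "Y \<in> D" "y \<in> carrier (G Y)" shows "r (Zero C X Y) y = \<one>\<^bsub>G X\<^esub>"
proof -
  have Z: "Zero C X Y \<in> Hom C X Y" using Zero_Hom D_Ob assms by blast
  have "r (Zero C X Y) y \<otimes>\<^bsub>G X\<^esub> r (Zero C X Y) y = r (Zero C X Y) y"
    using r_Add[OF Z Z assms] Add_Zero[OF Z] by simp
  then show ?thesis using group.r_cancel_one[OF G_group[OF assms(1)]] r_closed[OF Z assms] by simp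
qed

lemma r_Sub:
  assumes f: "f \<in> Hom C X Y" and g: "g \<in> Hom C X Y" and X: "X \<in> D" and Y: "Y \<in> D" and y: "y \<in> carrier (G Y)"
  shows "r (Sub C f g) y = r f y \<otimes>\<^bsub>G X\<^esub> inv\<^bsub>G X\<^esub> r g y"
proof -
  interpret GX: group "G X" using G_group X .
  have "r f y = r (Sub C f g) y \<otimes>\<^bsub>G X\<^esub> r g y"
    using r_Add[OF Sub_Hom[OF f g] g X Y y] Add_Sub[OF f g] by simp
  then show ?thesis
    using r_closed[OF _ X Y y] f g Sub_Hom[OF f g] GX.inv_solve_right by metis
qed

end

text \<open>
  The same functor with all groups replaced by copies inside the universe, as an additive functor to
  the category of small abelian groups.
\<close>
definition presheaf_functor ::
  "('o, 'm, 'x) addcat_scheme \<Rightarrow> ('o \<Rightarrow> 'g monoid) \<Rightarrow> ('m \<Rightarrow> 'g \<Rightarrow> 'g) \<Rightarrow>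
   ('o, 'm, 'u monoid, 'u ab_arrow) functr" where
  "presheaf_functor C G r = \<lparr>FOb = (\<lambda>X. small_copy (G X)),
     FArr = (\<lambda>f. (small_copy (G (Cod C f)), small_copy (G (Dom C f)),
       \<lambda>u\<in>carrier (small_copy (G (Cod C f))).
         copy_map (G (Dom C f)) (r f (copy_inv (G (Cod C f)) u))))\<rparr>"

lemma FOb_presheaf_functor [simp]: "FOb (presheaf_functor C G r) X = small_copy (G X)"
  by (simp add: presheaf_functor_def)

context presheaf
begin

lemma small_G: "X \<in> D \<Longrightarrow> small TYPE('u) (carrier (G X))"
  using G_small by (simp add: small_def)

lemma copy_G:
  assumes "X \<in> D"
  shows copy_G_group: "comm_group (small_copy (G X) :: 'u monoid)"
    and copy_G_small: "small TYPE('u) (carrier (small_copy (G X) :: 'u monoid))"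
    and copy_G_carrier: "carrier (small_copy (G X) :: 'u monoid) = copy_map (G X) ` carrier (G X)"
    and copy_G_inv: "x \<in> carrier (G X) \<Longrightarrow> copy_inv (G X) (copy_map (G X) x :: 'u) = x"
    and copy_G_mult: "x \<in> carrier (G X) \<Longrightarrow> y \<in> carrier (G X) \<Longrightarrow>
      (copy_map (G X) x :: 'u) \<otimes>\<^bsub>small_copy (G X)\<^esub> copy_map (G X) y = copy_map (G X) (x \<otimes>\<^bsub>G X\<^esub> y)"
  using small_copy[OF G_comm[OF assms] small_G[OF assms]]
    small_copy_mult[OF G_comm[OF assms] small_G[OF assms]] by auto

lemma FArr_presheaf_functor:
  "f \<in> Hom C X Y \<Longrightarrow> FArr (presheaf_functor C G r :: ('o, 'm, 'u monoid, 'u ab_arrow) functr) f =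
     (small_copy (G Y), small_copy (G X),
       \<lambda>u\<in>carrier (small_copy (G Y)). copy_map (G X) (r f (copy_inv (G Y) u)))"
  by (auto simp: presheaf_functor_def Hom_def)

lemma presheaf_functor_map:
  assumes "f \<in> Hom C X Y" "X \<in> D" "Y \<in> D" "y \<in> carrier (G Y)"
  shows "ab_map (FArr (presheaf_functor C G r) f) (copy_map (G Y) y :: 'u) = copy_map (G X) (r f y)"
  using FArr_presheaf_functor[OF assms(1)] copy_G_carrier copy_G_inv assms by simp

lemma presheaf_functor_additive:
  "is_additive_functor (op_category (full_subcategory C D)) Ab
     (presheaf_functor C G r :: ('o, 'm, 'u monoid, 'u ab_arrow) functr)" (is "is_additive_functor _ _ ?F")
proof -
  let ?e = "\<lambda>X. copy_map (G X) :: 'g \<Rightarrow> 'u"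
  have ob: "(small_copy (G X) :: 'u monoid) \<in> Ob Ab" if "X \<in> D" for X
    using copy_G_group copy_G_small that by (simp add: Ob_Ab)
  have arr: "FArr ?F f \<in> Hom Ab (small_copy (G Y)) (small_copy (G X))"
    if f: "f \<in> Hom C X Y" and X: "X \<in> D" and Y: "Y \<in> D" for f X Y
  proof -
    have "(\<lambda>u\<in>carrier (small_copy (G Y) :: 'u monoid). ?e X (r f (copy_inv (G Y) u)))
        \<in> hom (small_copy (G Y)) (small_copy (G X))"
    proof (rule homI)
      let ?h = "\<lambda>u\<in>carrier (small_copy (G Y) :: 'u monoid). ?e X (r f (copy_inv (G Y) u))"
      have h: "?h (?e Y y) = ?e X (r f y)" if "y \<in> carrier (G Y)" for y
        using that by (simp add: copy_G_carrier Y copy_G_inv)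
      show "?h u \<in> carrier (small_copy (G X))" if "u \<in> carrier (small_copy (G Y))" for u :: 'u
        using that h r_closed[OF f X Y] by (auto simp: copy_G_carrier X Y simp del: restrict_apply)
      show "?h (u \<otimes>\<^bsub>small_copy (G Y)\<^esub> v) = ?h u \<otimes>\<^bsub>small_copy (G X)\<^esub> ?h v"
        if uv: "u \<in> carrier (small_copy (G Y))" "v \<in> carrier (small_copy (G Y))" for u v :: 'u
      proof -
        obtain y z where y: "y \<in> carrier (G Y)" "u = ?e Y y" and z: "z \<in> carrier (G Y)" "v = ?e Y z"
          using uv unfolding copy_G_carrier[OF Y] by blast
        have yz: "y \<otimes>\<^bsub>G Y\<^esub> z \<in> carrier (G Y)"
          using y z group.is_monoid[OF G_group[OF Y]] monoid.m_closed by metis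
        show ?thesis
          using y z h[OF y(1)] h[OF z(1)] h[OF yz] r_closed[OF f X Y] r_mult[OF f X Y]
          by (simp add: copy_G_mult X Y del: restrict_apply)
      qed
    qed
    then show ?thesis unfolding FArr_presheaf_functor[OF f] Hom_Ab using ob X Y by auto
  qed
  have idn: "FArr ?F (Idn C X) = Idn Ab (small_copy (G X))" if X: "X \<in> D" for X
    using FArr_presheaf_functor[OF Idn_in_Hom[OF subsetD[OF D_Ob X]]] X
    by (auto simp: copy_G_carrier copy_G_inv r_Idn intro!: restrict_ext)
  have comp: "FArr ?F (g \<cdot> f) = Comp Ab (FArr ?F f) (FArr ?F g)"
    if "f \<in> Hom C X Y" "g \<in> Hom C Y Z" "X \<in> D" "Y \<in> D" "Z \<in> D" for f g X Y Z
    using that FArr_presheaf_functor[OF that(1)] FArr_presheaf_functor[OF that(2)]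
      FArr_presheaf_functor[OF Comp_in_Hom[OF that(1,2)]] r_closed[OF that(2,4,5)]
    by (auto simp: copy_G_carrier copy_G_inv r_Comp intro!: restrict_ext)
  have add: "FArr ?F (Add C f g) = Add Ab (FArr ?F f) (FArr ?F g)"
    if "f \<in> Hom C X Y" "g \<in> Hom C X Y" "X \<in> D" "Y \<in> D" for f g X Y
    using that FArr_presheaf_functor[OF that(1)] FArr_presheaf_functor[OF that(2)]
      FArr_presheaf_functor[OF Add_Hom[OF that(1,2)]] r_closed[OF that(2,3,4)] r_closed[OF that(1,3,4)]
    by (auto simp: copy_G_carrier copy_G_inv r_Add copy_G_mult intro!: restrict_ext)
  show ?thesis
    unfolding is_additive_functor_def is_functor_def
    using ob arr idn comp add by (simp add: Hom_op Hom_full)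
qed

lemma presheaf_functor_hom:
  assumes "f \<in> Hom C X Y" "X \<in> D" "Y \<in> D"
  shows "ab_map (FArr (presheaf_functor C G r) f) \<in> hom (small_copy (G Y)) (small_copy (G X) :: 'u monoid)"
proof -
  let ?F = "presheaf_functor C G r :: ('o, 'm, 'u monoid, 'u ab_arrow) functr"
  have "is_functor (op_category (full_subcategory C D)) Ab ?F"
    using presheaf_functor_additive by (simp add: is_additive_functor_def)
  then have "\<forall>f \<in> Hom C X Y. FArr ?F f \<in> Hom Ab (FOb ?F Y) (FOb ?F X)"
    using assms(2,3) D_Ob unfolding is_functor_def by (simp add: Hom_op Hom_full subset_iff)
  then show ?thesis using assms(1) by (auto simp: Hom_Ab)
qed

text \<open>
  Elementwise unique gluing over a family of morphisms is what makes the comparison map with the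
  product of groups bijective.
\<close>
lemma presheaf_functor_product_iso:
  assumes S: "S \<in> D" and X: "\<And>i. i \<in> I \<Longrightarrow> X i \<in> D" and \<iota>: "\<And>i. i \<in> I \<Longrightarrow> \<iota> i \<in> Hom C (X i) S"
    and ex: "\<And>x. (\<And>i. i \<in> I \<Longrightarrow> x i \<in> carrier (G (X i))) \<Longrightarrow>
      \<exists>!s. s \<in> carrier (G S) \<and> (\<forall>i\<in>I. r (\<iota> i) s = x i)"
  shows "(\<lambda>x. \<lambda>i\<in>I. ab_map (FArr (presheaf_functor C G r) (\<iota> i)) x)
    \<in> iso (small_copy (G S) :: 'u monoid) (product_group I (\<lambda>i. small_copy (G (X i))))"
proof -
  define H where "H = (presheaf_functor C G r :: ('o, 'm, 'u monoid, 'u ab_arrow) functr)"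
  let ?e = "\<lambda>X. copy_map (G X) :: 'g \<Rightarrow> 'u"
  have FOb: "FOb H X = small_copy (G X)" for X by (simp add: H_def)
  have car: "carrier (FOb H X) = ?e X ` carrier (G X)" if "X \<in> D" for X
    using copy_G_carrier[OF that] FOb by simp
  have map: "ab_map (FArr H f) (?e Y y) = ?e X (r f y)" if "f \<in> Hom C X Y" "X \<in> D" "Y \<in> D" "y \<in> carrier (G Y)" for f X Y y
    using presheaf_functor_map[OF that] by (simp add: H_def)
  have inj: "?e X x = ?e X y \<longleftrightarrow> x = y" if "X \<in> D" "x \<in> carrier (G X)" "y \<in> carrier (G X)" for X x y
    using copy_G_inv that by metis
  have maphom: "ab_map (FArr H f) \<in> hom (FOb H Y) (FOb H X)" if "f \<in> Hom C X Y" "X \<in> D" "Y \<in> D" for f X Y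
    using presheaf_functor_hom[OF that] by (simp add: H_def)
  let ?f = "\<lambda>x. \<lambda>i\<in>I. ab_map (FArr H (\<iota> i)) x"
  have h: "?f \<in> hom (FOb H S) (product_group I (\<lambda>i. FOb H (X i)))"
    by (rule homI) (use maphom[OF \<iota> X S] in \<open>auto simp: hom_mult intro: hom_in_carrier\<close>)
  have "bij_betw ?f (carrier (FOb H S)) (carrier (product_group I (\<lambda>i. FOb H (X i))))"
    unfolding bij_betw_def
  proof
    show "inj_on ?f (carrier (FOb H S))"
    proof (rule inj_onI)
      fix u v assume u: "u \<in> carrier (FOb H S)" and v: "v \<in> carrier (FOb H S)" and eq: "?f u = ?f v"
      obtain s t where s: "s \<in> carrier (G S)" "u = ?e S s" and t: "t \<in> carrier (G S)" "v = ?e S t"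
        using u v car[OF S] by auto
      have "r (\<iota> i) s = r (\<iota> i) t" if i: "i \<in> I" for i
      proof -
        have "?e (X i) (r (\<iota> i) s) = ?e (X i) (r (\<iota> i) t)"
          using fun_cong[OF eq, of i] i s t map[OF \<iota>[OF i] X[OF i] S] by simp
        then show ?thesis using inj[OF X[OF i]] r_closed[OF \<iota>[OF i] X[OF i] S] s t by blast
      qed
      then have "s = t" using ex[of "\<lambda>i. r (\<iota> i) t"] s t r_closed[OF \<iota> X S t(1)] by blast
      then show "u = v" using s t by simp
    qed
    show "?f ` carrier (FOb H S) = carrier (product_group I (\<lambda>i. FOb H (X i)))"
    proof (intro equalityI subsetI)
      fix y assume "y \<in> ?f ` carrier (FOb H S)"
      then show "y \<in> carrier (product_group I (\<lambda>i. FOb H (X i)))" using h hom_in_carrier by fast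
    next
      fix y assume y: "y \<in> carrier (product_group I (\<lambda>i. FOb H (X i)))"
      then have "\<forall>i\<in>I. \<exists>x. x \<in> carrier (G (X i)) \<and> y i = ?e (X i) x" using car X by (fastforce simp: PiE_iff)
      then obtain x where x: "\<And>i. i \<in> I \<Longrightarrow> x i \<in> carrier (G (X i)) \<and> y i = ?e (X i) (x i)" by metis
      then obtain s where s: "s \<in> carrier (G S)" "\<And>i. i \<in> I \<Longrightarrow> r (\<iota> i) s = x i" using ex[of x] by blast
      have "y = ?f (?e S s)"
        using y x s map[OF \<iota> X S] by (intro ext) (auto simp: PiE_iff extensional_def)
      then show "y \<in> ?f ` carrier (FOb H S)" using s car[OF S] by blast
    qed
  qed
  then have "?f \<in> iso (FOb H S) (product_group I (\<lambda>i. FOb H (X i)))" using h by (simp add: iso_def)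
  then show ?thesis by (simp add: H_def)
qed

end

lemma op_full_Ob:
  assumes "category C" shows "op_category (full_subcategory C (Ob C)) = op_category C"
proof -
  have "{f \<in> Arr C. Dom C f \<in> Ob C \<and> Cod C f \<in> Ob C} = Arr C"
    using category.Dom_in_Ob[OF assms] category.Cod_in_Ob[OF assms] by auto
  then show ?thesis by (simp add: op_category_def full_subcategory_def)
qed

lemma presheaf_of_functor:
  fixes F :: "('o, 'm, 'u monoid, 'u ab_arrow) functr"
  assumes C: "preadditive_category C" and D: "D \<subseteq> Ob C"
    and F: "is_additive_functor (op_category (full_subcategory C D)) Ab F"
  shows "presheaf C (U :: 'u itself) D (FOb F) (\<lambda>f. ab_map (FArr F f))"
    and "f \<in> Hom C X Y \<Longrightarrow> X \<in> D \<Longrightarrow> Y \<in> D \<Longrightarrow> FArr F f \<in> Hom Ab (FOb F Y) (FOb F X)"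
proof -
  interpret preadditive_category C by fact
  have F': "is_functor (op_category (full_subcategory C D)) Ab F"
    using F by (simp add: is_additive_functor_def)
  have O: "X \<in> D \<Longrightarrow> X \<in> Ob C" for X using D by blast
  have ob: "FOb F X \<in> Ob Ab" if "X \<in> D" for X
    using F' O[OF that] that by (simp add: is_functor_def)
  show arr: "FArr F f \<in> Hom Ab (FOb F Y) (FOb F X)"
    if "f \<in> Hom C X Y" "X \<in> D" "Y \<in> D" for f X Y
    using F' O that by (simp add: is_functor_def Hom_op Hom_full)
  have comp: "FArr F (Comp C g f) = Comp Ab (FArr F f) (FArr F g)"
    if "f \<in> Hom C X Y" "g \<in> Hom C Y Z" "X \<in> D" "Y \<in> D" "Z \<in> D" for f g X Y Z
    using F' that O unfolding is_functor_def by (simp add: Hom_op Hom_full) (meson IntI)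
  have add: "FArr F (Add C f g) = Add Ab (FArr F f) (FArr F g)"
    if "f \<in> Hom C X Y" "g \<in> Hom C X Y" "X \<in> D" "Y \<in> D" for f g X Y
    using F that O unfolding is_additive_functor_def by (simp add: Hom_op Hom_full) (meson IntI)
  have idn: "FArr F (Idn C X) = Idn Ab (FOb F X)" if "X \<in> D" for X
    using F' O that by (simp add: is_functor_def)
  show "presheaf C U D (FOb F) (\<lambda>f. ab_map (FArr F f))"
  proof (intro presheaf.intro presheaf_axioms.intro preadditive_category_axioms)
    show "D \<subseteq> Ob C" by fact
    show "comm_group (FOb F X)" "small U (carrier (FOb F X))" if "X \<in> D" for X
      using ob[OF that] by (simp_all add: Ob_Ab small_def)
    show "ab_map (FArr F f) \<in> hom (FOb F Y) (FOb F X)" if "f \<in> Hom C X Y" "X \<in> D" "Y \<in> D" for f X Y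
      using arr[OF that] by (auto simp: Hom_Ab)
    show "ab_map (FArr F (Idn C X)) x = x" if "X \<in> D" "x \<in> carrier (FOb F X)" for X x
      using idn that by simp
    show "ab_map (FArr F (Comp C g f)) z = ab_map (FArr F f) (ab_map (FArr F g) z)"
      if "f \<in> Hom C X Y" "g \<in> Hom C Y Z" "X \<in> D" "Y \<in> D" "Z \<in> D" "z \<in> carrier (FOb F Z)" for f g X Y Z z
      using comp[OF that(1-5)] arr[OF that(1,3,4)] arr[OF that(2,4,5)] that(6) by (auto simp: Hom_Ab)
    show "ab_map (FArr F (Add C f g)) y = ab_map (FArr F f) y \<otimes>\<^bsub>FOb F X\<^esub> ab_map (FArr F g) y"
      if "f \<in> Hom C X Y" "g \<in> Hom C X Y" "X \<in> D" "Y \<in> D" "y \<in> carrier (FOb F Y)" for f g X Y y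
      using add[OF that(1-4)] arr[OF that(1,3,4)] arr[OF that(2,3,4)] that(5) by (auto simp: Hom_Ab)
  qed
qed

section \<open>Coproducts\<close>

lemma coproduct_factor:
  assumes "is_coproduct C I X S \<iota>" "Z \<in> Ob C" "\<And>i. i \<in> I \<Longrightarrow> f i \<in> Hom C (X i) Z"
  obtains u where "u \<in> Hom C S Z" "\<And>i. i \<in> I \<Longrightarrow> Comp C u (\<iota> i) = f i"
  using assms unfolding is_coproduct_def by metis

lemma coproduct_unique:
  assumes "is_coproduct C I X S \<iota>" "category C" "u \<in> Hom C S Z" "v \<in> Hom C S Z"
    "\<And>i. i \<in> I \<Longrightarrow> Comp C u (\<iota> i) = Comp C v (\<iota> i)"
  shows "u = v"
proof -
  have Z: "Z \<in> Ob C" using assms category.Hom_Ob by metis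
  have "\<forall>i\<in>I. Comp C v (\<iota> i) \<in> Hom C (X i) Z"
    using assms(1,2,4) category.Comp_in_Hom unfolding is_coproduct_def by metis
  then have "\<exists>!u. u \<in> Hom C S Z \<and> (\<forall>i\<in>I. Comp C u (\<iota> i) = Comp C v (\<iota> i))"
    using assms(1) Z unfolding is_coproduct_def by simp
  then show ?thesis using assms(3-5) by blast
qed

lemma coproductD:
  assumes "is_coproduct C I X S \<iota>"
  shows "S \<in> Ob C" "i \<in> I \<Longrightarrow> X i \<in> Ob C" "i \<in> I \<Longrightarrow> \<iota> i \<in> Hom C (X i) S"
  using assms by (auto simp: is_coproduct_def)

context triangulated_category
begin

lemma coproduct_shift_iff:
  assumes X: "\<And>i. i \<in> I \<Longrightarrow> X i \<in> Ob C" and S: "S \<in> Ob C" and \<iota>: "\<And>i. i \<in> I \<Longrightarrow> \<iota> i \<in> Hom C (X i) S"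
  shows "is_coproduct C I (\<lambda>i. T (X i)) (T S) (\<lambda>i. Ta (\<iota> i)) \<longleftrightarrow> is_coproduct C I X S \<iota>"
proof
  assume L: "is_coproduct C I X S \<iota>"
  show "is_coproduct C I (\<lambda>i. T (X i)) (T S) (\<lambda>i. Ta (\<iota> i))"
    unfolding is_coproduct_def
  proof (intro conjI ballI allI impI)
    fix Z f assume Z: "Z \<in> Ob C" and f: "\<forall>i\<in>I. f i \<in> Hom C (T (X i)) Z"
    obtain Z' where Z': "Z' \<in> Ob C" "T Z' = Z" using T_surj[OF Z] .
    have "\<exists>g. g \<in> Hom C (X i) Z' \<and> Ta g = f i" if "i \<in> I" for i
      using Ta_full[OF X[OF that] Z'(1), of "f i"] f that Z' by metis
    then obtain g where g: "\<And>i. i \<in> I \<Longrightarrow> g i \<in> Hom C (X i) Z'" "\<And>i. i \<in> I \<Longrightarrow> Ta (g i) = f i" by metis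
    obtain u where u: "u \<in> Hom C S Z'" "\<And>i. i \<in> I \<Longrightarrow> u \<cdot> \<iota> i = g i"
      using coproduct_factor[OF L Z'(1)] g(1) by blast
    show "\<exists>!u. u \<in> Hom C (T S) Z \<and> (\<forall>i\<in>I. u \<cdot> Ta (\<iota> i) = f i)"
    proof (rule ex1I[of _ "Ta u"])
      show "Ta u \<in> Hom C (T S) Z \<and> (\<forall>i\<in>I. Ta u \<cdot> Ta (\<iota> i) = f i)"
        using Ta_Hom[OF u(1)] Z' Ta_Comp[OF \<iota> u(1)] u(2) g(2) by auto
      fix v assume v: "v \<in> Hom C (T S) Z \<and> (\<forall>i\<in>I. v \<cdot> Ta (\<iota> i) = f i)"
      then obtain w where w: "w \<in> Hom C S Z'" "Ta w = v" using Ta_full[OF S Z'(1)] Z' by blast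
      have "w \<cdot> \<iota> i = u \<cdot> \<iota> i" if i: "i \<in> I" for i
      proof -
        have "Ta (w \<cdot> \<iota> i) = Ta (u \<cdot> \<iota> i)"
          using Ta_Comp[OF \<iota>[OF i] w(1)] w v u(2)[OF i] g(2)[OF i] i by simp
        then show ?thesis using Ta_inj Comp_in_Hom \<iota>[OF i] w(1) u(1) by metis
      qed
      then show "v = Ta u" using coproduct_unique[OF L category_axioms w(1) u(1)] w by blast
    qed
  qed (use X S \<iota> T_Ob Ta_Hom in auto)
next
  assume R: "is_coproduct C I (\<lambda>i. T (X i)) (T S) (\<lambda>i. Ta (\<iota> i))"
  show "is_coproduct C I X S \<iota>"
    unfolding is_coproduct_def
  proof (intro conjI ballI allI impI)
    fix Z f assume Z: "Z \<in> Ob C" and f: "\<forall>i\<in>I. f i \<in> Hom C (X i) Z"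
    obtain v where v: "v \<in> Hom C (T S) (T Z)" "\<And>i. i \<in> I \<Longrightarrow> v \<cdot> Ta (\<iota> i) = Ta (f i)"
      using coproduct_factor[OF R T_Ob[OF Z], of "\<lambda>i. Ta (f i)"] f Ta_Hom by metis
    obtain u where u: "u \<in> Hom C S Z" "Ta u = v" using Ta_full[OF S Z v(1)] .
    show "\<exists>!u. u \<in> Hom C S Z \<and> (\<forall>i\<in>I. u \<cdot> \<iota> i = f i)"
    proof (rule ex1I[of _ u])
      have "u \<cdot> \<iota> i = f i" if i: "i \<in> I" for i
        using Ta_inj[OF Comp_in_Hom[OF \<iota>[OF i] u(1)]] f i Ta_Comp[OF \<iota>[OF i] u(1)] u(2) v(2) by metis
      then show "u \<in> Hom C S Z \<and> (\<forall>i\<in>I. u \<cdot> \<iota> i = f i)" using u by simp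
      fix w assume w: "w \<in> Hom C S Z \<and> (\<forall>i\<in>I. w \<cdot> \<iota> i = f i)"
      have "Ta w \<cdot> Ta (\<iota> i) = v \<cdot> Ta (\<iota> i)" if "i \<in> I" for i
        using Ta_Comp[OF \<iota>[OF that], of w Z] w v that by simp
      then have "Ta w = v"
        using coproduct_unique[OF R category_axioms _ v(1)] Ta_Hom w by blast
      then show "w = u" using Ta_inj w u by metis
    qed
  qed (use X S \<iota> in auto)
qed

end

section \<open>Brown representability through universal elements\<close>

text \<open>
  Yoneda: the element corresponding to the identity of the representing object is universal.
\<close>
lemma representable_universal_element:
  assumes C: "category C" and H: "\<And>X Y f y. f \<in> Hom C X Y \<Longrightarrow> y \<in> carrier (FOb H Y) \<Longrightarrow> ab_map (FArr H f) y \<in> carrier (FOb H X)"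
    and rep: "representable C H"
  obtains L \<xi> where "L \<in> Ob C" "\<xi> \<in> carrier (FOb H L)"
    "\<And>X. X \<in> Ob C \<Longrightarrow> bij_betw (\<lambda>f. ab_map (FArr H f) \<xi>) (Hom C X L) (carrier (FOb H X))"
proof -
  interpret category C by fact
  obtain L \<phi> where L: "L \<in> Ob C" and \<phi>: "\<And>X. X \<in> Ob C \<Longrightarrow> \<phi> X \<in> iso (FOb H X) (hom_group C X L)"
    and nat: "\<And>X Y f y. X \<in> Ob C \<Longrightarrow> Y \<in> Ob C \<Longrightarrow> f \<in> Hom C X Y \<Longrightarrow> y \<in> carrier (FOb H Y) \<Longrightarrow>
      \<phi> X (ab_map (FArr H f) y) = Comp C (\<phi> Y y) f"
    using rep unfolding representable_def by metis
  have b: "bij_betw (\<phi> X) (carrier (FOb H X)) (Hom C X L)" if "X \<in> Ob C" for X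
    using \<phi>[OF that] by (simp add: iso_def hom_group_def)
  define \<xi> where "\<xi> = inv_into (carrier (FOb H L)) (\<phi> L) (Idn C L)"
  have \<xi>: "\<xi> \<in> carrier (FOb H L)" "\<phi> L \<xi> = Idn C L"
    using bij_betw_imp_surj_on[OF b[OF L]] Idn_in_Hom[OF L] unfolding \<xi>_def
    by (metis inv_into_into, metis f_inv_into_f)
  have "bij_betw (\<lambda>f. ab_map (FArr H f) \<xi>) (Hom C X L) (carrier (FOb H X))" if X: "X \<in> Ob C" for X
  proof -
    have e: "\<phi> X (ab_map (FArr H f) \<xi>) = f" if "f \<in> Hom C X L" for f
      using nat[OF X L that \<xi>(1)] \<xi>(2) Comp_Idn_left[OF that] by simp
    show ?thesis
    proof (rule bij_betw_byWitness[where f' = "\<phi> X"])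
      show "\<forall>a\<in>Hom C X L. \<phi> X (ab_map (FArr H a) \<xi>) = a" using e by blast
      have "x = y" if "x \<in> carrier (FOb H X)" "y \<in> carrier (FOb H X)" "\<phi> X x = \<phi> X y" for x y
        using b[OF X] that unfolding bij_betw_def inj_on_def by blast
      then show "\<forall>a'\<in>carrier (FOb H X). ab_map (FArr H (\<phi> X a')) \<xi> = a'"
        using H[OF _ \<xi>(1)] e bij_betwE[OF b[OF X]] by metis
    qed (use H \<xi> bij_betwE[OF b[OF X]] in auto)
  qed
  then show ?thesis using that L \<xi> by blast
qed

context triangulated_category
begin

text \<open>
  The representability hypothesis in a form free of the category of small abelian groups. All three
  exactness conditions on a triangle are instances of exactness on weak cokernel pairs, since
  \<open>(f, g)\<close>, \<open>(g, h)\<close> and \<open>(h, f[1])\<close> are such pairs and this is stable under the shift.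
\<close>
lemma brown_universal_element:
  fixes U :: "'u itself" and G :: "'o \<Rightarrow> 'g monoid"
  assumes B: "brown_representability U C" and P: "presheaf C U (Ob C) G r"
    and exact: "\<And>X Y Z f g y. \<lbrakk>weak_cokernel_pair C f g; f \<in> Hom C X Y; g \<in> Hom C Y Z;
      y \<in> carrier (G Y); r f y = \<one>\<^bsub>G X\<^esub>\<rbrakk> \<Longrightarrow> \<exists>z\<in>carrier (G Z). r g z = y"
    and prod: "\<And>(I :: 'u set) X S \<iota> x. \<lbrakk>small U I; is_coproduct C I X S \<iota>;
      \<And>i. i \<in> I \<Longrightarrow> x i \<in> carrier (G (X i))\<rbrakk> \<Longrightarrow> \<exists>!s. s \<in> carrier (G S) \<and> (\<forall>i\<in>I. r (\<iota> i) s = x i)"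
  obtains L \<xi> where "L \<in> Ob C" "\<xi> \<in> carrier (G L)"
    "\<And>X. X \<in> Ob C \<Longrightarrow> bij_betw (\<lambda>f. r f \<xi>) (Hom C X L) (carrier (G X))"
proof -
  interpret P: presheaf C U "Ob C" G r by fact
  define H :: "('o, 'm, 'u monoid, 'u ab_arrow) functr" where "H = presheaf_functor C G r"
  let ?e = "\<lambda>X. copy_map (G X) :: 'g \<Rightarrow> 'u"
  have FOb: "FOb H X = small_copy (G X)" for X by (simp add: H_def)
  have car: "carrier (FOb H X) = ?e X ` carrier (G X)" if "X \<in> Ob C" for X
    using P.copy_G_carrier[OF that] FOb by simp
  have map: "ab_map (FArr H f) (?e Y y) = ?e X (r f y)" if "f \<in> Hom C X Y" "y \<in> carrier (G Y)" for f X Y y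
    using P.presheaf_functor_map[OF that(1)] Hom_Ob[OF that(1)] that(2) by (simp add: H_def)
  have inj: "?e X x = ?e X y \<longleftrightarrow> x = y" if "X \<in> Ob C" "x \<in> carrier (G X)" "y \<in> carrier (G X)" for X x y
    using P.copy_G_inv that by metis
  have add: "is_additive_functor (op_category C) Ab H"
    using P.presheaf_functor_additive op_full_Ob[OF category_axioms] by (simp add: H_def)
  have arr: "FArr H f = (FOb H Y, FOb H X, ab_map (FArr H f))" if "f \<in> Hom C X Y" for f X Y
    using P.FArr_presheaf_functor[OF that] by (simp add: H_def)
  have maphom: "ab_map (FArr H f) \<in> hom (FOb H Y) (FOb H X)" if f: "f \<in> Hom C X Y" for f X Y
    using P.presheaf_functor_hom[OF f] Hom_Ob[OF f] by (simp add: H_def)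
  have ep: "exact_pair (FArr H g) (FArr H f)" if w: "weak_cokernel_pair C f g" for f g
  proof -
    obtain X Y Z where f: "f \<in> Hom C X Y" and g: "g \<in> Hom C Y Z"
      using w unfolding weak_cokernel_pair_def Hom_def by auto
    have O: "X \<in> Ob C" "Y \<in> Ob C" "Z \<in> Ob C" using f g Hom_Ob by auto
    have gf: "g \<cdot> f = Zero C X Z" using w f g unfolding weak_cokernel_pair_def Hom_def by auto
    have one: "\<one>\<^bsub>FOb H X\<^esub> = ?e X \<one>\<^bsub>G X\<^esub>" by (simp add: FOb small_copy_one)
    have oc: "\<one>\<^bsub>G X\<^esub> \<in> carrier (G X)" using P.G_group O group.is_monoid monoid.one_closed by metis
    have "ab_map (FArr H g) ` carrier (FOb H Z) = kernel (FOb H Y) (FOb H X) (ab_map (FArr H f))"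
    proof (intro equalityI subsetI)
      fix u assume "u \<in> ab_map (FArr H g) ` carrier (FOb H Z)"
      then obtain z where z: "z \<in> carrier (G Z)" "u = ?e Y (r g z)" using car O map[OF g] by auto
      have "r f (r g z) = \<one>\<^bsub>G X\<^esub>" using P.r_Comp[OF f g] O z gf P.r_Zero by metis
      then show "u \<in> kernel (FOb H Y) (FOb H X) (ab_map (FArr H f))"
        using z P.r_closed[OF g] O map[OF f] car one by (auto simp: kernel_def)
    next
      fix u assume "u \<in> kernel (FOb H Y) (FOb H X) (ab_map (FArr H f))"
      then obtain y where y: "y \<in> carrier (G Y)" "u = ?e Y y" "?e X (r f y) = ?e X \<one>\<^bsub>G X\<^esub>"
        using car O map[OF f] one by (auto simp: kernel_def)
      then have "r f y = \<one>\<^bsub>G X\<^esub>" using inj[OF O(1)] P.r_closed[OF f] O oc by blast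
      then obtain z where "z \<in> carrier (G Z)" "r g z = y" using exact[OF w f g y(1)] by blast
      then show "u \<in> ab_map (FArr H g) ` carrier (FOb H Z)"
        using car O map[OF g] y(2) by (auto intro!: image_eqI[of _ _ "?e Z z"])
    qed
    then show ?thesis using arr[OF f] arr[OF g] unfolding exact_pair_def by (metis Ab_simps(4,5) snd_conv)
  qed
  have coh: "is_cohomological C H"
    unfolding is_cohomological_def
  proof (intro conjI add ballI, clarify)
    fix f g h n assume "(f, g, h) \<in> Tri C"
    then obtain X Y Z where D: "distinguished C X Y Z f g h"
      using Tri_triangle unfolding distinguished_def by blast
    have "shift_arr C n f = shift_arr C (n - 1) (Ta f)"
    proof -
      have fA: "f \<in> Arr C" using distinguishedD[OF D] by (simp add: Hom_def)
      have "shift_arr C n (Ta f) = Ta (shift_arr C n f)" for n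
      proof (induction n rule: int_induct[where k = 0])
        case base then show ?case by (simp add: shift_arr_0)
      next
        case (step1 i)
        have "Ta f \<in> Arr C" using fA Ta_Hom[of f] by (simp add: Hom_def)
        then show ?case using step1(2) shift_arr_Suc fA by metis
      next
        case (step2 i)
        have TfA: "Ta f \<in> Arr C" using fA Ta_Hom[of f] by (simp add: Hom_def)
        have "Ta (shift_arr C (i - 1) (Ta f)) = Ta (Ta (shift_arr C (i - 1) f))"
          using step2(2) shift_arr_Suc[OF TfA, of "i - 1"] shift_arr_Suc[OF fA, of "i - 1"] by simp
        moreover have "shift_arr C (i - 1) (Ta f) \<in> Arr C" "Ta (shift_arr C (i - 1) f) \<in> Arr C"
          using shift_arr_Arr[OF TfA] shift_arr_Arr[OF fA] Ta_Hom by (auto simp: Hom_def)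
        ultimately show ?case using shift_bij_Arr unfolding bij_betw_def inj_on_def by blast
      qed
      then show ?thesis using shift_arr_Suc[OF fA, of "n - 1"] by simp
    qed
    then show "exact_pair (FArr H (shift_arr C n h)) (FArr H (shift_arr C n g)) \<and>
      exact_pair (FArr H (shift_arr C n g)) (FArr H (shift_arr C n f)) \<and>
      exact_pair (FArr H (shift_arr C n f)) (FArr H (shift_arr C (n - 1) h))"
      using triangle_weak_cokernels[OF D] weak_cokernel_shift_arr ep by metis
  qed
  have resp: "respects_products C H"
    unfolding respects_products_def
  proof (intro allI impI, elim conjE)
    fix I :: "'u set" and X S \<iota>
    assume I: "small TYPE('u) I" and cp: "is_coproduct C I X S \<iota>"
    have S: "S \<in> Ob C" and X: "\<And>i. i \<in> I \<Longrightarrow> X i \<in> Ob C" and \<iota>: "\<And>i. i \<in> I \<Longrightarrow> \<iota> i \<in> Hom C (X i) S"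
      using coproductD[OF cp] by auto
    have "(\<lambda>x. \<lambda>i\<in>I. ab_map (FArr H (\<iota> i)) x) \<in> iso (small_copy (G S)) (product_group I (\<lambda>i. small_copy (G (X i))))"
      unfolding H_def
    proof (rule P.presheaf_functor_product_iso[OF S X \<iota>])
      show "\<exists>!s. s \<in> carrier (G S) \<and> (\<forall>i\<in>I. r (\<iota> i) s = x i)"
        if "\<And>i. i \<in> I \<Longrightarrow> x i \<in> carrier (G (X i))" for x
        using prod[OF _ cp that] I by (simp add: small_def)
    qed
    then show "(\<lambda>x. \<lambda>i\<in>I. ab_map (FArr H (\<iota> i)) x) \<in> iso (FOb H S) (product_group I (\<lambda>i. FOb H (X i)))"
      by (simp add: FOb)
  qed
  have rep: "representable C H" using B coh resp unfolding brown_representability_def by blast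
  have cl: "\<And>X Y f y. f \<in> Hom C X Y \<Longrightarrow> y \<in> carrier (FOb H Y) \<Longrightarrow> ab_map (FArr H f) y \<in> carrier (FOb H X)"
    using hom_in_carrier[OF maphom] .
  obtain L \<eta> where L: "L \<in> Ob C" "\<eta> \<in> carrier (FOb H L)"
    "\<And>X. X \<in> Ob C \<Longrightarrow> bij_betw (\<lambda>f. ab_map (FArr H f) \<eta>) (Hom C X L) (carrier (FOb H X))"
    by (rule representable_universal_element[OF category_axioms cl rep]) blast+
  obtain \<xi> where \<xi>: "\<xi> \<in> carrier (G L)" "\<eta> = ?e L \<xi>" using car[OF L(1)] L(2) by auto
  have "bij_betw (\<lambda>f. r f \<xi>) (Hom C X L) (carrier (G X))" if X: "X \<in> Ob C" for X
  proof -
    note b = L(3)[OF X]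
    have m: "ab_map (FArr H f) \<eta> = ?e X (r f \<xi>)" if "f \<in> Hom C X L" for f
      using map[OF that \<xi>(1)] \<xi>(2) by simp
    have cl: "r f \<xi> \<in> carrier (G X)" if "f \<in> Hom C X L" for f
      using P.r_closed[OF that X L(1) \<xi>(1)] .
    show ?thesis
      unfolding bij_betw_def
    proof
      show "inj_on (\<lambda>f. r f \<xi>) (Hom C X L)"
        using b m unfolding bij_betw_def inj_on_def by metis
      show "(\<lambda>f. r f \<xi>) ` Hom C X L = carrier (G X)"
      proof (intro equalityI subsetI)
        fix x assume x: "x \<in> carrier (G X)"
        then have "?e X x \<in> (\<lambda>f. ab_map (FArr H f) \<eta>) ` Hom C X L"
          using car[OF X] b unfolding bij_betw_def by blast
        then obtain f where f: "f \<in> Hom C X L" "?e X x = ?e X (r f \<xi>)" using m by auto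
        then have "x = r f \<xi>" using inj[OF X x cl] by blast
        then show "x \<in> (\<lambda>f. r f \<xi>) ` Hom C X L" using f by blast
      qed (use cl in auto)
    qed
  qed
  then show ?thesis using that L \<xi> by blast
qed

end

section \<open>Brown representability on an aisle\<close>

text \<open>
  The properties of \<open>C\<^sub>w\<^sub>\<ge>\<^sub>0\<close>, for a smashing weight structure, from which the \<open>t\<close>-structure is built.
  Weak reflections take the place of weight decompositions.
\<close>
locale reflective_aisle = triangulated_category C
  for C :: "('o, 'm, 'x) tricat_scheme" (structure) +
  fixes U :: "'u itself" and A :: "'o set"
  assumes univ: "universe U"
    and coproducts: "has_small_coproducts U C"
    and A_Ob: "A \<subseteq> Ob C"
    and A_retracts: "closed_under_retracts C A"
    and A_shift: "X \<in> A \<Longrightarrow> T X \<in> A"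
    and A_extension: "\<lbrakk>distinguished C X Y Z f g h; X \<in> A; Z \<in> A\<rbrakk> \<Longrightarrow> Y \<in> A"
    and A_coproducts: "closed_under_small_coproducts U C A"
    and A_weakly_reflective: "X \<in> Ob C \<Longrightarrow>
      \<exists>Y a. Y \<in> A \<and> a \<in> Hom C X Y \<and> (\<forall>Z\<in>A. \<forall>e \<in> Hom C X Z. \<exists>g \<in> Hom C Y Z. g \<cdot> a = e)"
begin

lemma A_in_Ob: "X \<in> A \<Longrightarrow> X \<in> Ob C"
  using A_Ob by blast

lemma cone_in_A: "\<lbrakk>distinguished C X Y Z f g h; X \<in> A; Y \<in> A\<rbrakk> \<Longrightarrow> Z \<in> A"
  using A_extension[OF rotate] A_shift by blast

lemma coproduct_in_A:
  assumes "small U (I :: 'u set)" "\<And>i. i \<in> I \<Longrightarrow> X i \<in> A"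
  obtains S \<iota> where "is_coproduct C I X S \<iota>" "S \<in> A"
proof -
  obtain S \<iota> where c: "is_coproduct C I X S \<iota>"
    using coproducts assms A_in_Ob unfolding has_small_coproducts_def by blast
  then have "S \<in> A" using A_coproducts assms unfolding closed_under_small_coproducts_def by blast
  then show ?thesis using that c by blast
qed

text \<open>
  A biproduct is a coproduct over a two-element set of indices, which may be chosen in the universe.
\<close>
lemma biproduct_in_A:
  assumes "X \<in> A" "Y \<in> A"
  obtains S i j p q where "S \<in> A" "i \<in> Hom C X S" "j \<in> Hom C Y S" "p \<in> Hom C S X" "q \<in> Hom C S Y"
    "p \<cdot> i = Idn C X" "q \<cdot> j = Idn C Y" "p \<cdot> j = Zero C Y X" "q \<cdot> i = Zero C X Y"
proof -
  have O: "X \<in> Ob C" "Y \<in> Ob C" using assms A_in_Ob by auto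
  obtain S i j p q where S: "S \<in> Ob C" "i \<in> Hom C X S" "j \<in> Hom C Y S" "p \<in> Hom C S X" "q \<in> Hom C S Y"
    "p \<cdot> i = Idn C X" "q \<cdot> j = Idn C Y" "p \<cdot> j = Zero C Y X" "q \<cdot> i = Zero C X Y"
    "Add C (i \<cdot> p) (j \<cdot> q) = Idn C S"
    using ex_biproduct[OF O] by blast
  obtain a b :: 'u where ab: "a \<noteq> b"
    using universe_infinite[OF univ] by (metis (full_types) UNIV_eq_I finite.emptyI finite.insertI insertCI)
  let ?F = "\<lambda>u. if u = a then X else Y" and ?\<iota> = "\<lambda>u. if u = a then i else j"
  have "is_coproduct C {a, b} ?F S ?\<iota>"
    unfolding is_coproduct_def
  proof (intro conjI ballI allI impI)
    fix Z f assume Z: "Z \<in> Ob C" and f: "\<forall>u\<in>{a, b}. f u \<in> Hom C (?F u) Z"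
    have fa: "f a \<in> Hom C X Z" and fb: "f b \<in> Hom C Y Z" using f ab by auto
    have fap: "f a \<cdot> p \<in> Hom C S Z" and fbq: "f b \<cdot> q \<in> Hom C S Z" using fa fb S Comp_in_Hom by blast+
    let ?u = "Add C (f a \<cdot> p) (f b \<cdot> q)"
    have u: "?u \<in> Hom C S Z" using fap fbq Add_Hom by blast
    have ua: "?u \<cdot> i = f a"
      using Comp_Add_left[OF S(2) fap fbq] Comp_assoc[OF S(2,4) fa] Comp_assoc[OF S(2,5) fb] S(6,9)
        Comp_Idn_right[OF fa] Comp_Zero[OF fb O(1)] Add_Zero[OF fa] by simp
    have ub: "?u \<cdot> j = f b"
      using Comp_Add_left[OF S(3) fap fbq] Comp_assoc[OF S(3,4) fa] Comp_assoc[OF S(3,5) fb] S(7,8)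
        Comp_Idn_right[OF fb] Comp_Zero[OF fa O(2)] Zero_Add[OF fb] by simp
    show "\<exists>!u. u \<in> Hom C S Z \<and> (\<forall>k\<in>{a, b}. u \<cdot> ?\<iota> k = f k)"
    proof (rule ex1I[of _ ?u])
      show "?u \<in> Hom C S Z \<and> (\<forall>k\<in>{a, b}. ?u \<cdot> ?\<iota> k = f k)" using u ua ub ab by simp
      fix v assume v: "v \<in> Hom C S Z \<and> (\<forall>k\<in>{a, b}. v \<cdot> ?\<iota> k = f k)"
      then have vv: "v \<in> Hom C S Z" "v \<cdot> i = f a" "v \<cdot> j = f b" using ab by auto
      have "v = v \<cdot> Add C (i \<cdot> p) (j \<cdot> q)" using Comp_Idn_right[OF vv(1)] S(10) by simp
      also have "\<dots> = Add C (v \<cdot> (i \<cdot> p)) (v \<cdot> (j \<cdot> q))"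
        using Comp_Add_right[OF Comp_in_Hom[OF S(4,2)] Comp_in_Hom[OF S(5,3)] vv(1)] .
      also have "\<dots> = ?u" using Comp_assoc[OF S(4,2) vv(1)] Comp_assoc[OF S(5,3) vv(1)] vv by simp
      finally show "v = ?u" .
    qed
  qed (use S O ab in auto)
  then have "S \<in> A"
    using A_coproducts assms small_finite[OF univ, of "{a, b}"]
    unfolding closed_under_small_coproducts_def by fastforce
  then show ?thesis using that S by blast
qed

end

text \<open>
  Half exactness is required only for triangles that stay inside \<open>A\<close>. This lets the
  representability theorem below apply to functors without an evident extension to \<open>C\<close>.
\<close>
locale aisle_presheaf = reflective_aisle C U A + presheaf C U A G r
  for C :: "('o, 'm, 'x) tricat_scheme" (structure) and U :: "'u itself" and A
    and G :: "'o \<Rightarrow> 'g monoid" and r :: "'m \<Rightarrow> 'g \<Rightarrow> 'g" +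
  assumes half_exact: "\<lbrakk>distinguished C X Y Z f g h; X \<in> A; Y \<in> A; Z \<in> A; y \<in> carrier (G Y);
      r f y = \<one>\<^bsub>G X\<^esub>\<rbrakk> \<Longrightarrow> \<exists>z\<in>carrier (G Z). r g z = y"
    and products: "\<lbrakk>small U (I :: 'u set); is_coproduct C I F S \<iota>; \<And>i. i \<in> I \<Longrightarrow> F i \<in> A;
      \<And>i. i \<in> I \<Longrightarrow> x i \<in> carrier (G (F i))\<rbrakk> \<Longrightarrow> \<exists>!s. s \<in> carrier (G S) \<and> (\<forall>i\<in>I. r (\<iota> i) s = x i)"
begin

text \<open>
  By additivity, the sum of the restrictions of \<open>x\<close> and \<open>y\<close> along the two projections has the required
  restrictions along the inclusions.
\<close>
lemma biproduct_glue:
  assumes X: "X \<in> A" and Y: "Y \<in> A" and x: "x \<in> carrier (G X)" and y: "y \<in> carrier (G Y)"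
  obtains S i j s where "S \<in> A" "i \<in> Hom C X S" "j \<in> Hom C Y S" "s \<in> carrier (G S)" "r i s = x" "r j s = y"
proof -
  obtain S i j p q where S: "S \<in> A" "i \<in> Hom C X S" "j \<in> Hom C Y S" "p \<in> Hom C S X" "q \<in> Hom C S Y"
    "p \<cdot> i = Idn C X" "q \<cdot> j = Idn C Y" "p \<cdot> j = Zero C Y X" "q \<cdot> i = Zero C X Y"
    using biproduct_in_A[OF X Y] by blast
  interpret GX: group "G X" using G_group X . interpret GY: group "G Y" using G_group Y .
  interpret GS: group "G S" using G_group S(1) .
  have px: "r p x \<in> carrier (G S)" and qy: "r q y \<in> carrier (G S)"
    using r_closed[OF S(4) S(1) X x] r_closed[OF S(5) S(1) Y y] by auto
  have 1: "r i (r p x) = x" using r_Comp[OF S(2,4) X S(1) X x] S(6) r_Idn[OF X x] by simp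
  have 2: "r i (r q y) = \<one>\<^bsub>G X\<^esub>" using r_Comp[OF S(2,5) X S(1) Y y] S(9) r_Zero[OF X Y y] by simp
  have 3: "r j (r p x) = \<one>\<^bsub>G Y\<^esub>" using r_Comp[OF S(3,4) Y S(1) X x] S(8) r_Zero[OF Y X x] by simp
  have 4: "r j (r q y) = y" using r_Comp[OF S(3,5) Y S(1) Y y] S(7) r_Idn[OF Y y] by simp
  show ?thesis
  proof (rule that[OF S(1-3)])
    show "r p x \<otimes>\<^bsub>G S\<^esub> r q y \<in> carrier (G S)" using px qy by simp
    show "r i (r p x \<otimes>\<^bsub>G S\<^esub> r q y) = x" using r_mult[OF S(2) X S(1) px qy] 1 2 GX.r_one[OF x] by metis
    show "r j (r p x \<otimes>\<^bsub>G S\<^esub> r q y) = y" using r_mult[OF S(3) Y S(1) px qy] 3 4 GY.l_one[OF y] by metis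
  qed
qed

text \<open>
  The weak pushout \<open>W\<close> of the family \<open>k i\<close> along the family \<open>h i\<close> is the cone of the difference map from
  the coproduct of the \<open>P i\<close> to the direct sum of \<open>B\<close> and the coproduct of the \<open>Q i\<close>. It lies in \<open>A\<close>, and
  half exactness of \<open>G\<close> glues \<open>b\<close> and the \<open>c i\<close> to an element of \<open>G W\<close> because they agree on each \<open>P i\<close>.
\<close>
lemma amalgamation:
  assumes I: "small U (I :: 'u set)" and B: "B \<in> A" and b: "b \<in> carrier (G B)"
    and P: "\<And>i. i \<in> I \<Longrightarrow> P i \<in> A" and Q: "\<And>i. i \<in> I \<Longrightarrow> Q i \<in> A"
    and h: "\<And>i. i \<in> I \<Longrightarrow> h i \<in> Hom C (P i) B" and k: "\<And>i. i \<in> I \<Longrightarrow> k i \<in> Hom C (P i) (Q i)"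
    and c: "\<And>i. i \<in> I \<Longrightarrow> c i \<in> carrier (G (Q i))"
    and eq: "\<And>i. i \<in> I \<Longrightarrow> r (h i) b = r (k i) (c i)"
  obtains W w v d where "W \<in> A" "w \<in> Hom C B W" "\<And>i. i \<in> I \<Longrightarrow> v i \<in> Hom C (Q i) W"
    "\<And>i. i \<in> I \<Longrightarrow> w \<cdot> h i = v i \<cdot> k i" "d \<in> carrier (G W)" "r w d = b"
proof -
  obtain D \<kappa> where D: "is_coproduct C I P D \<kappa>" "D \<in> A" using coproduct_in_A[OF I, of P] P by blast
  obtain E l where E: "is_coproduct C I Q E l" "E \<in> A" using coproduct_in_A[OF I, of Q] Q by blast
  have \<kappa>: "\<kappa> i \<in> Hom C (P i) D" and l: "l i \<in> Hom C (Q i) E" if "i \<in> I" for i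
    using coproductD(3)[OF D(1)] coproductD(3)[OF E(1)] that by auto
  obtain e where e: "e \<in> carrier (G E)" "\<And>n. n \<in> I \<Longrightarrow> r (l n) e = c n"
    using products[OF I E(1) Q c] by blast
  obtain S i j y where S: "S \<in> A" "i \<in> Hom C B S" "j \<in> Hom C E S" and y: "y \<in> carrier (G S)"
    and iy: "r i y = b" and jy: "r j y = e"
    using biproduct_glue[OF B E(2) b e(1)] by blast
  let ?lk = "\<lambda>n. j \<cdot> (l n \<cdot> k n)"
  have ih: "i \<cdot> h n \<in> Hom C (P n) S" and lk: "?lk n \<in> Hom C (P n) S" if "n \<in> I" for n
    using Comp_in_Hom[OF h[OF that] S(2)] Comp_in_Hom[OF Comp_in_Hom[OF k[OF that] l[OF that]] S(3)] by auto
  \<comment> \<open>The cone of this difference makes the two composites to it equal.\<close>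
  obtain m where m: "m \<in> Hom C D S" "\<And>n. n \<in> I \<Longrightarrow> m \<cdot> \<kappa> n = Sub C (i \<cdot> h n) (?lk n)"
    using coproduct_factor[OF D(1) A_in_Ob[OF S(1)], of "\<lambda>n. Sub C (i \<cdot> h n) (?lk n)"] Sub_Hom[OF ih lk] by blast
  obtain W s t where W: "distinguished C D S W m s t" using Tri_completion[OF m(1)] by blast
  have WA: "W \<in> A" using cone_in_A[OF W D(2) S(1)] .
  have s: "s \<in> Hom C S W" using distinguishedD[OF W] by blast
  have my: "r m y \<in> carrier (G D)" using r_closed[OF m(1) D(2) S(1) y] .
  have "r (\<kappa> n) (r m y) = \<one>\<^bsub>G (P n)\<^esub>" if n: "n \<in> I" for n
  proof -
    interpret GP: group "G (P n)" using G_group P[OF n] .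
    have 1: "r (i \<cdot> h n) y = r (h n) b" using r_Comp[OF h[OF n] S(2) P[OF n] B S(1) y] iy by simp
    have 2: "r (?lk n) y = r (k n) (c n)"
      using r_Comp[OF Comp_in_Hom[OF k[OF n] l[OF n]] S(3) P[OF n] E(2) S(1) y] jy
        r_Comp[OF k[OF n] l[OF n] P[OF n] Q[OF n] E(2) e(1)] e(2)[OF n] by simp
    have "r (\<kappa> n) (r m y) = r (m \<cdot> \<kappa> n) y" using r_Comp[OF \<kappa>[OF n] m(1) P[OF n] D(2) S(1) y] by simp
    also have "\<dots> = r (h n) b \<otimes>\<^bsub>G (P n)\<^esub> inv\<^bsub>G (P n)\<^esub> r (k n) (c n)"
      using m(2)[OF n] r_Sub[OF ih[OF n] lk[OF n] P[OF n] S(1) y] 1 2 by simp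
    also have "\<dots> = \<one>\<^bsub>G (P n)\<^esub>"
      using eq[OF n] r_closed[OF k[OF n] P[OF n] Q[OF n] c[OF n]] by simp
    finally show ?thesis .
  qed
  moreover have "r (\<kappa> n) \<one>\<^bsub>G D\<^esub> = \<one>\<^bsub>G (P n)\<^esub>" if n: "n \<in> I" for n
    using r_one[OF \<kappa>[OF n] P[OF n] D(2)] .
  moreover have "\<exists>!z. z \<in> carrier (G D) \<and> (\<forall>n\<in>I. r (\<kappa> n) z = \<one>\<^bsub>G (P n)\<^esub>)"
    by (rule products[OF I D(1) P]) (auto intro!: monoid.one_closed group.is_monoid G_group P)
  moreover have "\<one>\<^bsub>G D\<^esub> \<in> carrier (G D)" using G_group[OF D(2)] group.is_monoid monoid.one_closed by blast
  ultimately have "r m y = \<one>\<^bsub>G D\<^esub>" using my by blast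
  then obtain d where d: "d \<in> carrier (G W)" "r s d = y" using half_exact[OF W D(2) S(1) WA y] by blast
  show ?thesis
  proof (rule that[OF WA])
    show si: "s \<cdot> i \<in> Hom C B W" using Comp_in_Hom[OF S(2) s] .
    show "s \<cdot> (j \<cdot> l n) \<in> Hom C (Q n) W" if "n \<in> I" for n
      using Comp_in_Hom[OF Comp_in_Hom[OF l[OF that] S(3)] s] .
    show "s \<cdot> i \<cdot> h n = s \<cdot> (j \<cdot> l n) \<cdot> k n" if n: "n \<in> I" for n
    proof -
      have "Sub C (s \<cdot> (i \<cdot> h n)) (s \<cdot> ?lk n) = s \<cdot> (m \<cdot> \<kappa> n)"
        using Comp_Sub[OF ih[OF n] lk[OF n] s] m(2)[OF n] by simp
      also have "\<dots> = Zero C (P n) W"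
        using Comp_assoc[OF \<kappa>[OF n] m(1) s] triangle_Comp[OF W] Zero_Comp[OF \<kappa>[OF n] A_in_Ob[OF WA]] by simp
      finally have "s \<cdot> (i \<cdot> h n) = s \<cdot> ?lk n"
        using Sub_Zero_iff Comp_in_Hom[OF ih[OF n] s] Comp_in_Hom[OF lk[OF n] s] by blast
      then show ?thesis
        using Comp_assoc[OF h[OF n] S(2) s] Comp_assoc[OF k[OF n] l[OF n] S(3)]
          Comp_assoc[OF k[OF n] Comp_in_Hom[OF l[OF n] S(3)] s] by simp
    qed
    show "d \<in> carrier (G W)" by fact
    show "r (s \<cdot> i) d = b" using r_Comp[OF S(2) s B S(1) WA d(1)] d(2) iy by simp
  qed
qed

definition reflection :: "'o \<Rightarrow> 'o \<times> 'm" where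
  "reflection X = (SOME (Y, b). Y \<in> A \<and> b \<in> Hom C X Y \<and>
     (\<forall>Z\<in>A. \<forall>e \<in> Hom C X Z. \<exists>g \<in> Hom C Y Z. g \<cdot> b = e))"

abbreviation refl_ob where "refl_ob X \<equiv> fst (reflection X)"
abbreviation refl_map where "refl_map X \<equiv> snd (reflection X)"

lemma reflection:
  assumes "X \<in> Ob C"
  shows refl_ob_A: "refl_ob X \<in> A" and refl_map_Hom: "refl_map X \<in> Hom C X (refl_ob X)"
    and refl_map_factor: "Z \<in> A \<Longrightarrow> e \<in> Hom C X Z \<Longrightarrow> \<exists>g \<in> Hom C (refl_ob X) Z. g \<cdot> refl_map X = e"
proof -
  have "\<exists>p. case p of (Y, b) \<Rightarrow> Y \<in> A \<and> b \<in> Hom C X Y \<and>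
     (\<forall>Z\<in>A. \<forall>e \<in> Hom C X Z. \<exists>g \<in> Hom C Y Z. g \<cdot> b = e)"
    using A_weakly_reflective[OF assms] by simp
  then have "case reflection X of (Y, b) \<Rightarrow> Y \<in> A \<and> b \<in> Hom C X Y \<and>
     (\<forall>Z\<in>A. \<forall>e \<in> Hom C X Z. \<exists>g \<in> Hom C Y Z. g \<cdot> b = e)"
    unfolding reflection_def by (rule someI_ex)
  then show "refl_ob X \<in> A" "refl_map X \<in> Hom C X (refl_ob X)" "Z \<in> A \<Longrightarrow> e \<in> Hom C X Z \<Longrightarrow> \<exists>g \<in> Hom C (refl_ob X) Z. g \<cdot> refl_map X = e"
    by (auto split: prod.splits)
qed

text \<open>
  The elements that the left Kan extension has to kill: two extensions of a morphism along the weak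
  reflection of \<open>X\<close> differ by some \<open>d\<close> that vanishes on \<open>X\<close>.
\<close>
definition null_elements :: "'o \<Rightarrow> 'g set" where
  "null_elements X = {r d t | d t. \<exists>Y\<in>A. d \<in> Hom C (refl_ob X) Y \<and> d \<cdot> refl_map X = Zero C X Y \<and> t \<in> carrier (G Y)}"

lemma null_elementsI: "Y \<in> A \<Longrightarrow> d \<in> Hom C (refl_ob X) Y \<Longrightarrow> d \<cdot> refl_map X = Zero C X Y \<Longrightarrow> t \<in> carrier (G Y) \<Longrightarrow> r d t \<in> null_elements X"
  unfolding null_elements_def by blast

text \<open>
  Two such elements have a sum of the same form, by the direct sum of their targets.
\<close>
lemma null_elements_subgroup: assumes X: "X \<in> Ob C" shows "subgroup (null_elements X) (G (refl_ob X))"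
proof -
  note RX = refl_ob_A[OF X] and aX = refl_map_Hom[OF X]
  interpret GR: group "G (refl_ob X)" using G_group RX .
  show ?thesis
  proof (rule GR.subgroupI)
    show "null_elements X \<subseteq> carrier (G (refl_ob X))" unfolding null_elements_def using r_closed RX by blast
    have Z: "Zero C (refl_ob X) (refl_ob X) \<in> Hom C (refl_ob X) (refl_ob X)" using Zero_Hom A_in_Ob RX by blast
    have "r (Zero C (refl_ob X) (refl_ob X)) \<one>\<^bsub>G (refl_ob X)\<^esub> \<in> null_elements X"
      by (rule null_elementsI[OF RX Z Zero_Comp[OF aX A_in_Ob[OF RX]] GR.one_closed])
    then show "null_elements X \<noteq> {}" by blast
    fix x assume "x \<in> null_elements X"
    then obtain d t Y where x: "x = r d t" "Y \<in> A" "d \<in> Hom C (refl_ob X) Y" "d \<cdot> refl_map X = Zero C X Y" "t \<in> carrier (G Y)"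
      unfolding null_elements_def by blast
    interpret GY: group "G Y" using G_group x(2) .
    show "inv\<^bsub>G (refl_ob X)\<^esub> x \<in> null_elements X"
      using null_elementsI[OF x(2-4) GY.inv_closed[OF x(5)]] r_inv[OF x(3) RX x(2,5)] x(1) by simp
    fix y assume "y \<in> null_elements X"
    then obtain d' t' Y' where y: "y = r d' t'" "Y' \<in> A" "d' \<in> Hom C (refl_ob X) Y'" "d' \<cdot> refl_map X = Zero C X Y'" "t' \<in> carrier (G Y')"
      unfolding null_elements_def by blast
    obtain S i j s where S: "S \<in> A" "i \<in> Hom C Y S" "j \<in> Hom C Y' S" and s: "s \<in> carrier (G S)"
      and iy: "r i s = t" and jy: "r j s = t'"
      using biproduct_glue[OF x(2) y(2) x(5) y(5)] by blast
    let ?d = "Add C (i \<cdot> d) (j \<cdot> d')"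
    have id: "i \<cdot> d \<in> Hom C (refl_ob X) S" and jd: "j \<cdot> d' \<in> Hom C (refl_ob X) S"
      using Comp_in_Hom[OF x(3) S(2)] Comp_in_Hom[OF y(3) S(3)] by auto
    have "r ?d s = x \<otimes>\<^bsub>G (refl_ob X)\<^esub> y"
      using r_Add[OF id jd RX S(1) s] r_Comp[OF x(3) S(2) RX x(2) S(1) s] r_Comp[OF y(3) S(3) RX y(2) S(1) s]
        iy jy x(1) y(1) by simp
    moreover have "?d \<cdot> refl_map X = Zero C X S"
      using Comp_Add_left[OF aX id jd] Comp_assoc[OF aX x(3) S(2)] Comp_assoc[OF aX y(3) S(3)] x(4) y(4)
        Comp_Zero[OF S(2) X] Comp_Zero[OF S(3) X] Add_Zero[OF Zero_Hom[OF X A_in_Ob[OF S(1)]]] by simp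
    ultimately show "x \<otimes>\<^bsub>G (refl_ob X)\<^esub> y \<in> null_elements X"
      using null_elementsI[OF S(1) Add_Hom[OF id jd] _ s] by metis
  qed
qed

text \<open>
  The value at \<open>X\<close> of the left Kan extension of \<open>G\<close> to \<open>C\<close>. The colimit over all morphisms from \<open>X\<close> to
  objects of \<open>A\<close> is computed by the weakly initial one.
\<close>
definition Lan :: "'o \<Rightarrow> 'g set monoid" where "Lan X = G (refl_ob X) Mod null_elements X"

definition quot :: "'o \<Rightarrow> 'g \<Rightarrow> 'g set" where "quot X t = null_elements X #>\<^bsub>G (refl_ob X)\<^esub> t"

lemma quot:
  assumes X: "X \<in> Ob C"
  shows Lan_comm: "comm_group (Lan X)" and quot_hom: "quot X \<in> hom (G (refl_ob X)) (Lan X)"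
    and quot_surj: "quot X ` carrier (G (refl_ob X)) = carrier (Lan X)"
    and quot_one: "t \<in> carrier (G (refl_ob X)) \<Longrightarrow> quot X t = \<one>\<^bsub>Lan X\<^esub> \<longleftrightarrow> t \<in> null_elements X"
proof -
  interpret GR: comm_group "G (refl_ob X)" using G_comm refl_ob_A[OF X] .
  have sub: "subgroup (null_elements X) (G (refl_ob X))" by (rule null_elements_subgroup[OF X])
  interpret N: normal "null_elements X" "G (refl_ob X)" by (rule GR.subgroup_imp_normal[OF sub])
  show hom: "quot X \<in> hom (G (refl_ob X)) (Lan X)" unfolding Lan_def quot_def[abs_def] by (rule N.r_coset_hom_Mod)
  show surj: "quot X ` carrier (G (refl_ob X)) = carrier (Lan X)"
    unfolding Lan_def quot_def[abs_def] FactGroup_def RCOSETS_def by auto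
  interpret F: group "Lan X" unfolding Lan_def by (rule N.factorgroup_is_group)
  show "comm_group (Lan X)"
  proof (rule F.group_comm_groupI)
    fix x y assume "x \<in> carrier (Lan X)" "y \<in> carrier (Lan X)"
    then obtain s t where "s \<in> carrier (G (refl_ob X))" "x = quot X s" "t \<in> carrier (G (refl_ob X))" "y = quot X t"
      unfolding surj[symmetric] by blast
    then show "x \<otimes>\<^bsub>Lan X\<^esub> y = y \<otimes>\<^bsub>Lan X\<^esub> x"
      using hom_mult[OF hom, of s t] hom_mult[OF hom, of t s] GR.m_comm by simp
  qed
  have one: "\<one>\<^bsub>Lan X\<^esub> = null_elements X" by (simp add: Lan_def FactGroup_def)
  show "t \<in> carrier (G (refl_ob X)) \<Longrightarrow> quot X t = \<one>\<^bsub>Lan X\<^esub> \<longleftrightarrow> t \<in> null_elements X"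
    unfolding one quot_def using GR.coset_join1[OF _ _ sub] GR.coset_join2[OF _ sub] by blast
qed

text \<open>
  A chosen extension of \<open>e\<close> along the weak reflection of its domain; extensions are not unique.
\<close>
definition extend :: "'m \<Rightarrow> 'm" where
  "extend e = (SOME g. g \<in> Hom C (refl_ob (Dom C e)) (Cod C e) \<and> g \<cdot> refl_map (Dom C e) = e)"

lemma extend:
  assumes "e \<in> Hom C X Y" "Y \<in> A"
  shows extend_Hom: "extend e \<in> Hom C (refl_ob X) Y" and extend_Comp: "extend e \<cdot> refl_map X = e"
proof -
  have X: "X \<in> Ob C" using assms(1) Hom_Ob by blast
  have DC: "Dom C e = X" "Cod C e = Y" using assms(1) by (auto simp: Hom_def)
  have "\<exists>g. g \<in> Hom C (refl_ob X) Y \<and> g \<cdot> refl_map X = e" using refl_map_factor[OF X assms(2,1)] by blast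
  then have "extend e \<in> Hom C (refl_ob X) Y \<and> extend e \<cdot> refl_map X = e" unfolding extend_def DC by (rule someI_ex)
  then show "extend e \<in> Hom C (refl_ob X) Y" "extend e \<cdot> refl_map X = e" by auto
qed

text \<open>
  The class of the pair \<open>(e, t)\<close> in the left Kan extension at the domain of \<open>e\<close>.
\<close>
definition pair_class :: "'m \<Rightarrow> 'g \<Rightarrow> 'g set" where "pair_class e t = quot (Dom C e) (r (extend e) t)"

text \<open>
  The class does not depend on the extension of \<open>e\<close>: a difference of two extensions vanishes on \<open>X\<close>.
\<close>
lemma pair_class_eq:
  assumes e: "e \<in> Hom C X Y" and Y: "Y \<in> A" and t: "t \<in> carrier (G Y)"
    and g: "g \<in> Hom C (refl_ob X) Y" "g \<cdot> refl_map X = e"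
  shows "pair_class e t = quot X (r g t)"
proof -
  have X: "X \<in> Ob C" using e Hom_Ob by blast
  note RX = refl_ob_A[OF X] and aX = refl_map_Hom[OF X] and g' = extend_Hom[OF e Y] and g'r = extend_Comp[OF e Y]
  interpret GR: group "G (refl_ob X)" using G_group RX .
  interpret HX: comm_group "Lan X" using Lan_comm X .
  interpret q: group_hom "G (refl_ob X)" "Lan X" "quot X"
    using quot_hom[OF X] by unfold_locales
  have c: "r (extend e) t \<in> carrier (G (refl_ob X))" "r g t \<in> carrier (G (refl_ob X))"
    using r_closed[OF g' RX Y t] r_closed[OF g(1) RX Y t] by auto
  have "Sub C (extend e) g \<cdot> refl_map X = Zero C X Y"
    using Sub_Comp[OF aX g' g(1)] g'r g(2) Sub_Zero_iff[OF e e] by simp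
  then have "r (Sub C (extend e) g) t \<in> null_elements X" using null_elementsI[OF Y Sub_Hom[OF g' g(1)] _ t] by blast
  then have "r (extend e) t \<otimes>\<^bsub>G (refl_ob X)\<^esub> inv\<^bsub>G (refl_ob X)\<^esub> r g t \<in> null_elements X"
    using r_Sub[OF g' g(1) RX Y t] by simp
  then have "quot X (r (extend e) t \<otimes>\<^bsub>G (refl_ob X)\<^esub> inv\<^bsub>G (refl_ob X)\<^esub> r g t) = \<one>\<^bsub>Lan X\<^esub>"
    by (rule iffD2[OF quot_one[OF X GR.m_closed[OF c(1) GR.inv_closed[OF c(2)]]]])
  then have "quot X (r (extend e) t) \<otimes>\<^bsub>Lan X\<^esub> inv\<^bsub>Lan X\<^esub> quot X (r g t) = \<one>\<^bsub>Lan X\<^esub>"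
    using q.hom_mult q.hom_inv c by simp
  then have "quot X (r (extend e) t) = quot X (r g t)"
    using HX.inv_solve_right' q.hom_closed c by simp
  then show ?thesis using e by (simp add: pair_class_def Hom_def)
qed

lemma pair_class_closed: "e \<in> Hom C X Y \<Longrightarrow> Y \<in> A \<Longrightarrow> t \<in> carrier (G Y) \<Longrightarrow> pair_class e t \<in> carrier (Lan X)"
  using pair_class_eq[OF _ _ _ extend_Hom extend_Comp] hom_in_carrier[OF quot_hom] r_closed[OF extend_Hom] refl_ob_A Hom_Ob by metis

lemma pair_class_Comp:
  assumes e: "e \<in> Hom C X Y" and k: "k \<in> Hom C Y Z" and Y: "Y \<in> A" and Z: "Z \<in> A" and t: "t \<in> carrier (G Z)"
  shows "pair_class (k \<cdot> e) t = pair_class e (r k t)"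
proof -
  have X: "X \<in> Ob C" using e Hom_Ob by blast
  note g = extend_Hom[OF e Y]
  have "pair_class (k \<cdot> e) t = quot X (r (k \<cdot> extend e) t)"
    by (rule pair_class_eq[OF Comp_in_Hom[OF e k] Z t Comp_in_Hom[OF g k]])
       (simp add: Comp_assoc[OF refl_map_Hom[OF X] g k] extend_Comp[OF e Y])
  also have "\<dots> = quot X (r (extend e) (r k t))" using r_Comp[OF g k refl_ob_A[OF X] Y Z t] by simp
  also have "\<dots> = pair_class e (r k t)" using e by (simp add: pair_class_def Hom_def)
  finally show ?thesis .
qed

lemma pair_class_mult:
  assumes e: "e \<in> Hom C X Y" and Y: "Y \<in> A" and t: "t \<in> carrier (G Y)" "t' \<in> carrier (G Y)"
  shows "pair_class e (t \<otimes>\<^bsub>G Y\<^esub> t') = pair_class e t \<otimes>\<^bsub>Lan X\<^esub> pair_class e t'"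
proof -
  have X: "X \<in> Ob C" using e Hom_Ob by blast
  note g = extend_Hom[OF e Y]
  show ?thesis
    using r_mult[OF g refl_ob_A[OF X] Y t] hom_mult[OF quot_hom[OF X]] r_closed[OF g refl_ob_A[OF X] Y] t e
    by (simp add: pair_class_def Hom_def)
qed

lemma pair_class_Add:
  assumes e: "e \<in> Hom C X Y" "e' \<in> Hom C X Y" and Y: "Y \<in> A" and t: "t \<in> carrier (G Y)"
  shows "pair_class (Add C e e') t = pair_class e t \<otimes>\<^bsub>Lan X\<^esub> pair_class e' t"
proof -
  have X: "X \<in> Ob C" using e Hom_Ob by blast
  note g = extend_Hom[OF e(1) Y] and g' = extend_Hom[OF e(2) Y]
  have "pair_class (Add C e e') t = quot X (r (Add C (extend e) (extend e')) t)"
    by (rule pair_class_eq[OF Add_Hom[OF e] Y t Add_Hom[OF g g']])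
       (simp add: Comp_Add_left[OF refl_map_Hom[OF X] g g'] extend_Comp[OF e(1) Y] extend_Comp[OF e(2) Y])
  also have "\<dots> = quot X (r (extend e) t) \<otimes>\<^bsub>Lan X\<^esub> quot X (r (extend e') t)"
    using r_Add[OF g g' refl_ob_A[OF X] Y t] hom_mult[OF quot_hom[OF X]] r_closed[OF g refl_ob_A[OF X] Y t]
      r_closed[OF g' refl_ob_A[OF X] Y t] by simp
  also have "\<dots> = pair_class e t \<otimes>\<^bsub>Lan X\<^esub> pair_class e' t" using e by (simp add: pair_class_def Hom_def)
  finally show ?thesis .
qed

lemma pair_class_refl_map: "X \<in> Ob C \<Longrightarrow> t \<in> carrier (G (refl_ob X)) \<Longrightarrow> pair_class (refl_map X) t = quot X t"
  using pair_class_eq[OF refl_map_Hom refl_ob_A _ Idn_in_Hom Comp_Idn_left] r_Idn refl_ob_A refl_map_Hom A_in_Ob by metis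

lemma pair_class_surj:
  assumes "X \<in> Ob C" "u \<in> carrier (Lan X)"
  obtains t where "t \<in> carrier (G (refl_ob X))" "u = pair_class (refl_map X) t"
proof -
  obtain t where "t \<in> carrier (G (refl_ob X))" "u = quot X t"
    using quot_surj[OF assms(1)] assms(2) by blast
  then show ?thesis using that pair_class_refl_map[OF assms(1)] by simp
qed

lemma pair_class_Zero:
  assumes "X \<in> Ob C" "Y \<in> A" "t \<in> carrier (G Y)"
  shows "pair_class (Zero C X Y) t = \<one>\<^bsub>Lan X\<^esub>"
proof -
  have Z: "Zero C X Y \<in> Hom C X Y" using Zero_Hom assms A_in_Ob by blast
  interpret HX: comm_group "Lan X" using Lan_comm assms by blast
  have "pair_class (Zero C X Y) t \<otimes>\<^bsub>Lan X\<^esub> pair_class (Zero C X Y) t = pair_class (Zero C X Y) t"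
    using pair_class_Add[OF Z Z assms(2,3)] Add_Zero[OF Z] by simp
  then show ?thesis using HX.r_cancel_one pair_class_closed[OF Z assms(2,3)] by simp
qed

text \<open>
  The criterion behind all later chases. By construction the extension of \<open>e\<close> and some \<open>d\<close> vanishing
  on \<open>X\<close> restrict \<open>t\<close> and an element \<open>s\<close> to the same element; amalgamating over both morphisms yields
  \<open>k\<close>, which kills \<open>e\<close> because \<open>d\<close> vanishes on \<open>X\<close>.
\<close>
lemma pair_class_eq_one:
  assumes e: "e \<in> Hom C X Y" and Y: "Y \<in> A" and t: "t \<in> carrier (G Y)" and z: "pair_class e t = \<one>\<^bsub>Lan X\<^esub>"
  obtains W k d where "W \<in> A" "k \<in> Hom C Y W" "d \<in> carrier (G W)" "k \<cdot> e = Zero C X W" "r k d = t"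
proof -
  have X: "X \<in> Ob C" using e Hom_Ob by blast
  note g = extend_Hom[OF e Y]
  have "r (extend e) t \<in> null_elements X"
    using z e quot_one[OF X r_closed[OF g refl_ob_A[OF X] Y t]] by (simp add: pair_class_def Hom_def)
  then obtain d s V where d: "r (extend e) t = r d s" "V \<in> A" "d \<in> Hom C (refl_ob X) V" "d \<cdot> refl_map X = Zero C X V" "s \<in> carrier (G V)"
    unfolding null_elements_def by blast
  obtain i :: 'u where True by blast
  have I: "small U {i}" by (rule small_finite[OF univ]) simp
  obtain W w v x where W: "W \<in> A" "w \<in> Hom C Y W" "\<And>n. n \<in> {i} \<Longrightarrow> v n \<in> Hom C V W"
    "\<And>n. n \<in> {i} \<Longrightarrow> w \<cdot> extend e = v n \<cdot> d" "x \<in> carrier (G W)" "r w x = t"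
  proof (rule amalgamation[OF I Y t, of "\<lambda>_. refl_ob X" "\<lambda>_. V" "\<lambda>_. extend e" "\<lambda>_. d" "\<lambda>_. s"])
    show "refl_ob X \<in> A" "V \<in> A" "extend e \<in> Hom C (refl_ob X) Y" "d \<in> Hom C (refl_ob X) V" "s \<in> carrier (G V)" "r (extend e) t = r d s"
      using refl_ob_A[OF X] d g by auto
  qed (rule that)
  have v: "v i \<in> Hom C V W" "w \<cdot> extend e = v i \<cdot> d" using W(3,4) by auto
  have "w \<cdot> e = v i \<cdot> d \<cdot> refl_map X"
    using Comp_assoc[OF refl_map_Hom[OF X] g W(2)] extend_Comp[OF e Y] v(2) by simp
  also have "\<dots> = Zero C X W"
    using Comp_assoc[OF refl_map_Hom[OF X] d(3) v(1)] d(4) Comp_Zero[OF v(1) X] by simp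
  finally show ?thesis using that[OF W(1,2,5) _ W(6)] by blast
qed

text \<open>
  Restriction along \<open>f\<close> composes the first component of a pair with \<open>f\<close>. An arbitrary representative
  over the weak reflection of the codomain is used; \<open>Lan_map_pair_class\<close> shows independence.
\<close>
definition Lan_map :: "'m \<Rightarrow> 'g set \<Rightarrow> 'g set" where
  "Lan_map f u = pair_class (refl_map (Cod C f) \<cdot> f) (SOME t. t \<in> carrier (G (refl_ob (Cod C f))) \<and> pair_class (refl_map (Cod C f)) t = u)"

lemma Lan_map_pair_class:
  assumes f: "f \<in> Hom C X Y" and e: "e \<in> Hom C Y Z" and Z: "Z \<in> A" and t: "t \<in> carrier (G Z)"
  shows "Lan_map f (pair_class e t) = pair_class (e \<cdot> f) t"
proof -
  have Y: "Y \<in> Ob C" and X: "X \<in> Ob C" using f Hom_Ob by auto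
  note RY = refl_ob_A[OF Y] and aY = refl_map_Hom[OF Y] and g = extend_Hom[OF e Z]
  define s where "s = (SOME t'. t' \<in> carrier (G (refl_ob Y)) \<and> pair_class (refl_map Y) t' = pair_class e t)"
  have "\<exists>t'. t' \<in> carrier (G (refl_ob Y)) \<and> pair_class (refl_map Y) t' = pair_class e t"
    using pair_class_surj[OF Y pair_class_closed[OF e Z t]] by metis
  then have "s \<in> carrier (G (refl_ob Y)) \<and> pair_class (refl_map Y) s = pair_class e t"
    unfolding s_def by (rule someI_ex)
  then have s: "s \<in> carrier (G (refl_ob Y))" "pair_class (refl_map Y) s = pair_class e t" by auto
  define t' where "t' = r (extend e) t"
  have t': "t' \<in> carrier (G (refl_ob Y))" using r_closed[OF g RY Z t] t'_def by simp
  have et: "pair_class e t = pair_class (refl_map Y) t'"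
    using pair_class_Comp[OF aY g RY Z t] extend_Comp[OF e Z] t'_def by simp
  interpret GR: group "G (refl_ob Y)" using G_group RY .
  interpret HY: comm_group "Lan Y" using Lan_comm Y .
  interpret HX: comm_group "Lan X" using Lan_comm X .
  have b: "refl_map Y \<cdot> f \<in> Hom C X (refl_ob Y)" using Comp_in_Hom[OF f aY] .
  let ?d = "s \<otimes>\<^bsub>G (refl_ob Y)\<^esub> inv\<^bsub>G (refl_ob Y)\<^esub> t'"
  have d: "?d \<in> carrier (G (refl_ob Y))" using s t' by simp
  have sd: "?d \<otimes>\<^bsub>G (refl_ob Y)\<^esub> t' = s" using s t' by (simp add: GR.m_assoc)
  have "pair_class (refl_map Y) ?d \<otimes>\<^bsub>Lan Y\<^esub> pair_class (refl_map Y) t' = pair_class (refl_map Y) t'"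
    using pair_class_mult[OF aY RY d t'] sd s(2) et by simp
  then have "pair_class (refl_map Y) ?d = \<one>\<^bsub>Lan Y\<^esub>"
    using HY.l_cancel_one pair_class_closed[OF aY RY] d t' by simp
  then obtain W k c where W: "W \<in> A" "k \<in> Hom C (refl_ob Y) W" "c \<in> carrier (G W)" "k \<cdot> refl_map Y = Zero C Y W" "r k c = ?d"
    using pair_class_eq_one[OF aY RY d] by metis
  have "pair_class (refl_map Y \<cdot> f) ?d = pair_class (k \<cdot> (refl_map Y \<cdot> f)) c"
    using pair_class_Comp[OF b W(2) RY W(1,3)] W(5) by simp
  also have "\<dots> = \<one>\<^bsub>Lan X\<^esub>"
    using Comp_assoc[OF f aY W(2)] W(4) Zero_Comp[OF f A_in_Ob[OF W(1)]] pair_class_Zero[OF X W(1,3)] by simp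
  finally have "pair_class (refl_map Y \<cdot> f) s = pair_class (refl_map Y \<cdot> f) t'"
    using pair_class_mult[OF b RY d t'] sd pair_class_closed[OF b RY t'] by simp
  also have "\<dots> = pair_class (extend e \<cdot> (refl_map Y \<cdot> f)) t" using pair_class_Comp[OF b g RY Z t] t'_def by simp
  also have "\<dots> = pair_class (e \<cdot> f) t" using Comp_assoc[OF f aY g] extend_Comp[OF e Z] by simp
  finally have "pair_class (refl_map Y \<cdot> f) s = pair_class (e \<cdot> f) t" .
  moreover have "Cod C f = Y" using f by (simp add: Hom_def)
  ultimately show ?thesis unfolding Lan_map_def s_def by simp
qed

lemma Lan_presheaf: "presheaf C U (Ob C) Lan Lan_map"
proof (intro presheaf.intro presheaf_axioms.intro preadditive_category_axioms)
  show "comm_group (Lan X)" if "X \<in> Ob C" for X using Lan_comm that .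
  show "small U (carrier (Lan X))" if "X \<in> Ob C" for X
    using small_image[OF G_small[OF refl_ob_A[OF that]], of "quot X"] quot_surj[OF that] by simp
  show "Lan_map f \<in> hom (Lan Y) (Lan X)" if f: "f \<in> Hom C X Y" and X: "X \<in> Ob C" and Y: "Y \<in> Ob C" for f X Y
  proof (rule homI)
    note aY = refl_map_Hom[OF Y] and RY = refl_ob_A[OF Y] and b = Comp_in_Hom[OF f refl_map_Hom[OF Y]]
    fix u assume "u \<in> carrier (Lan Y)"
    then obtain s where s: "s \<in> carrier (G (refl_ob Y))" "u = pair_class (refl_map Y) s" using pair_class_surj[OF Y] by blast
    then show "Lan_map f u \<in> carrier (Lan X)" using Lan_map_pair_class[OF f aY RY] pair_class_closed[OF b RY] by simp
    fix v assume "v \<in> carrier (Lan Y)"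
    then obtain t where t: "t \<in> carrier (G (refl_ob Y))" "v = pair_class (refl_map Y) t" using pair_class_surj[OF Y] by blast
    have st: "s \<otimes>\<^bsub>G (refl_ob Y)\<^esub> t \<in> carrier (G (refl_ob Y))"
      using s t monoid.m_closed[OF group.is_monoid[OF G_group[OF RY]]] by blast
    then show "Lan_map f (u \<otimes>\<^bsub>Lan Y\<^esub> v) = Lan_map f u \<otimes>\<^bsub>Lan X\<^esub> Lan_map f v"
      using s t pair_class_mult[OF aY RY s(1) t(1)] pair_class_mult[OF b RY s(1) t(1)] Lan_map_pair_class[OF f aY RY] by metis
  qed
  show "Lan_map (Idn C X) u = u" if X: "X \<in> Ob C" and u: "u \<in> carrier (Lan X)" for X u
    using pair_class_surj[OF X u] Lan_map_pair_class[OF Idn_in_Hom[OF X] refl_map_Hom[OF X] refl_ob_A[OF X]] Comp_Idn_right[OF refl_map_Hom[OF X]] by metis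
  show "Lan_map (g \<cdot> f) u = Lan_map f (Lan_map g u)" if "f \<in> Hom C X Y" "g \<in> Hom C Y Z" "Z \<in> Ob C" "u \<in> carrier (Lan Z)" for f g X Y Z u
    using pair_class_surj[OF that(3,4)] Lan_map_pair_class[OF that(1) Comp_in_Hom[OF that(2) refl_map_Hom[OF that(3)]] refl_ob_A[OF that(3)]]
      Lan_map_pair_class[OF that(2) refl_map_Hom[OF that(3)] refl_ob_A[OF that(3)]]
      Lan_map_pair_class[OF Comp_in_Hom[OF that(1,2)] refl_map_Hom[OF that(3)] refl_ob_A[OF that(3)]] Comp_assoc[OF that(1,2) refl_map_Hom[OF that(3)]]
    by metis
  show "Lan_map (Add C f g) u = Lan_map f u \<otimes>\<^bsub>Lan X\<^esub> Lan_map g u"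
    if f: "f \<in> Hom C X Y" and g: "g \<in> Hom C X Y" and Y: "Y \<in> Ob C" and u: "u \<in> carrier (Lan Y)" for f g X Y u
  proof -
    note aY = refl_map_Hom[OF Y] and RY = refl_ob_A[OF Y]
    obtain s where s: "s \<in> carrier (G (refl_ob Y))" "u = pair_class (refl_map Y) s" using pair_class_surj[OF Y u] .
    then show ?thesis
      using Lan_map_pair_class[OF f aY RY] Lan_map_pair_class[OF g aY RY] Lan_map_pair_class[OF Add_Hom[OF f g] aY RY]
        Comp_Add_right[OF f g aY] pair_class_Add[OF Comp_in_Hom[OF f aY] Comp_in_Hom[OF g aY] RY s(1)] by simp
  qed
qed simp

text \<open>
  Let \<open>a\<close> be the weak reflection of \<open>Y\<close>. If the class of \<open>(a \<cdot> f, t)\<close> vanishes, then \<open>t\<close> comes from an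
  element along some \<open>k\<close> with \<open>k \<cdot> a \<cdot> f = 0\<close>; this composite factors through \<open>g\<close>, and the factorization is the desired preimage.
\<close>
lemma Lan_exact:
  assumes w: "weak_cokernel_pair C f g" and f: "f \<in> Hom C X Y" and g: "g \<in> Hom C Y Z"
    and u: "u \<in> carrier (Lan Y)" and z: "Lan_map f u = \<one>\<^bsub>Lan X\<^esub>"
  shows "\<exists>v\<in>carrier (Lan Z). Lan_map g v = u"
proof -
  have Y: "Y \<in> Ob C" using f Hom_Ob by blast
  note aY = refl_map_Hom[OF Y] and RY = refl_ob_A[OF Y]
  obtain t where t: "t \<in> carrier (G (refl_ob Y))" "u = pair_class (refl_map Y) t" using pair_class_surj[OF Y u] .
  have "pair_class (refl_map Y \<cdot> f) t = \<one>\<^bsub>Lan X\<^esub>" using z t Lan_map_pair_class[OF f aY RY t(1)] by simp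
  then obtain W k d where W: "W \<in> A" "k \<in> Hom C (refl_ob Y) W" "d \<in> carrier (G W)"
    "k \<cdot> (refl_map Y \<cdot> f) = Zero C X W" "r k d = t"
    using pair_class_eq_one[OF Comp_in_Hom[OF f aY] RY t(1)] by metis
  have "k \<cdot> refl_map Y \<cdot> f = Zero C X W" using W(4) Comp_assoc[OF f aY W(2)] by simp
  then obtain m where m: "m \<in> Hom C Z W" "k \<cdot> refl_map Y = m \<cdot> g"
    using weak_cokernel_pair_factor[OF w category_axioms Comp_in_Hom[OF aY W(2)] g f] by metis
  have "Lan_map g (pair_class m d) = u"
    using Lan_map_pair_class[OF g m(1) W(1,3)] m(2) pair_class_Comp[OF aY W(2) RY W(1,3)] W(5) t(2) by simp
  then show ?thesis using pair_class_closed[OF m(1) W(1,3)] by blast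
qed

text \<open>
  Given pairs over the summands, the coproduct of their targets carries a pair over the coproduct, so
  the comparison map is surjective. For injectivity the criterion for vanishing gives one morphism
  \<open>k i\<close> for each summand; amalgamating them all gives a single morphism that kills the class.
\<close>
lemma Lan_products:
  assumes I: "small U (I :: 'u set)" and S: "is_coproduct C I F S \<iota>"
    and x: "\<And>i. i \<in> I \<Longrightarrow> x i \<in> carrier (Lan (F i))"
  shows "\<exists>!s. s \<in> carrier (Lan S) \<and> (\<forall>i\<in>I. Lan_map (\<iota> i) s = x i)"
proof -
  interpret HP: presheaf C U "Ob C" Lan Lan_map by (rule Lan_presheaf)
  have SO: "S \<in> Ob C" and FO: "\<And>i. i \<in> I \<Longrightarrow> F i \<in> Ob C" and \<iota>: "\<And>i. i \<in> I \<Longrightarrow> \<iota> i \<in> Hom C (F i) S"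
    using coproductD[OF S] by auto
  have inj: "u = \<one>\<^bsub>Lan S\<^esub>" if u: "u \<in> carrier (Lan S)" and uz: "\<And>i. i \<in> I \<Longrightarrow> Lan_map (\<iota> i) u = \<one>\<^bsub>Lan (F i)\<^esub>" for u
  proof -
    note aS = refl_map_Hom[OF SO] and RS = refl_ob_A[OF SO]
    obtain t where t: "t \<in> carrier (G (refl_ob S))" "u = pair_class (refl_map S) t" using pair_class_surj[OF SO u] .
    have "\<exists>W k d. W \<in> A \<and> k \<in> Hom C (refl_ob S) W \<and> d \<in> carrier (G W) \<and>
        k \<cdot> (refl_map S \<cdot> \<iota> i) = Zero C (F i) W \<and> r k d = t" if i: "i \<in> I" for i
    proof -
      have "pair_class (refl_map S \<cdot> \<iota> i) t = \<one>\<^bsub>Lan (F i)\<^esub>" using uz[OF i] t Lan_map_pair_class[OF \<iota>[OF i] aS RS t(1)] by simp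
      then show ?thesis using pair_class_eq_one[OF Comp_in_Hom[OF \<iota>[OF i] aS] RS t(1)] by metis
    qed
    then obtain Q k d where Q: "\<And>i. i \<in> I \<Longrightarrow> Q i \<in> A" "\<And>i. i \<in> I \<Longrightarrow> k i \<in> Hom C (refl_ob S) (Q i)"
      "\<And>i. i \<in> I \<Longrightarrow> d i \<in> carrier (G (Q i))" "\<And>i. i \<in> I \<Longrightarrow> k i \<cdot> (refl_map S \<cdot> \<iota> i) = Zero C (F i) (Q i)"
      "\<And>i. i \<in> I \<Longrightarrow> r (k i) (d i) = t" by metis
    have Id: "Idn C (refl_ob S) \<in> Hom C (refl_ob S) (refl_ob S)" using Idn_in_Hom A_in_Ob RS by blast
    obtain W w v c where W: "W \<in> A" "w \<in> Hom C (refl_ob S) W" "\<And>i. i \<in> I \<Longrightarrow> v i \<in> Hom C (Q i) W"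
      "\<And>i. i \<in> I \<Longrightarrow> w \<cdot> Idn C (refl_ob S) = v i \<cdot> k i" "c \<in> carrier (G W)" "r w c = t"
    proof (rule amalgamation[OF I RS t(1), of "\<lambda>_. refl_ob S" Q "\<lambda>_. Idn C (refl_ob S)" k d])
      show "refl_ob S \<in> A" "Idn C (refl_ob S) \<in> Hom C (refl_ob S) (refl_ob S)" using RS Id by auto
      show "Q i \<in> A" "k i \<in> Hom C (refl_ob S) (Q i)" "d i \<in> carrier (G (Q i))" "r (Idn C (refl_ob S)) t = r (k i) (d i)"
        if "i \<in> I" for i
        using Q that r_Idn[OF RS t(1)] by auto
    qed (rule that)
    have "w \<cdot> refl_map S = Zero C S W"
    proof (rule coproduct_unique[OF S category_axioms Comp_in_Hom[OF aS W(2)] Zero_Hom[OF SO A_in_Ob[OF W(1)]]])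
      fix i assume i: "i \<in> I"
      have "w \<cdot> refl_map S \<cdot> \<iota> i = w \<cdot> (refl_map S \<cdot> \<iota> i)" by (rule Comp_assoc[OF \<iota>[OF i] aS W(2)])
      also have "\<dots> = v i \<cdot> k i \<cdot> (refl_map S \<cdot> \<iota> i)" using W(4)[OF i] Comp_Idn_right[OF W(2)] by simp
      also have "\<dots> = v i \<cdot> (k i \<cdot> (refl_map S \<cdot> \<iota> i))"
        by (rule Comp_assoc[OF Comp_in_Hom[OF \<iota>[OF i] aS] Q(2)[OF i] W(3)[OF i]])
      also have "\<dots> = Zero C (F i) W" using Q(4)[OF i] Comp_Zero[OF W(3)[OF i] FO[OF i]] by simp
      also have "\<dots> = Zero C S W \<cdot> \<iota> i" using Zero_Comp[OF \<iota>[OF i] A_in_Ob[OF W(1)]] by simp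
      finally show "w \<cdot> refl_map S \<cdot> \<iota> i = Zero C S W \<cdot> \<iota> i" .
    qed
    then show "u = \<one>\<^bsub>Lan S\<^esub>"
      using pair_class_Comp[OF aS W(2) RS W(1,5)] W(6) t(2) pair_class_Zero[OF SO W(1,5)] by simp
  qed
  have "\<exists>t. t \<in> carrier (G (refl_ob (F i))) \<and> x i = pair_class (refl_map (F i)) t" if "i \<in> I" for i
    using pair_class_surj[OF FO[OF that] x[OF that]] by metis
  then obtain t where t: "\<And>i. i \<in> I \<Longrightarrow> t i \<in> carrier (G (refl_ob (F i)))" "\<And>i. i \<in> I \<Longrightarrow> x i = pair_class (refl_map (F i)) (t i)"
    by metis
  obtain E l where E: "is_coproduct C I (\<lambda>i. refl_ob (F i)) E l" "E \<in> A"
    using coproduct_in_A[OF I, of "\<lambda>i. refl_ob (F i)"] refl_ob_A FO by blast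
  have l: "l i \<in> Hom C (refl_ob (F i)) E" if "i \<in> I" for i using coproductD(3)[OF E(1) that] .
  obtain s where s: "s \<in> carrier (G E)" "\<And>i. i \<in> I \<Longrightarrow> r (l i) s = t i"
    using products[OF I E(1) refl_ob_A[OF FO] t(1)] by blast
  obtain e where e: "e \<in> Hom C S E" "\<And>i. i \<in> I \<Longrightarrow> e \<cdot> \<iota> i = l i \<cdot> refl_map (F i)"
    using coproduct_factor[OF S A_in_Ob[OF E(2)], of "\<lambda>i. l i \<cdot> refl_map (F i)"] Comp_in_Hom[OF refl_map_Hom[OF FO] l] by blast
  have es: "pair_class e s \<in> carrier (Lan S)" using pair_class_closed[OF e(1) E(2) s(1)] .
  have ei: "Lan_map (\<iota> i) (pair_class e s) = x i" if i: "i \<in> I" for i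
    using Lan_map_pair_class[OF \<iota>[OF i] e(1) E(2) s(1)] e(2)[OF i]
      pair_class_Comp[OF refl_map_Hom[OF FO[OF i]] l[OF i] refl_ob_A[OF FO[OF i]] E(2) s(1)] s(2)[OF i] t(2)[OF i] by simp
  show ?thesis
  proof (rule ex1I[of _ "pair_class e s"])
    show "pair_class e s \<in> carrier (Lan S) \<and> (\<forall>i\<in>I. Lan_map (\<iota> i) (pair_class e s) = x i)" using es ei by blast
    fix v assume v: "v \<in> carrier (Lan S) \<and> (\<forall>i\<in>I. Lan_map (\<iota> i) v = x i)"
    interpret HS: comm_group "Lan S" using Lan_comm SO .
    have "Lan_map (\<iota> i) (v \<otimes>\<^bsub>Lan S\<^esub> inv\<^bsub>Lan S\<^esub> pair_class e s) = \<one>\<^bsub>Lan (F i)\<^esub>" if i: "i \<in> I" for i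
    proof -
      interpret Hi: comm_group "Lan (F i)" using Lan_comm FO i by blast
      show ?thesis
        using HP.r_mult[OF \<iota>[OF i] FO[OF i] SO] HP.r_inv[OF \<iota>[OF i] FO[OF i] SO] ei[OF i] v es i x[OF i] by simp
    qed
    then have "v \<otimes>\<^bsub>Lan S\<^esub> inv\<^bsub>Lan S\<^esub> pair_class e s = \<one>\<^bsub>Lan S\<^esub>" using inj v es by simp
    then show "v = pair_class e s" using HS.inv_solve_right' v es by simp
  qed
qed

text \<open>
  The representing object \<open>L\<close> of the left Kan extension lies in \<open>A\<close>: the universal element is a class
  \<open>(a, t)\<close> over the weak reflection \<open>a\<close> of \<open>L\<close>, and the class \<open>(id, t)\<close> over its target corresponds to a
  morphism \<open>p\<close> back to \<open>L\<close> with \<open>p \<cdot> a = id\<close>. On \<open>A\<close> the extension agrees with \<open>G\<close> by the criterion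
  for vanishing, so the universal element is an element of \<open>G L\<close>.
\<close>
theorem aisle_brown_representability:
  assumes "brown_representability U C"
  obtains N \<xi> where "N \<in> A" "\<xi> \<in> carrier (G N)"
    "\<And>X. X \<in> A \<Longrightarrow> bij_betw (\<lambda>f. r f \<xi>) (Hom C X N) (carrier (G X))"
proof -
  obtain L u where L: "L \<in> Ob C" "u \<in> carrier (Lan L)"
    "\<And>X. X \<in> Ob C \<Longrightarrow> bij_betw (\<lambda>f. Lan_map f u) (Hom C X L) (carrier (Lan X))"
  proof (rule brown_universal_element[OF assms Lan_presheaf])
    show "\<exists>z\<in>carrier (Lan Z). Lan_map g z = y"
      if "weak_cokernel_pair C f g" "f \<in> Hom C X Y" "g \<in> Hom C Y Z" "y \<in> carrier (Lan Y)" "Lan_map f y = \<one>\<^bsub>Lan X\<^esub>"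
      for X Y Z f g y
      by (rule Lan_exact[OF that])
    show "\<exists>!s. s \<in> carrier (Lan S) \<and> (\<forall>i\<in>I. Lan_map (\<iota> i) s = x i)"
      if "small U I" "is_coproduct C I F S \<iota>" "\<And>i. i \<in> I \<Longrightarrow> x i \<in> carrier (Lan (F i))"
      for I :: "'u set" and F S \<iota> x
      by (rule Lan_products[OF that])
  qed (rule that)
  note aL = refl_map_Hom[OF L(1)] and RL = refl_ob_A[OF L(1)]
  obtain t where t: "t \<in> carrier (G (refl_ob L))" "u = pair_class (refl_map L) t" using pair_class_surj[OF L(1,2)] .
  have "pair_class (Idn C (refl_ob L)) t \<in> carrier (Lan (refl_ob L))"
    using pair_class_closed[OF Idn_in_Hom[OF A_in_Ob[OF RL]] RL t(1)] .
  then obtain p where p: "p \<in> Hom C (refl_ob L) L" "Lan_map p u = pair_class (Idn C (refl_ob L)) t"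
    using L(3)[OF A_in_Ob[OF RL]] unfolding bij_betw_def by (metis (no_types, lifting) image_iff)
  interpret HP: presheaf C U "Ob C" Lan Lan_map by (rule Lan_presheaf)
  have "Lan_map (p \<cdot> refl_map L) u = Lan_map (refl_map L) (pair_class (Idn C (refl_ob L)) t)"
    using HP.r_Comp[OF aL p(1) L(1) A_in_Ob[OF RL] L(1,2)] p(2) by simp
  also have "\<dots> = u"
    using Lan_map_pair_class[OF aL Idn_in_Hom[OF A_in_Ob[OF RL]] RL t(1)] Comp_Idn_left[OF aL] t(2) by simp
  also have "\<dots> = Lan_map (Idn C L) u" using HP.r_Idn[OF L(1,2)] by simp
  \<comment> \<open>Both morphisms pull the universal element back to itself.\<close>
  finally have "p \<cdot> refl_map L = Idn C L"
    using L(3)[OF L(1)] Comp_in_Hom[OF aL p(1)] Idn_in_Hom[OF L(1)] unfolding bij_betw_def inj_on_def by blast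
  then have LA: "L \<in> A" using A_retracts L(1) RL aL p(1) unfolding closed_under_retracts_def by blast
  have Id: "Idn C L \<in> Hom C L L" using Idn_in_Hom L(1) .
  have "\<exists>x\<in>carrier (G L). pair_class (Idn C L) x = u"
  proof
    show "r (refl_map L) t \<in> carrier (G L)" using r_closed[OF aL LA RL t(1)] .
    show "pair_class (Idn C L) (r (refl_map L) t) = u"
      using pair_class_Comp[OF Id aL LA RL t(1)] Comp_Idn_right[OF aL] t(2) by simp
  qed
  then obtain \<xi> where \<xi>: "\<xi> \<in> carrier (G L)" "pair_class (Idn C L) \<xi> = u" by blast
  have inj: "x = y" if X: "X \<in> A" and x: "x \<in> carrier (G X)" and y: "y \<in> carrier (G X)"
    and eq: "pair_class (Idn C X) x = pair_class (Idn C X) y" for X x y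
  proof -
    interpret GX: group "G X" using G_group X .
    have XO: "X \<in> Ob C" using A_in_Ob X .
    have I: "Idn C X \<in> Hom C X X" using Idn_in_Hom XO .
    interpret HX: comm_group "Lan X" using Lan_comm XO .
    let ?d = "x \<otimes>\<^bsub>G X\<^esub> inv\<^bsub>G X\<^esub> y"
    have d: "?d \<in> carrier (G X)" using x y by simp
    have "pair_class (Idn C X) ?d \<otimes>\<^bsub>Lan X\<^esub> pair_class (Idn C X) y = pair_class (Idn C X) y"
      using pair_class_mult[OF I X d y] x y eq by (simp add: GX.m_assoc)
    then have "pair_class (Idn C X) ?d = \<one>\<^bsub>Lan X\<^esub>" using HX.l_cancel_one pair_class_closed[OF I X] d y by simp
    then obtain W k c where W: "W \<in> A" "k \<in> Hom C X W" "c \<in> carrier (G W)" "k \<cdot> Idn C X = Zero C X W" "r k c = ?d"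
      using pair_class_eq_one[OF I X d] by metis
    then have "?d = \<one>\<^bsub>G X\<^esub>" using Comp_Idn_right[OF W(2)] r_Zero[OF X W(1,3)] by simp
    then show "x = y" using GX.inv_solve_right' x y by simp
  qed
  have cl: "Lan_map f u = pair_class (Idn C X) (r f \<xi>)" if X: "X \<in> A" and f: "f \<in> Hom C X L" for X f
    using Lan_map_pair_class[OF f Id LA \<xi>(1)] \<xi>(2) Comp_Idn_left[OF f] Comp_Idn_right[OF f]
      pair_class_Comp[OF Idn_in_Hom[OF A_in_Ob[OF X]] f X LA \<xi>(1)] by simp
  have "bij_betw (\<lambda>f. r f \<xi>) (Hom C X L) (carrier (G X))" if X: "X \<in> A" for X
  proof -
    note b = L(3)[OF A_in_Ob[OF X]] and I = Idn_in_Hom[OF A_in_Ob[OF X]]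
    have rc: "r f \<xi> \<in> carrier (G X)" if "f \<in> Hom C X L" for f using r_closed[OF that X LA \<xi>(1)] .
    show ?thesis unfolding bij_betw_def
    proof
      show "inj_on (\<lambda>f. r f \<xi>) (Hom C X L)"
        using b cl[OF X] unfolding bij_betw_def inj_on_def by metis
      show "(\<lambda>f. r f \<xi>) ` Hom C X L = carrier (G X)"
      proof (intro equalityI subsetI)
        fix x assume x: "x \<in> carrier (G X)"
        then obtain f where f: "f \<in> Hom C X L" "Lan_map f u = pair_class (Idn C X) x"
          using b pair_class_closed[OF I X x] unfolding bij_betw_def by (metis (no_types, lifting) image_iff)
        then have "r f \<xi> = x" using inj[OF X rc[OF f(1)] x] cl[OF X f(1)] by simp
        then show "x \<in> (\<lambda>f. r f \<xi>) ` Hom C X L" using f by blast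
      qed (use rc in auto)
    qed
  qed
  then show ?thesis using that LA \<xi>(1) by blast
qed

end

section \<open>Representable presheaves and the adjacent t-structure\<close>

lemma (in preadditive_category) representable_presheaf:
  assumes "locally_small U C" "D \<subseteq> Ob C" "M \<in> Ob C"
  shows "presheaf C U D (\<lambda>X. hom_group C X M) (\<lambda>f m. m \<cdot> f)"
proof (intro presheaf.intro presheaf_axioms.intro preadditive_category_axioms)
  fix X assume X: "X \<in> D"
  then have XO: "X \<in> Ob C" using assms by blast
  show "comm_group (hom_group C X M)" using hom_comm_group XO assms by blast
  show "small U (carrier (hom_group C X M))"
    using assms XO unfolding locally_small_def by simp
  show "x \<cdot> Idn C X = x" if "x \<in> carrier (hom_group C X M)" for x
    using Comp_Idn_right that by simp
next
  show "(\<lambda>m. m \<cdot> f) \<in> hom (hom_group C Y M) (hom_group C X M)" if "f \<in> Hom C X Y" for f X Y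
    by (rule homI) (use that Comp_in_Hom Comp_Add_left in auto)
  show "z \<cdot> (g \<cdot> f) = z \<cdot> g \<cdot> f" if "f \<in> Hom C X Y" "g \<in> Hom C Y Z" "z \<in> carrier (hom_group C Z M)" for f g X Y Z z
    using that Comp_assoc by simp
  show "y \<cdot> Add C f g = y \<cdot> f \<otimes>\<^bsub>hom_group C X M\<^esub> (y \<cdot> g)"
    if "f \<in> Hom C X Y" "g \<in> Hom C X Y" "y \<in> carrier (hom_group C Y M)" for f g X Y y
    using that Comp_Add_right by simp
qed (use assms in auto)

lemma (in category) coproduct_Hom_bijection:
  assumes S: "is_coproduct C I F S \<iota>" and Z: "Z \<in> Ob C" and x: "\<And>i. i \<in> I \<Longrightarrow> x i \<in> Hom C (F i) Z"
  shows "\<exists>!s. s \<in> Hom C S Z \<and> (\<forall>i\<in>I. s \<cdot> \<iota> i = x i)"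
  using S Z x unfolding is_coproduct_def by simp

text \<open>
  The class of objects right orthogonal to \<open>A[1]\<close>; it is \<open>C\<^sub>t\<^sub>\<le>\<^sub>0\<close> for the \<open>t\<close>-structure with
  \<open>C\<^sub>t\<^sub>\<ge>\<^sub>0 = A\<close>.
\<close>
definition coaisle :: "('o, 'm, 'x) tricat_scheme \<Rightarrow> 'o set \<Rightarrow> 'o set" where
  "coaisle C A = {Y \<in> Ob C. \<forall>X\<in>A. \<forall>f \<in> Hom C (FOb (Shift C) X) Y. f = Zero C (FOb (Shift C) X) Y}"

context triangulated_category
begin

text \<open>
  The cone of \<open>u\<close> shifted back by one; the two other morphisms change sign.
\<close>
lemma fiber:
  assumes u: "u \<in> Hom C X (T L)" and L: "L \<in> Ob C"
  obtains Y s p where "distinguished C L Y X s p u"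
proof -
  have X: "X \<in> Ob C" using u Hom_Ob by blast
  obtain V v w where V: "distinguished C X (T L) V u v w" using Tri_completion[OF u] by blast
  have v: "v \<in> Hom C (T L) V" and w: "w \<in> Hom C V (T X)" using distinguishedD[OF V] by auto
  obtain Y where Y: "Y \<in> Ob C" "T Y = V" using T_surj Hom_Ob[OF v] by metis
  have v': "v \<in> Hom C (T L) (T Y)" and w': "w \<in> Hom C (T Y) (T X)" using v w Y by auto
  obtain s where s: "s \<in> Hom C L Y" "Ta s = Neg C v" using Ta_full[OF L Y(1) Neg_Hom[OF v']] .
  obtain p where p: "p \<in> Hom C Y X" "Ta p = Neg C w" using Ta_full[OF Y(1) X Neg_Hom[OF w']] .
  have e: "Neg C (Ta s) = v" "Neg C (Ta p) = w" using s p Neg_Neg[OF v'] Neg_Neg[OF w'] by auto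
  have "distinguished C L Y X s p u"
    by (rule rotate_back[OF s(1) rotate_back[OF p(1)]]) (use e V Y in simp)
  then show ?thesis using that by blast
qed

lemma triangle_retract_left:
  assumes D: "distinguished C X Y Z f g h" and g: "g = Zero C Y Z"
  shows "\<exists>i \<in> Hom C Y X. \<exists>p \<in> Hom C X Y. p \<cdot> i = Idn C Y"
proof -
  have f: "f \<in> Hom C X Y" and gH: "g \<in> Hom C Y Z" using distinguishedD[OF D] by auto
  have Y: "Y \<in> Ob C" using f Hom_Ob by blast
  have "g \<cdot> Idn C Y = Zero C Y Z" using Comp_Idn_right[OF gH] g by simp
  then obtain i where "i \<in> Hom C Y X" "Idn C Y = f \<cdot> i"
    using triangle_factor_left[OF D Idn_in_Hom[OF Y]] by metis
  then show ?thesis using f by metis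
qed

lemma triangle_retract_right:
  assumes D: "distinguished C X Y Z f g h" and f: "f = Zero C X Y"
  shows "\<exists>i \<in> Hom C Y Z. \<exists>p \<in> Hom C Z Y. p \<cdot> i = Idn C Y"
proof -
  have fH: "f \<in> Hom C X Y" and g: "g \<in> Hom C Y Z" using distinguishedD[OF D] by auto
  have Y: "Y \<in> Ob C" using g Hom_Ob by blast
  have "Idn C Y \<cdot> f = Zero C X Y" using Comp_Idn_left[OF fH] f by simp
  then obtain p where "p \<in> Hom C Z Y" "Idn C Y = p \<cdot> g"
    using triangle_factor_right[OF D Idn_in_Hom[OF Y]] by metis
  then show ?thesis using g by metis
qed

lemma shift_triangle:
  assumes "distinguished C X Y Z f g h"
  shows "distinguished C (T X) (T Y) (T Z) (Neg C (Ta f)) (Neg C (Ta g)) (Neg C (Ta h))"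
  using rotate[OF rotate[OF rotate[OF assms]]] .

lemma T_inv: assumes "X \<in> Ob C" shows "T (shift_ob C (-1) X) = X" "shift_ob C (-1) X \<in> Ob C"
  using assms shift_bij_Ob unfolding shift_ob_def bij_betw_def
  by (simp_all add: f_inv_into_f inv_into_into)

lemma inv_T: assumes "X \<in> Ob C" shows "shift_ob C (-1) (T X) = X"
  using assms shift_bij_Ob unfolding shift_ob_def bij_betw_def by simp

end

context reflective_aisle
begin

theorem aisle_coreflection:
  assumes "brown_representability U C" "locally_small U C" "M \<in> Ob C"
  obtains L l where "L \<in> A" "l \<in> Hom C L M" "\<And>X. X \<in> A \<Longrightarrow> bij_betw (\<lambda>f. l \<cdot> f) (Hom C X L) (Hom C X M)"
proof -
  interpret P: presheaf C U A "\<lambda>X. hom_group C X M" "\<lambda>f m. m \<cdot> f"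
    by (rule representable_presheaf[OF assms(2) A_Ob assms(3)])
  interpret aisle_presheaf C U A "\<lambda>X. hom_group C X M" "\<lambda>f m. m \<cdot> f"
  proof (intro aisle_presheaf.intro aisle_presheaf_axioms.intro reflective_aisle_axioms P.presheaf_axioms)
    show "\<exists>z\<in>carrier (hom_group C Z M). z \<cdot> g = y"
      if "distinguished C X Y Z f g h" "y \<in> carrier (hom_group C Y M)" "y \<cdot> f = \<one>\<^bsub>hom_group C X M\<^esub>" for X Y Z f g h y
      using triangle_factor_right[OF that(1), of y M] that(2,3) by (metis hom_group_simps(1,3))
    show "\<exists>!s. s \<in> carrier (hom_group C S M) \<and> (\<forall>i\<in>I. s \<cdot> \<iota> i = x i)"
      if "is_coproduct C I F S \<iota>" "\<And>i. i \<in> I \<Longrightarrow> x i \<in> carrier (hom_group C (F i) M)" for I :: "'u set" and F S \<iota> x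
      using coproduct_Hom_bijection[OF that(1) assms(3)] that(2) by simp
  qed
  obtain L l where "L \<in> A" "l \<in> carrier (hom_group C L M)"
    "\<And>X. X \<in> A \<Longrightarrow> bij_betw (\<lambda>f. l \<cdot> f) (Hom C X L) (carrier (hom_group C X M))"
    by (rule aisle_brown_representability[OF assms(1)]) (rule that)
  then show ?thesis using that by simp
qed

text \<open>
  Let \<open>Y\<close> be the fiber of \<open>h \<cdot> x\<close>, an extension of \<open>X\<close> by \<open>L\<close> and hence in \<open>A\<close>. The induced morphism
  \<open>y : Y \<rightarrow> M\<close> restricts to \<open>l\<close> on \<open>L\<close> and factors through \<open>l\<close>, so \<open>L \<rightarrow> Y\<close> is split and \<open>h \<cdot> x = 0\<close>.
  Then \<open>x\<close> lifts to \<open>M\<close>, further to \<open>L\<close>, and the composite \<open>L \<rightarrow> M \<rightarrow> R\<close> is zero.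
\<close>
lemma coreflection_cone:
  assumes L: "L \<in> A" and D: "distinguished C L M R l g h"
    and bij: "\<And>X. X \<in> A \<Longrightarrow> bij_betw (\<lambda>f. l \<cdot> f) (Hom C X L) (Hom C X M)"
    and X: "X \<in> A" and x: "x \<in> Hom C X R"
  shows "x = Zero C X R"
proof -
  note LO = A_in_Ob[OF L] and XO = A_in_Ob[OF X]
  have l: "l \<in> Hom C L M" and g: "g \<in> Hom C M R" and h: "h \<in> Hom C R (T L)" using distinguishedD[OF D] by auto
  have M: "M \<in> Ob C" and R: "R \<in> Ob C" using g Hom_Ob by auto
  have u: "h \<cdot> x \<in> Hom C X (T L)" using Comp_in_Hom[OF x h] .
  \<comment> \<open>\<open>Y\<close> is the pullback of \<open>x\<close> and \<open>g\<close>.\<close>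
  obtain Y s p where Y: "distinguished C L Y X s p (h \<cdot> x)" using fiber[OF u LO] .
  have s: "s \<in> Hom C L Y" and p: "p \<in> Hom C Y X" using distinguishedD[OF Y] by auto
  have YO: "Y \<in> Ob C" using p Hom_Ob by blast
  have YA: "Y \<in> A" using A_extension[OF Y L X] .
  have "\<exists>c \<in> Hom C (T Y) (T M). c \<cdot> Neg C (Ta s) = Neg C (Ta l) \<cdot> Idn C (T L) \<and>
      shift_arr C 1 x \<cdot> Neg C (Ta p) = Neg C (Ta g) \<cdot> c"
    by (rule Tri_morphism[OF rotate[OF rotate[OF Y]] rotate[OF rotate[OF D]] x Idn_in_Hom[OF T_Ob[OF LO]]])
       (rule Comp_Idn_left[OF u])
  then obtain c where c: "c \<in> Hom C (T Y) (T M)" "c \<cdot> Neg C (Ta s) = Neg C (Ta l) \<cdot> Idn C (T L)"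
    by (elim bexE conjE)
  obtain y where y: "y \<in> Hom C Y M" "Ta y = c" using Ta_full[OF YO M c(1)] .
  have "Neg C (Ta (y \<cdot> s)) = Neg C (Ta l)"
    using c(2) y Comp_Neg[OF Ta_Hom[OF s] c(1)] Ta_Comp[OF s y(1)] Comp_Idn_right[OF Neg_Hom[OF Ta_Hom[OF l]]] by simp
  then have "Ta (y \<cdot> s) = Ta l"
    using Neg_Neg[OF Ta_Hom[OF Comp_in_Hom[OF s y(1)]]] Neg_Neg[OF Ta_Hom[OF l]] by metis
  then have ys: "y \<cdot> s = l" by (rule Ta_inj[OF Comp_in_Hom[OF s y(1)] l])
  obtain y' where y': "y' \<in> Hom C Y L" "l \<cdot> y' = y"
    using bij[OF YA] y(1) unfolding bij_betw_def by (metis (no_types, lifting) image_iff)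
  have "l \<cdot> (y' \<cdot> s) = l \<cdot> Idn C L" using Comp_assoc[OF s y'(1) l] y'(2) ys Comp_Idn_right[OF l] by simp
  then have ret: "y' \<cdot> s = Idn C L"
    using bij[OF L] Comp_in_Hom[OF s y'(1)] Idn_in_Hom[OF LO] unfolding bij_betw_def inj_on_def by blast
  have "Ta s \<cdot> (h \<cdot> x) = Zero C X (T Y)"
    using triangle_weak_cokernels(3)[OF Y] s u Ta_Hom[OF s] unfolding weak_cokernel_pair_def Hom_def by simp
  then have "Ta y' \<cdot> (Ta s \<cdot> (h \<cdot> x)) = Zero C X (T L)" using Comp_Zero[OF Ta_Hom[OF y'(1)] XO] by simp
  then have "h \<cdot> x = Zero C X (T L)"
    using Comp_assoc[OF u Ta_Hom[OF s] Ta_Hom[OF y'(1)]] Ta_Comp[OF s y'(1)] ret Ta_Idn[OF LO] Comp_Idn_left[OF u] by simp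
  then obtain m where m: "m \<in> Hom C X M" "x = g \<cdot> m" using triangle_factor_left[OF rotate[OF D] x] by blast
  obtain m' where m': "m' \<in> Hom C X L" "l \<cdot> m' = m"
    using bij[OF X] m(1) unfolding bij_betw_def by (metis (no_types, lifting) image_iff)
  have "x = g \<cdot> l \<cdot> m'" using m m' Comp_assoc[OF m'(1) l g] by simp
  then show ?thesis using triangle_Comp[OF D] Zero_Comp[OF m'(1) R] by simp
qed

theorem aisle_t_structure:
  assumes "brown_representability U C" "locally_small U C"
  shows "t_structure C (coaisle C A) A"
  unfolding t_structure_def
proof (intro conjI)
  let ?B = "coaisle C A"
  have BI: "Y \<in> ?B" if "Y \<in> Ob C" "\<And>X f. X \<in> A \<Longrightarrow> f \<in> Hom C (T X) Y \<Longrightarrow> f = Zero C (T X) Y" for Y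
    using that unfolding coaisle_def by blast
  have BD: "f = Zero C (T X) Y" if "Y \<in> ?B" "X \<in> A" "f \<in> Hom C (T X) Y" for X Y f
    using that unfolding coaisle_def by blast
  show BO: "?B \<subseteq> Ob C" unfolding coaisle_def by blast
  show "A \<subseteq> Ob C" by (rule A_Ob)
  have iso: "\<exists>i \<in> Hom C X Y. \<exists>p \<in> Hom C Y X. p \<cdot> i = Idn C X" if "isomorphic_in C X Y" for X Y
    using that unfolding isomorphic_in_def is_isomorphism_def Hom_def by fastforce
  show "closed_under_isomorphism C ?B"
    unfolding closed_under_isomorphism_def
  proof (intro ballI impI)
    fix X Y assume X: "X \<in> Ob C" and Y: "Y \<in> ?B" and "isomorphic_in C X Y"
    then obtain i p where ip: "i \<in> Hom C X Y" "p \<in> Hom C Y X" "p \<cdot> i = Idn C X" using iso by blast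
    show "X \<in> ?B"
    proof (rule BI[OF X])
      fix Z f assume Z: "Z \<in> A" and f: "f \<in> Hom C (T Z) X"
      have "f = p \<cdot> (i \<cdot> f)" using Comp_assoc[OF f ip(1,2)] ip(3) Comp_Idn_left[OF f] by simp
      also have "\<dots> = Zero C (T Z) X"
        using BD[OF Y Z Comp_in_Hom[OF f ip(1)]] Comp_Zero[OF ip(2) T_Ob[OF A_in_Ob[OF Z]]] by simp
      finally show "f = Zero C (T Z) X" .
    qed
  qed
  show "closed_under_isomorphism C A"
    using iso A_retracts unfolding closed_under_isomorphism_def closed_under_retracts_def by blast
  show "?B \<subseteq> shift_class C 1 ?B"
  proof
    fix Y assume Y: "Y \<in> ?B"
    then obtain Y' where Y': "Y' \<in> Ob C" "T Y' = Y" using T_surj BO by blast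
    have "Y' \<in> ?B"
    proof (rule BI[OF Y'(1)])
      fix X f assume X: "X \<in> A" and f: "f \<in> Hom C (T X) Y'"
      have "Ta f = Zero C (T (T X)) Y" using BD[OF Y A_shift[OF X]] Ta_Hom[OF f] Y' by simp
      then show "f = Zero C (T X) Y'"
        using Ta_Zero[OF T_Ob[OF A_in_Ob[OF X]] Y'(1)] Y'(2) Ta_inj[OF f Zero_Hom[OF T_Ob[OF A_in_Ob[OF X]] Y'(1)]] by simp
    qed
    then show "Y \<in> shift_class C 1 ?B" using Y' by (auto simp: shift_class_def)
  qed
  show "shift_class C 1 A \<subseteq> A" using A_shift by (auto simp: shift_class_def)
  show "orthogonal C (shift_class C 1 A) ?B"
    unfolding orthogonal_def
  proof (intro ballI)
    fix V Y assume "V \<in> shift_class C 1 A" and Y: "Y \<in> ?B"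
    then obtain X where X: "X \<in> A" "V = T X" by (auto simp: shift_class_def)
    have "Zero C V Y \<in> Hom C V Y" using Zero_Hom T_Ob A_in_Ob X BO Y by blast
    then show "Hom C V Y = {Zero C V Y}" using BD[OF Y X(1)] X(2) by blast
  qed
  show "\<forall>M\<in>Ob C. \<exists>L\<in>A. \<exists>R\<in>shift_class C (- 1) ?B. \<exists>f g h. distinguished C L M R f g h"
  proof
    fix M assume M: "M \<in> Ob C"
    obtain L l where L: "L \<in> A" "l \<in> Hom C L M" "\<And>X. X \<in> A \<Longrightarrow> bij_betw (\<lambda>f. l \<cdot> f) (Hom C X L) (Hom C X M)"
      using aisle_coreflection[OF assms M] by blast
    obtain R g h where D: "distinguished C L M R l g h" using Tri_completion[OF L(2)] by blast
    have R: "R \<in> Ob C" using distinguishedD[OF D] Hom_Ob by blast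
    have "T R \<in> ?B"
    proof (rule BI[OF T_Ob[OF R]])
      fix X f assume X: "X \<in> A" and f: "f \<in> Hom C (T X) (T R)"
      obtain x where x: "x \<in> Hom C X R" "Ta x = f" using Ta_full[OF A_in_Ob[OF X] R f] .
      then show "f = Zero C (T X) (T R)"
        using coreflection_cone[OF L(1) D L(3) X x(1)] Ta_Zero[OF A_in_Ob[OF X] R] by simp
    qed
    then have "R \<in> shift_class C (- 1) ?B" using inv_T[OF R] by (metis shift_class_def imageI)
    then show "\<exists>L\<in>A. \<exists>R\<in>shift_class C (- 1) ?B. \<exists>f g h. distinguished C L M R f g h" using L(1) D by blast
  qed
qed

end

section \<open>Weight structures\<close>

locale weighted_category = triangulated_category C
  for C :: "('o, 'm, 'x) tricat_scheme" (structure) +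
  fixes Wle Wge :: "'o set"
  assumes weight: "weight_structure C Wle Wge"
begin

lemma W_Ob: "X \<in> Wle \<Longrightarrow> X \<in> Ob C" "X \<in> Wge \<Longrightarrow> X \<in> Ob C"
  using weight unfolding weight_structure_def by blast+

lemma Wge_shift: "X \<in> Wge \<Longrightarrow> T X \<in> Wge"
  using weight unfolding weight_structure_def shift_class_def by auto

lemma W_orthogonal: "\<lbrakk>X \<in> Wle; Y \<in> Wge; f \<in> Hom C X (T Y)\<rbrakk> \<Longrightarrow> f = Zero C X (T Y)"
  using weight unfolding weight_structure_def shift_class_def orthogonal_def by auto

lemma W_decomposition:
  assumes "M \<in> Ob C"
  obtains L R f g h where "L \<in> Wle" "R \<in> Wge" "distinguished C L M (T R) f g h"
  using weight assms unfolding weight_structure_def shift_class_def by fastforce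

text \<open>
  If \<open>Y[1]\<close> receives no nonzero morphism from \<open>Wle\<close>, its weight decomposition splits.
\<close>
lemma Wge_iff: "Y \<in> Wge \<longleftrightarrow> Y \<in> Ob C \<and> (\<forall>L\<in>Wle. \<forall>f \<in> Hom C L (T Y). f = Zero C L (T Y))"
proof
  assume Y: "Y \<in> Ob C \<and> (\<forall>L\<in>Wle. \<forall>f \<in> Hom C L (T Y). f = Zero C L (T Y))"
  then have YO: "Y \<in> Ob C" by blast
  obtain L R f g h where D: "L \<in> Wle" "R \<in> Wge" "distinguished C L (T Y) (T R) f g h"
    using W_decomposition[OF T_Ob[OF YO]] .
  have "f = Zero C L (T Y)" using Y D distinguishedD by blast
  then obtain i p where ip: "i \<in> Hom C (T Y) (T R)" "p \<in> Hom C (T R) (T Y)" "p \<cdot> i = Idn C (T Y)"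
    using triangle_retract_right[OF D(3)] by blast
  obtain i' where i': "i' \<in> Hom C Y R" "Ta i' = i" using Ta_full[OF YO W_Ob(2)[OF D(2)] ip(1)] .
  obtain p' where p': "p' \<in> Hom C R Y" "Ta p' = p" using Ta_full[OF W_Ob(2)[OF D(2)] YO ip(2)] .
  have "Ta (p' \<cdot> i') = Ta (Idn C Y)" using Ta_Comp[OF i'(1) p'(1)] Ta_Idn[OF YO] i' p' ip by simp
  then have "p' \<cdot> i' = Idn C Y" using Ta_inj[OF Comp_in_Hom[OF i'(1) p'(1)] Idn_in_Hom[OF YO]] by simp
  then show "Y \<in> Wge"
    using weight YO D(2) i'(1) p'(1) unfolding weight_structure_def closed_under_retracts_def by blast
qed (use W_Ob W_orthogonal in blast)

lemma Wle_iff: "X \<in> Wle \<longleftrightarrow> X \<in> Ob C \<and> (\<forall>Y\<in>Wge. \<forall>f \<in> Hom C X (T Y). f = Zero C X (T Y))"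
proof
  assume X: "X \<in> Ob C \<and> (\<forall>Y\<in>Wge. \<forall>f \<in> Hom C X (T Y). f = Zero C X (T Y))"
  then have XO: "X \<in> Ob C" by blast
  obtain L R f g h where D: "L \<in> Wle" "R \<in> Wge" "distinguished C L X (T R) f g h"
    using W_decomposition[OF XO] .
  have "g = Zero C X (T R)" using X D distinguishedD by blast
  then show "X \<in> Wle"
    using triangle_retract_left[OF D(3)] weight XO D(1)
    unfolding weight_structure_def closed_under_retracts_def by blast
qed (use W_Ob W_orthogonal in blast)

lemma Wge_extension:
  assumes D: "distinguished C X Y Z f g h" and X: "X \<in> Wge" and Z: "Z \<in> Wge"
  shows "Y \<in> Wge"
  unfolding Wge_iff
proof (intro conjI ballI)
  have f: "f \<in> Hom C X Y" and g: "g \<in> Hom C Y Z" using distinguishedD[OF D] by auto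
  show "Y \<in> Ob C" using f Hom_Ob by blast
  fix L n assume L: "L \<in> Wle" and n: "n \<in> Hom C L (T Y)"
  note S = shift_triangle[OF D]
  have f': "Neg C (Ta f) \<in> Hom C (T X) (T Y)" and g': "Neg C (Ta g) \<in> Hom C (T Y) (T Z)"
    using distinguishedD[OF S] by auto
  have "Neg C (Ta g) \<cdot> n = Zero C L (T Z)" using W_orthogonal[OF L Z Comp_in_Hom[OF n g']] .
  then obtain n' where n': "n' \<in> Hom C L (T X)" "n = Neg C (Ta f) \<cdot> n'" using triangle_factor_left[OF S n] by blast
  then show "n = Zero C L (T Y)" using W_orthogonal[OF L X n'(1)] Comp_Zero[OF f' W_Ob(1)[OF L]] by simp
qed

text \<open>
  The second morphism of a weight decomposition of \<open>X[1]\<close>, shifted back, is a weak reflection: the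
  first vertex has no nonzero morphisms to \<open>Z[1]\<close> for \<open>Z\<close> in \<open>Wge\<close>.
\<close>
lemma Wge_weakly_reflective:
  assumes X: "X \<in> Ob C"
  shows "\<exists>Y a. Y \<in> Wge \<and> a \<in> Hom C X Y \<and> (\<forall>Z\<in>Wge. \<forall>e \<in> Hom C X Z. \<exists>g \<in> Hom C Y Z. g \<cdot> a = e)"
proof -
  obtain L R f g h where D: "L \<in> Wle" "R \<in> Wge" "distinguished C L (T X) (T R) f g h"
    using W_decomposition[OF T_Ob[OF X]] .
  have f: "f \<in> Hom C L (T X)" and g: "g \<in> Hom C (T X) (T R)" using distinguishedD[OF D(3)] by auto
  obtain a where a: "a \<in> Hom C X R" "Ta a = g" using Ta_full[OF X W_Ob(2)[OF D(2)] g] .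
  have "\<exists>k \<in> Hom C R Z. k \<cdot> a = e" if Z: "Z \<in> Wge" and e: "e \<in> Hom C X Z" for Z e
  proof -
    have "Ta e \<cdot> f = Zero C L (T Z)" using W_orthogonal[OF D(1) Z Comp_in_Hom[OF f Ta_Hom[OF e]]] .
    then obtain k' where k': "k' \<in> Hom C (T R) (T Z)" "Ta e = k' \<cdot> g"
      using triangle_factor_right[OF D(3) Ta_Hom[OF e]] by blast
    obtain k where k: "k \<in> Hom C R Z" "Ta k = k'" using Ta_full[OF W_Ob(2)[OF D(2)] W_Ob(2)[OF Z] k'(1)] .
    have "Ta (k \<cdot> a) = Ta e" using Ta_Comp[OF a(1) k(1)] a k k' by simp
    then show ?thesis using Ta_inj[OF Comp_in_Hom[OF a(1) k(1)] e] k by blast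
  qed
  then show ?thesis using a(1) D(2) by blast
qed

lemma Wge_reflective_aisle:
  assumes "universe U" "has_small_coproducts U C" "closed_under_small_coproducts U C Wge"
  shows "reflective_aisle C U Wge"
proof (intro reflective_aisle.intro reflective_aisle_axioms.intro triangulated_category_axioms)
  show "closed_under_retracts C Wge" using weight by (simp add: weight_structure_def)
qed (use assms W_Ob Wge_shift Wge_extension Wge_weakly_reflective in blast)+

end

locale adjacent_structures = weighted_category C Wle Wge
  for C :: "('o, 'm, 'x) tricat_scheme" (structure) and Wle Wge +
  fixes Tle :: "'o set"
  assumes tstr: "t_structure C Tle Wge"
begin

lemma Tle_Ob: "X \<in> Tle \<Longrightarrow> X \<in> Ob C"
  using tstr unfolding t_structure_def by blast

lemma t_orthogonal: "\<lbrakk>X \<in> Wge; Y \<in> Tle; f \<in> Hom C (T X) Y\<rbrakk> \<Longrightarrow> f = Zero C (T X) Y"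
  using tstr unfolding t_structure_def shift_class_def orthogonal_def by auto

lemma t_decomposition:
  assumes "M \<in> Ob C"
  obtains L R f g h where "L \<in> Wge" "R \<in> Ob C" "T R \<in> Tle" "distinguished C L M R f g h"
proof -
  obtain L R f g h where D: "L \<in> Wge" "R \<in> shift_class C (-1) Tle" "distinguished C L M R f g h"
    using tstr assms unfolding t_structure_def by blast
  then have "R \<in> Ob C" "T R \<in> Tle" using T_inv Tle_Ob unfolding shift_class_def by auto
  then show ?thesis using that D by blast
qed

text \<open>
  A morphism from a coproduct of objects of \<open>Wge\<close> to an object of \<open>Tle[-1]\<close> vanishes on every summand,
  so the \<open>t\<close>-decomposition of the coproduct splits.
\<close>
lemma Wge_coproducts: "closed_under_small_coproducts U C Wge"
  unfolding closed_under_small_coproducts_def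
proof (intro allI impI, elim conjE)
  fix I :: "'b set" and F S \<iota>
  assume S: "is_coproduct C I F S \<iota>" and F: "\<forall>i\<in>I. F i \<in> Wge"
  have SO: "S \<in> Ob C" using coproductD[OF S] by blast
  obtain L R f g h where D: "L \<in> Wge" "R \<in> Ob C" "T R \<in> Tle" "distinguished C L S R f g h"
    using t_decomposition[OF SO] .
  have g: "g \<in> Hom C S R" using distinguishedD[OF D(4)] by blast
  have "g = Zero C S R"
  proof (rule coproduct_unique[OF S category_axioms g Zero_Hom[OF SO D(2)]])
    fix i assume i: "i \<in> I"
    have \<iota>: "\<iota> i \<in> Hom C (F i) S" and Fi: "F i \<in> Ob C" using coproductD[OF S] i by auto
    note gi = Comp_in_Hom[OF \<iota> g]
    have "Ta (g \<cdot> \<iota> i) = Zero C (T (F i)) (T R)" using t_orthogonal[OF _ D(3) Ta_Hom[OF gi]] F i by blast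
    then have "g \<cdot> \<iota> i = Zero C (F i) R" using Ta_Zero[OF Fi D(2)] Ta_inj[OF gi Zero_Hom[OF Fi D(2)]] by simp
    then show "g \<cdot> \<iota> i = Zero C S R \<cdot> \<iota> i" using Zero_Comp[OF \<iota> D(2)] by simp
  qed
  then show "S \<in> Wge"
    using triangle_retract_left[OF D(4)] weight SO D(1)
    unfolding weight_structure_def closed_under_retracts_def by blast
qed

text \<open>
  If \<open>Y\<close> is right orthogonal to \<open>Wge[1]\<close>, the shifted \<open>t\<close>-decomposition of \<open>Y[-1]\<close> makes \<open>Y\<close> a retract of
  some \<open>R[1]\<close> in \<open>Tle\<close>. The complementary idempotent factors through \<open>Wge[2]\<close>, which has no nonzero
  morphisms to \<open>Tle\<close>, so \<open>Y\<close> is even isomorphic to \<open>R[1]\<close>.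
\<close>
lemma Tle_eq: "Tle = coaisle C Wge"
proof (intro equalityI subsetI)
  fix Y assume "Y \<in> Tle"
  then show "Y \<in> coaisle C Wge" using t_orthogonal Tle_Ob unfolding coaisle_def by blast
next
  fix Y assume "Y \<in> coaisle C Wge"
  then have Y: "Y \<in> Ob C" "\<And>X f. X \<in> Wge \<Longrightarrow> f \<in> Hom C (T X) Y \<Longrightarrow> f = Zero C (T X) Y"
    unfolding coaisle_def by auto
  obtain Y' where Y': "Y' \<in> Ob C" "T Y' = Y" using T_surj[OF Y(1)] .
  obtain L R f g h where D: "L \<in> Wge" "R \<in> Ob C" "T R \<in> Tle" "distinguished C L Y' R f g h"
    using t_decomposition[OF Y'(1)] .
  note S = shift_triangle[OF D(4)]
  let ?f = "Neg C (Ta f)" and ?g = "Neg C (Ta g)" and ?h = "Neg C (Ta h)"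
  have H: "?f \<in> Hom C (T L) Y" "?g \<in> Hom C Y (T R)" "?h \<in> Hom C (T R) (T (T L))"
    using distinguishedD[OF S] Y'(2) by auto
  have "?f = Zero C (T L) Y" using Y(2)[OF D(1) H(1)] .
  then have "Idn C Y \<cdot> ?f = Zero C (T L) Y" using Comp_Idn_left[OF H(1)] by simp
  then obtain k where k: "k \<in> Hom C (T R) Y" "Idn C Y = k \<cdot> ?g"
    using triangle_factor_right[OF S, of "Idn C Y" Y] Idn_in_Hom[OF Y(1)] Y'(2) by metis
  have TR: "T R \<in> Ob C" using T_Ob D by blast
  let ?e = "?g \<cdot> k"
  have e: "?e \<in> Hom C (T R) (T R)" using Comp_in_Hom[OF k(1) H(2)] .
  have I: "Idn C (T R) \<in> Hom C (T R) (T R)" using Idn_in_Hom TR .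
  have "Sub C ?e (Idn C (T R)) \<cdot> ?g = Zero C Y (T R)"
    using Sub_Comp[OF H(2) e I] Comp_assoc[OF H(2) k(1) H(2)] k(2) Comp_Idn_right[OF H(2)] Comp_Idn_left[OF H(2)]
      Sub_Zero_iff[OF H(2) H(2)] by simp
  then obtain z where z: "z \<in> Hom C (T (T L)) (T R)" "Sub C ?e (Idn C (T R)) = z \<cdot> ?h"
    using triangle_factor_right[OF rotate[OF S], of "Sub C ?e (Idn C (T R))" "T R"] Sub_Hom[OF e I] Y'(2) by metis
  have "z = Zero C (T (T L)) (T R)" using t_orthogonal[OF Wge_shift[OF D(1)] D(3) z(1)] .
  then have "Sub C ?e (Idn C (T R)) = Zero C (T R) (T R)" using z(2) Zero_Comp[OF H(3) TR] by simp
  then have "?e = Idn C (T R)" using Sub_Zero_iff[OF e I] by simp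
  then have "isomorphic_in C Y (T R)"
    using H(2) k unfolding isomorphic_in_def is_isomorphism_def Hom_def by fastforce
  then show "Y \<in> Tle" using tstr Y(1) D(3) unfolding t_structure_def closed_under_isomorphism_def by blast
qed

end

theorem adjacent_t_structure_iff_smashing:
  assumes U: "universe U" and C: "smashing_triangulated U C" and B: "brown_representability U C"
    and w: "weight_structure C Wle Wge"
  shows "(\<exists>Tle Tge. t_structure C Tle Tge \<and> adjacent (Tle, Tge) (Wle, Wge)) \<longleftrightarrow>
    smashing_weight_structure U C Wle Wge"
proof -
  interpret triangulated_category C using C by (simp add: smashing_triangulated_def)
  interpret weighted_category C Wle Wge by unfold_locales (rule w)
  show ?thesis
  proof
    assume "\<exists>Tle Tge. t_structure C Tle Tge \<and> adjacent (Tle, Tge) (Wle, Wge)"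
    then obtain Tle where t: "t_structure C Tle Wge" by (auto simp: adjacent_def)
    interpret adjacent_structures C Wle Wge Tle by unfold_locales (rule t)
    show "smashing_weight_structure U C Wle Wge"
      using w C Wge_coproducts by (simp add: smashing_weight_structure_def)
  next
    assume "smashing_weight_structure U C Wle Wge"
    then have cp: "closed_under_small_coproducts U C Wge" by (simp add: smashing_weight_structure_def)
    interpret reflective_aisle C U Wge
      by (rule Wge_reflective_aisle[OF U _ cp]) (use C in \<open>simp add: smashing_triangulated_def\<close>)
    have "t_structure C (coaisle C Wge) Wge"
      by (rule aisle_t_structure[OF B]) (use C in \<open>simp add: smashing_triangulated_def\<close>)
    then show "\<exists>Tle Tge. t_structure C Tle Tge \<and> adjacent (Tle, Tge) (Wle, Wge)"
      by (auto simp: adjacent_def)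
  qed
qed

section \<open>Coproducts of distinguished triangles\<close>

context triangulated_category
begin

text \<open>
  The cone of a coproduct of morphisms has the universal property of the coproduct of the cones. Both
  halves are the five lemma for the functors \<open>C(-, N)\<close>, carried out on elements.
\<close>
lemma cone_coproduct:
  assumes cX: "is_coproduct C I X SX \<kappa>" and cY: "is_coproduct C I Y SY l"
    and tri: "\<And>i. i \<in> I \<Longrightarrow> distinguished C (X i) (Y i) (Z i) (f i) (g i) (h i)"
    and D: "distinguished C SX SY SZ F G K"
    and comm: "\<And>i. i \<in> I \<Longrightarrow> F \<cdot> \<kappa> i = l i \<cdot> f i"
  obtains \<mu> where "is_coproduct C I Z SZ \<mu>" "\<And>i. i \<in> I \<Longrightarrow> \<mu> i \<cdot> g i = G \<cdot> l i"
proof -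
  have \<kappa>: "\<kappa> i \<in> Hom C (X i) SX" and l: "l i \<in> Hom C (Y i) SY" and f: "f i \<in> Hom C (X i) (Y i)"
    and g: "g i \<in> Hom C (Y i) (Z i)" and h: "h i \<in> Hom C (Z i) (T (X i))"
    and XO: "X i \<in> Ob C" and YO: "Y i \<in> Ob C" if "i \<in> I" for i
    using coproductD[OF cX] coproductD[OF cY] distinguishedD[OF tri] that by auto
  have F: "F \<in> Hom C SX SY" and G: "G \<in> Hom C SY SZ" and K: "K \<in> Hom C SZ (T SX)" using distinguishedD[OF D] by auto
  have SX: "SX \<in> Ob C" and SY: "SY \<in> Ob C" and SZ: "SZ \<in> Ob C" using F G Hom_Ob by auto
  have "\<exists>c. c \<in> Hom C (Z i) SZ \<and> c \<cdot> g i = G \<cdot> l i \<and> Ta (\<kappa> i) \<cdot> h i = K \<cdot> c" if i: "i \<in> I" for i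
  proof -
    have "l i \<cdot> f i = F \<cdot> \<kappa> i" using comm[OF i] by simp
    from Tri_morphism[OF tri[OF i] D \<kappa>[OF i] l[OF i] this] show ?thesis by auto
  qed
  then obtain \<mu> where \<mu>: "\<And>i. i \<in> I \<Longrightarrow> \<mu> i \<in> Hom C (Z i) SZ" "\<And>i. i \<in> I \<Longrightarrow> \<mu> i \<cdot> g i = G \<cdot> l i"
    "\<And>i. i \<in> I \<Longrightarrow> Ta (\<kappa> i) \<cdot> h i = K \<cdot> \<mu> i" by metis
  have cTX: "is_coproduct C I (\<lambda>i. T (X i)) (T SX) (\<lambda>i. Ta (\<kappa> i))"
    using coproduct_shift_iff[of I X SX \<kappa>] XO SX \<kappa> cX by blast
  have cTY: "is_coproduct C I (\<lambda>i. T (Y i)) (T SY) (\<lambda>i. Ta (l i))"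
    using coproduct_shift_iff[of I Y SY l] YO SY l cY by blast
  \<comment> \<open>First half of the five lemma: the inclusions \<open>\<mu> i\<close> are jointly epic.\<close>
  have zero: "n = Zero C SZ N" if n: "n \<in> Hom C SZ N" and nz: "\<And>i. i \<in> I \<Longrightarrow> n \<cdot> \<mu> i = Zero C (Z i) N" for n N
  proof -
    have N: "N \<in> Ob C" using n Hom_Ob by blast
    have nG: "n \<cdot> G \<in> Hom C SY N" using Comp_in_Hom[OF G n] .
    have "n \<cdot> G = Zero C SY N"
    proof (rule coproduct_unique[OF cY category_axioms nG Zero_Hom[OF SY N]])
      fix i assume i: "i \<in> I"
      have "n \<cdot> G \<cdot> l i = n \<cdot> (\<mu> i \<cdot> g i)" using Comp_assoc[OF l[OF i] G n] \<mu>(2)[OF i] by simp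
      also have "\<dots> = n \<cdot> \<mu> i \<cdot> g i" using Comp_assoc[OF g[OF i] \<mu>(1)[OF i] n] by simp
      also have "\<dots> = Zero C SY N \<cdot> l i" using nz[OF i] Zero_Comp[OF g[OF i] N] Zero_Comp[OF l[OF i] N] by simp
      finally show "n \<cdot> G \<cdot> l i = Zero C SY N \<cdot> l i" .
    qed
    then obtain n' where n': "n' \<in> Hom C (T SX) N" "n = n' \<cdot> K" using triangle_factor_right[OF rotate[OF D] n] by blast
    have "\<exists>m. m \<in> Hom C (T (Y i)) N \<and> n' \<cdot> Ta (\<kappa> i) = m \<cdot> Ta (f i)" if i: "i \<in> I" for i
    proof -
      have nk: "n' \<cdot> Ta (\<kappa> i) \<in> Hom C (T (X i)) N" using Comp_in_Hom[OF Ta_Hom[OF \<kappa>[OF i]] n'(1)] .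
      have "n' \<cdot> Ta (\<kappa> i) \<cdot> h i = n' \<cdot> (K \<cdot> \<mu> i)"
        using Comp_assoc[OF h[OF i] Ta_Hom[OF \<kappa>[OF i]] n'(1)] \<mu>(3)[OF i] by simp
      also have "\<dots> = Zero C (Z i) N" using Comp_assoc[OF \<mu>(1)[OF i] K n'(1)] n'(2) nz[OF i] by simp
      finally show ?thesis
        using weak_cokernel_pair_factor[OF triangle_weak_cokernels(3)[OF tri[OF i]] category_axioms nk Ta_Hom[OF f[OF i]] h[OF i]]
        by metis
    qed
    then obtain m where m: "\<And>i. i \<in> I \<Longrightarrow> m i \<in> Hom C (T (Y i)) N"
      "\<And>i. i \<in> I \<Longrightarrow> n' \<cdot> Ta (\<kappa> i) = m i \<cdot> Ta (f i)" by metis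
    obtain M where M: "M \<in> Hom C (T SY) N" "\<And>i. i \<in> I \<Longrightarrow> M \<cdot> Ta (l i) = m i"
      using coproduct_factor[OF cTY N m(1)] by blast
    have "M \<cdot> Ta F = n'"
    proof (rule coproduct_unique[OF cTX category_axioms Comp_in_Hom[OF Ta_Hom[OF F] M(1)] n'(1)])
      fix i assume i: "i \<in> I"
      have "M \<cdot> Ta F \<cdot> Ta (\<kappa> i) = M \<cdot> Ta (l i \<cdot> f i)"
        using Comp_assoc[OF Ta_Hom[OF \<kappa>[OF i]] Ta_Hom[OF F] M(1)] Ta_Comp[OF \<kappa>[OF i] F] comm[OF i] by simp
      also have "\<dots> = n' \<cdot> Ta (\<kappa> i)"
        using Ta_Comp[OF f[OF i] l[OF i]] Comp_assoc[OF Ta_Hom[OF f[OF i]] Ta_Hom[OF l[OF i]] M(1)] M(2)[OF i] m(2)[OF i] by simp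
      finally show "M \<cdot> Ta F \<cdot> Ta (\<kappa> i) = n' \<cdot> Ta (\<kappa> i)" .
    qed
    then have "n = M \<cdot> (Ta F \<cdot> K)" using n'(2) Comp_assoc[OF K Ta_Hom[OF F] M(1)] by simp
    moreover have "Ta F \<cdot> K = Zero C SZ (T SY)"
      using triangle_weak_cokernels(3)[OF D] K Ta_Hom[OF F] unfolding weak_cokernel_pair_def Hom_def by simp
    ultimately show ?thesis using Comp_Zero[OF M(1) SZ] by simp
  qed
  have "is_coproduct C I Z SZ \<mu>"
    unfolding is_coproduct_def
  proof (intro conjI ballI allI impI)
    fix N n assume N: "N \<in> Ob C" and n: "\<forall>i\<in>I. n i \<in> Hom C (Z i) N"
    have ng: "n i \<cdot> g i \<in> Hom C (Y i) N" if "i \<in> I" for i using Comp_in_Hom[OF g[OF that]] n that by blast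
    obtain y where y: "y \<in> Hom C SY N" "\<And>i. i \<in> I \<Longrightarrow> y \<cdot> l i = n i \<cdot> g i" using coproduct_factor[OF cY N ng] by blast
    have "y \<cdot> F = Zero C SX N"
    proof (rule coproduct_unique[OF cX category_axioms Comp_in_Hom[OF F y(1)] Zero_Hom[OF SX N]])
      fix i assume i: "i \<in> I"
      have ni: "n i \<in> Hom C (Z i) N" using n i by blast
      have "y \<cdot> F \<cdot> \<kappa> i = y \<cdot> l i \<cdot> f i"
        using Comp_assoc[OF \<kappa>[OF i] F y(1)] comm[OF i] Comp_assoc[OF f[OF i] l[OF i] y(1)] by simp
      also have "\<dots> = n i \<cdot> (g i \<cdot> f i)" using y(2)[OF i] Comp_assoc[OF f[OF i] g[OF i] ni] by simp
      also have "\<dots> = Zero C SX N \<cdot> \<kappa> i"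
        using triangle_Comp[OF tri[OF i]] Comp_Zero[OF ni XO[OF i]] Zero_Comp[OF \<kappa>[OF i] N] by simp
      finally show "y \<cdot> F \<cdot> \<kappa> i = Zero C SX N \<cdot> \<kappa> i" .
    qed
    then obtain v where v: "v \<in> Hom C SZ N" "y = v \<cdot> G" using triangle_factor_right[OF D y(1)] by blast
    have "\<exists>m. m \<in> Hom C (T (X i)) N \<and> Sub C (v \<cdot> \<mu> i) (n i) = m \<cdot> h i" if i: "i \<in> I" for i
    proof -
      have ni: "n i \<in> Hom C (Z i) N" using n i by blast
      note vm = Comp_in_Hom[OF \<mu>(1)[OF i] v(1)]
      have "v \<cdot> \<mu> i \<cdot> g i = n i \<cdot> g i"
        using Comp_assoc[OF g[OF i] \<mu>(1)[OF i] v(1)] \<mu>(2)[OF i] Comp_assoc[OF l[OF i] G v(1)] v(2) y(2)[OF i] by simp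
      then have "Sub C (v \<cdot> \<mu> i) (n i) \<cdot> g i = Zero C (Y i) N"
        using Sub_Comp[OF g[OF i] vm ni] Sub_Zero_iff[OF ng[OF i] ng[OF i]] by simp
      then show ?thesis using triangle_factor_right[OF rotate[OF tri[OF i]] Sub_Hom[OF vm ni]] by metis
    qed
    then obtain m where m: "\<And>i. i \<in> I \<Longrightarrow> m i \<in> Hom C (T (X i)) N"
      "\<And>i. i \<in> I \<Longrightarrow> Sub C (v \<cdot> \<mu> i) (n i) = m i \<cdot> h i" by metis
    obtain M where M: "M \<in> Hom C (T SX) N" "\<And>i. i \<in> I \<Longrightarrow> M \<cdot> Ta (\<kappa> i) = m i"
      using coproduct_factor[OF cTX N m(1)] by blast
    \<comment> \<open>\<open>v\<close> has the right restrictions along the \<open>g i\<close> only; the error factors through the \<open>h i\<close>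
      and is corrected by a morphism through \<open>K\<close>.\<close>
    let ?u = "Sub C v (M \<cdot> K)"
    have MK: "M \<cdot> K \<in> Hom C SZ N" using Comp_in_Hom[OF K M(1)] .
    have u: "?u \<in> Hom C SZ N" using Sub_Hom[OF v(1) MK] .
    have ui: "?u \<cdot> \<mu> i = n i" if i: "i \<in> I" for i
    proof -
      have ni: "n i \<in> Hom C (Z i) N" using n i by blast
      note vm = Comp_in_Hom[OF \<mu>(1)[OF i] v(1)]
      have "M \<cdot> K \<cdot> \<mu> i = m i \<cdot> h i"
        using Comp_assoc[OF \<mu>(1)[OF i] K M(1)] \<mu>(3)[OF i] Comp_assoc[OF h[OF i] Ta_Hom[OF \<kappa>[OF i]] M(1)] M(2)[OF i] by simp
      then have "?u \<cdot> \<mu> i = Sub C (v \<cdot> \<mu> i) (Sub C (v \<cdot> \<mu> i) (n i))"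
        using Sub_Comp[OF \<mu>(1)[OF i] v(1) MK] m(2)[OF i] by simp
      also have "\<dots> = n i"
      proof -
        let ?a = "v \<cdot> \<mu> i" and ?b = "n i"
        note S = Sub_Hom[OF vm ni]
        have "Add C (Sub C ?a (Sub C ?a ?b)) (Sub C ?a ?b) = Add C ?b (Sub C ?a ?b)"
          using Add_Sub[OF vm S] Add_Sub[OF vm ni] Add_comm[OF ni S] by simp
        then have "Sub C (Add C (Sub C ?a (Sub C ?a ?b)) (Sub C ?a ?b)) (Sub C ?a ?b) = Sub C (Add C ?b (Sub C ?a ?b)) (Sub C ?a ?b)"
          by simp
        moreover have "Sub C (Add C x y) y = x" if "x \<in> Hom C (Z i) N" "y \<in> Hom C (Z i) N" for x y
          unfolding Sub_def using Add_assoc[OF that Neg_Hom[OF that(2)]] Add_Zero[OF that(1)]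
            hom_group_ops(6)[OF _ _ that(2)] Hom_Ob[OF that(2)] by simp
        ultimately show ?thesis using Sub_Hom[OF vm S] S ni by simp
      qed
      finally show ?thesis .
    qed
    show "\<exists>!u. u \<in> Hom C SZ N \<and> (\<forall>i\<in>I. u \<cdot> \<mu> i = n i)"
    proof (rule ex1I[of _ ?u])
      show "?u \<in> Hom C SZ N \<and> (\<forall>i\<in>I. ?u \<cdot> \<mu> i = n i)" using u ui by blast
      fix w assume w: "w \<in> Hom C SZ N \<and> (\<forall>i\<in>I. w \<cdot> \<mu> i = n i)"
      have "Sub C w ?u \<cdot> \<mu> i = Zero C (Z i) N" if i: "i \<in> I" for i
        using Sub_Comp[OF \<mu>(1)[OF i] _ u] w ui[OF i] i Sub_Zero_iff n by simp
      then have "Sub C w ?u = Zero C SZ N" using zero[OF Sub_Hom[OF _ u]] w by blast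
      then show "w = ?u" using Sub_Zero_iff[OF _ u] w by blast
    qed
  qed (use \<mu> SZ distinguishedD[OF tri] Hom_Ob in blast)+
  then show ?thesis using that \<mu> by blast
qed

lemma coproduct_comparison:
  assumes "is_coproduct C I Z S \<mu>" "is_coproduct C I Z S' \<nu>"
  obtains e where "e \<in> Hom C S S'" "is_isomorphism C e" "\<And>i. i \<in> I \<Longrightarrow> e \<cdot> \<mu> i = \<nu> i"
proof -
  have \<mu>: "\<mu> i \<in> Hom C (Z i) S" and \<nu>: "\<nu> i \<in> Hom C (Z i) S'" if "i \<in> I" for i
    using coproductD[OF assms(1)] coproductD[OF assms(2)] that by auto
  have S: "S \<in> Ob C" "S' \<in> Ob C" using coproductD(1)[OF assms(1)] coproductD(1)[OF assms(2)] by auto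
  obtain e where e: "e \<in> Hom C S S'" "\<And>i. i \<in> I \<Longrightarrow> e \<cdot> \<mu> i = \<nu> i" using coproduct_factor[OF assms(1) S(2) \<nu>] by blast
  obtain d where d: "d \<in> Hom C S' S" "\<And>i. i \<in> I \<Longrightarrow> d \<cdot> \<nu> i = \<mu> i" using coproduct_factor[OF assms(2) S(1) \<mu>] by blast
  have "d \<cdot> e = Idn C S"
    by (rule coproduct_unique[OF assms(1) category_axioms Comp_in_Hom[OF e(1) d(1)] Idn_in_Hom[OF S(1)]])
      (simp add: Comp_assoc[OF \<mu> e(1) d(1)] e(2) d(2) Comp_Idn_left[OF \<mu>])
  moreover have "e \<cdot> d = Idn C S'"
    by (rule coproduct_unique[OF assms(2) category_axioms Comp_in_Hom[OF d(1) e(1)] Idn_in_Hom[OF S(2)]])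
      (simp add: Comp_assoc[OF \<nu> d(1) e(1)] e(2) d(2) Comp_Idn_left[OF \<nu>])
  ultimately have "is_isomorphism C e" using e(1) d(1) unfolding is_isomorphism_def Hom_def by auto
  then show ?thesis using that e by blast
qed

lemma Idn_isomorphism: "X \<in> Ob C \<Longrightarrow> is_isomorphism C (Idn C X)"
  using Idn_in_Hom[of X] Comp_Idn_left[OF Idn_in_Hom[of X]] unfolding is_isomorphism_def Hom_def by auto

text \<open>
  The cone of the coproduct of the \<open>f i\<close> is one coproduct of the third vertices. The given coproduct is
  isomorphic to it, and the triangle is transported along this isomorphism.
\<close>
lemma coproduct_of_triangles:
  assumes cX: "is_coproduct C I X SX \<kappa>" and cY: "is_coproduct C I Y SY l" and cZ: "is_coproduct C I Z S \<iota>"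
    and tri: "\<And>i. i \<in> I \<Longrightarrow> distinguished C (X i) (Y i) (Z i) (f i) (g i) (h i)"
  obtains F G K where "distinguished C SX SY S F G K" "\<And>i. i \<in> I \<Longrightarrow> F \<cdot> \<kappa> i = l i \<cdot> f i"
    "\<And>i. i \<in> I \<Longrightarrow> G \<cdot> l i = \<iota> i \<cdot> g i"
proof -
  have l: "l i \<in> Hom C (Y i) SY" and f: "f i \<in> Hom C (X i) (Y i)" and g: "g i \<in> Hom C (Y i) (Z i)" if "i \<in> I" for i
    using coproductD[OF cY] distinguishedD[OF tri] that by auto
  have SX: "SX \<in> Ob C" and SY: "SY \<in> Ob C" and S: "S \<in> Ob C" using coproductD(1)[OF cX] coproductD(1)[OF cY] coproductD(1)[OF cZ] by auto
  obtain F where F: "F \<in> Hom C SX SY" "\<And>i. i \<in> I \<Longrightarrow> F \<cdot> \<kappa> i = l i \<cdot> f i"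
    using coproduct_factor[OF cX SY Comp_in_Hom[OF f l]] by blast
  obtain V G K where D: "distinguished C SX SY V F G K" using Tri_completion[OF F(1)] by blast
  have G: "G \<in> Hom C SY V" and K: "K \<in> Hom C V (T SX)" using distinguishedD[OF D] by auto
  obtain \<mu> where \<mu>: "is_coproduct C I Z V \<mu>" "\<And>i. i \<in> I \<Longrightarrow> \<mu> i \<cdot> g i = G \<cdot> l i"
    using cone_coproduct[OF cX cY tri D F(2)] by blast
  obtain e where e: "e \<in> Hom C V S" "is_isomorphism C e" "\<And>i. i \<in> I \<Longrightarrow> e \<cdot> \<mu> i = \<iota> i"
    using coproduct_comparison[OF \<mu>(1) cZ] by blast
  obtain d where d: "d \<in> Hom C S V" "d \<cdot> e = Idn C V" using e(1,2) unfolding is_isomorphism_def Hom_def by auto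
  have tr: "is_triangle C SX SY S (F, e \<cdot> G, K \<cdot> d)"
    using F(1) Comp_in_Hom[OF G e(1)] Comp_in_Hom[OF d(1) K] by (simp add: is_triangle_def)
  have "(F, e \<cdot> G, K \<cdot> d) \<in> Tri C"
    by (rule Tri_isomorphism[OF D tr Idn_in_Hom[OF SX] Idn_in_Hom[OF SY] e(1)])
      (simp_all add: Idn_isomorphism SX SY e(2) Comp_Idn_left[OF F(1)] Comp_Idn_right[OF F(1)]
        Comp_Idn_right[OF Comp_in_Hom[OF G e(1)]] Ta_Idn Comp_Idn_left[OF K] Comp_assoc[OF e(1) d(1) K] d(2) Comp_Idn_right[OF K])
  then have D': "distinguished C SX SY S F (e \<cdot> G) (K \<cdot> d)" using tr by (simp add: distinguished_def)
  show ?thesis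
  proof (rule that[OF D' F(2)])
    show "e \<cdot> G \<cdot> l i = \<iota> i \<cdot> g i" if i: "i \<in> I" for i
      using Comp_assoc[OF l[OF i] G e(1)] \<mu>(2)[OF i] Comp_assoc[OF g[OF i] coproductD(3)[OF \<mu>(1) i] e(1)] e(3)[OF i] by simp
  qed
qed

end

section \<open>Covers by objects of the heart\<close>

locale smashing_adjacent = reflective_aisle C U Wge + adjacent_structures C Wle Wge Tle
  for C :: "('o, 'm, 'x) tricat_scheme" (structure) and U :: "'u itself" and Wle Wge Tle +
  assumes hom_small: "locally_small U C" and brown: "brown_representability U C"
begin

abbreviation "Hw \<equiv> Wle \<inter> Wge"

text \<open>
  The first vertex of a weight decomposition of an object of \<open>Wge\<close> is an extension of objects of \<open>Wge\<close>.
\<close>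
lemma cover:
  assumes X: "X \<in> Wge"
  obtains Y P u p h where "Y \<in> Wge" "P \<in> Hw" "distinguished C Y P X u p h"
proof -
  obtain L R f g h where D: "L \<in> Wle" "R \<in> Wge" "distinguished C L X (T R) f g h"
    using W_decomposition[OF A_in_Ob[OF X]] .
  have f: "f \<in> Hom C L X" and h: "h \<in> Hom C (T R) (T L)" using distinguishedD[OF D(3)] by auto
  obtain k where k: "k \<in> Hom C R L" "Ta k = Neg C h" using Ta_full[OF W_Ob(2)[OF D(2)] W_Ob(1)[OF D(1)] Neg_Hom[OF h]] .
  have D': "distinguished C R L X k f g"
    by (rule rotate_back[OF k(1)]) (use k(2) Neg_Neg[OF h] D(3) in simp)
  have "L \<in> Wge" using Wge_extension[OF D' D(2) X] .
  then show ?thesis using that D(1,2) D' by blast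
qed

lemma cover_lift:
  assumes D: "distinguished C Y P X u p h" and Y: "Y \<in> Wge" and Q: "Q \<in> Hw" and q: "q \<in> Hom C Q X"
  obtains q' where "q' \<in> Hom C Q P" "p \<cdot> q' = q"
proof -
  have h: "h \<in> Hom C X (T Y)" using distinguishedD[OF D] by blast
  have "h \<cdot> q = Zero C Q (T Y)" using W_orthogonal[OF _ Y Comp_in_Hom[OF q h]] Q by blast
  then show ?thesis using triangle_factor_left[OF rotate[OF D] q] that by metis
qed

lemma Hw_coproducts:
  assumes S: "is_coproduct C (I :: 'u set) P S \<iota>" and I: "small U I" and P: "\<And>i. i \<in> I \<Longrightarrow> P i \<in> Hw"
  shows "S \<in> Hw"
proof
  show "S \<in> Wge" using A_coproducts S I P unfolding closed_under_small_coproducts_def by blast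
  have SO: "S \<in> Ob C" using coproductD[OF S] by blast
  show "S \<in> Wle" unfolding Wle_iff
  proof (intro conjI ballI SO)
    fix Y f assume Y: "Y \<in> Wge" and f: "f \<in> Hom C S (T Y)"
    have TY: "T Y \<in> Ob C" using T_Ob W_Ob Y by blast
    show "f = Zero C S (T Y)"
    proof (rule coproduct_unique[OF S category_axioms f Zero_Hom[OF SO TY]])
      fix i assume i: "i \<in> I"
      have \<iota>: "\<iota> i \<in> Hom C (P i) S" using coproductD(3)[OF S i] .
      show "f \<cdot> \<iota> i = Zero C S (T Y) \<cdot> \<iota> i"
        using W_orthogonal[OF _ Y Comp_in_Hom[OF \<iota> f]] P[OF i] Zero_Comp[OF \<iota> TY] by simp
    qed
  qed
qed

lemma heart_Hom: "X \<in> Hw \<Longrightarrow> Y \<in> Hw \<Longrightarrow> Hom (heart C Wle Wge) X Y = Hom C X Y"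
  by (simp add: heart_def Hom_full)

text \<open>
  The heart inherits the coproducts of \<open>C\<close>. Conversely a coproduct in the heart is a retract of the
  coproduct in \<open>C\<close> in a way compatible with the inclusions, hence has its universal property.
\<close>
lemma heart_coproduct:
  assumes I: "small U (I :: 'u set)"
  shows heart_coproduct_if: "is_coproduct C I P S \<iota> \<Longrightarrow> (\<And>i. i \<in> I \<Longrightarrow> P i \<in> Hw) \<Longrightarrow> is_coproduct (heart C Wle Wge) I P S \<iota>"
    and heart_coproduct_is: "is_coproduct (heart C Wle Wge) I P S \<iota> \<Longrightarrow> is_coproduct C I P S \<iota>"
proof -
  have Ob: "Ob (heart C Wle Wge) = Hw" using W_Ob by (auto simp: heart_def)
  have Cmp: "Comp (heart C Wle Wge) = Comp C" by (simp add: heart_def)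
  have if_dir: "is_coproduct (heart C Wle Wge) I P S \<iota>"
    if S: "is_coproduct C I P S \<iota>" and P: "\<And>i. i \<in> I \<Longrightarrow> P i \<in> Hw" for P S \<iota>
    using S Hw_coproducts[OF S I P] P W_Ob heart_Hom unfolding is_coproduct_def Ob Cmp by auto
  then show "is_coproduct C I P S \<iota> \<Longrightarrow> (\<And>i. i \<in> I \<Longrightarrow> P i \<in> Hw) \<Longrightarrow> is_coproduct (heart C Wle Wge) I P S \<iota>" .
  show "is_coproduct C I P S \<iota>" if H: "is_coproduct (heart C Wle Wge) I P S \<iota>"
  proof -
    have P: "P i \<in> Hw" if "i \<in> I" for i using H that unfolding is_coproduct_def Ob by blast
    have S: "S \<in> Hw" using H unfolding is_coproduct_def Ob by blast
    have \<iota>: "\<iota> i \<in> Hom C (P i) S" if "i \<in> I" for i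
      using H that heart_Hom[OF P[OF that] S] unfolding is_coproduct_def by blast
    obtain E l where E: "is_coproduct C I P E l" "E \<in> Wge" using coproduct_in_A[OF I, of P] P by blast
    have E': "is_coproduct (heart C Wle Wge) I P E l" using if_dir[OF E(1) P] .
    have EH: "E \<in> Hw" using Hw_coproducts[OF E(1) I P] .
    have l: "l i \<in> Hom C (P i) E" if "i \<in> I" for i using coproductD(3)[OF E(1) that] .
    obtain e where e: "e \<in> Hom C E S" "\<And>i. i \<in> I \<Longrightarrow> e \<cdot> l i = \<iota> i"
      using coproduct_factor[OF E(1) _ \<iota>] S W_Ob by blast
    obtain d where d: "d \<in> Hom C S E" "\<And>i. i \<in> I \<Longrightarrow> d \<cdot> \<iota> i = l i"
      using coproduct_factor[OF H, of E l] heart_Hom[OF P EH] heart_Hom[OF S EH] l EH Ob Cmp by auto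
    have ed: "e \<cdot> d \<in> Hom C S S" "Idn C S \<in> Hom C S S" using Comp_in_Hom[OF d(1) e(1)] Idn_in_Hom S W_Ob by blast+
    have i1: "e \<cdot> d \<cdot> \<iota> i = \<iota> i" "Idn C S \<cdot> \<iota> i = \<iota> i" if "i \<in> I" for i
      using Comp_assoc[OF \<iota>[OF that] d(1) e(1)] d(2) e(2) that Comp_Idn_left[OF \<iota>[OF that]] by simp_all
    have "\<forall>i\<in>I. \<iota> i \<in> Hom (heart C Wle Wge) (P i) S" using H unfolding is_coproduct_def by blast
    then have "\<exists>!v. v \<in> Hom (heart C Wle Wge) S S \<and> (\<forall>i\<in>I. Comp (heart C Wle Wge) v (\<iota> i) = \<iota> i)"
      using H S unfolding is_coproduct_def Ob by blast
    then have "\<exists>!v. v \<in> Hom C S S \<and> (\<forall>i\<in>I. v \<cdot> \<iota> i = \<iota> i)" using heart_Hom[OF S S] Cmp by simp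
    \<comment> \<open>Both are endomorphisms of \<open>S\<close> in the heart, where \<open>S\<close> has the universal property.\<close>
    then have eid: "e \<cdot> d = Idn C S" using ed i1 by blast
    show ?thesis
      unfolding is_coproduct_def
    proof (intro conjI ballI allI impI)
      fix Z f assume Z: "Z \<in> Ob C" and f: "\<forall>i\<in>I. f i \<in> Hom C (P i) Z"
      obtain v where v: "v \<in> Hom C E Z" "\<And>i. i \<in> I \<Longrightarrow> v \<cdot> l i = f i" using coproduct_factor[OF E(1) Z] f by blast
      show "\<exists>!u. u \<in> Hom C S Z \<and> (\<forall>i\<in>I. u \<cdot> \<iota> i = f i)"
      proof (rule ex1I[of _ "v \<cdot> d"])
        show "v \<cdot> d \<in> Hom C S Z \<and> (\<forall>i\<in>I. v \<cdot> d \<cdot> \<iota> i = f i)"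
          using Comp_in_Hom[OF d(1) v(1)] Comp_assoc[OF \<iota> d(1) v(1)] d(2) v(2) by simp
        fix w assume w: "w \<in> Hom C S Z \<and> (\<forall>i\<in>I. w \<cdot> \<iota> i = f i)"
        then have wH: "w \<in> Hom C S Z" by blast
        have "w \<cdot> e = v"
        proof (rule coproduct_unique[OF E(1) category_axioms Comp_in_Hom[OF e(1) wH] v(1)])
          fix i assume i: "i \<in> I"
          show "w \<cdot> e \<cdot> l i = v \<cdot> l i" using Comp_assoc[OF l[OF i] e(1) wH] e(2)[OF i] v(2)[OF i] w i by simp
        qed
        then have "v \<cdot> d = w \<cdot> (e \<cdot> d)" using Comp_assoc[OF d(1) e(1) wH] by simp
        then show "w = v \<cdot> d" using eid Comp_Idn_right[OF wH] by simp
      qed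
    qed (use P S W_Ob \<iota> in auto)
  qed
qed

text \<open>
  Two covers give a presentation \<open>P' \<rightarrow> P \<rightarrow> M\<close> by the heart. A natural transformation sends the cover
  \<open>p\<close> to a morphism \<open>P \<rightarrow> N\<close> that vanishes on \<open>P'\<close>, hence on the fiber of \<open>p\<close>, and so it descends
  to \<open>M\<close>. Both the vanishing and the uniqueness use that \<open>N\<close> is right orthogonal to \<open>Wge[1]\<close>, so that
  composition with a cover is injective on morphisms to \<open>N\<close>.
\<close>
lemma restricted_transformation_lift:
  assumes M: "M \<in> Wge" and N: "N \<in> Tle"
    and \<eta>: "\<And>P q. P \<in> Hw \<Longrightarrow> q \<in> Hom C P M \<Longrightarrow> \<eta> q \<in> Hom C P N"
    and nat: "\<And>P Q q f. P \<in> Hw \<Longrightarrow> Q \<in> Hw \<Longrightarrow> q \<in> Hom C Q M \<Longrightarrow> f \<in> Hom C P Q \<Longrightarrow> \<eta> (q \<cdot> f) = \<eta> q \<cdot> f"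
  shows "\<exists>!g. g \<in> Hom C M N \<and> (\<forall>P\<in>Hw. \<forall>q \<in> Hom C P M. \<eta> q = g \<cdot> q)"
proof -
  obtain Y P u p h where P: "Y \<in> Wge" "P \<in> Hw" "distinguished C Y P M u p h" using cover[OF M] .
  obtain Y' P' u' p' h' where P': "Y' \<in> Wge" "P' \<in> Hw" "distinguished C Y' P' Y u' p' h'" using cover[OF P(1)] .
  have u: "u \<in> Hom C Y P" and p: "p \<in> Hom C P M" and h: "h \<in> Hom C M (T Y)" using distinguishedD[OF P(3)] by auto
  have p': "p' \<in> Hom C P' Y" and h': "h' \<in> Hom C Y (T Y')" using distinguishedD[OF P'(3)] by auto
  have O: "P \<in> Ob C" "P' \<in> Ob C" "Y \<in> Ob C" "N \<in> Ob C" using P P' W_Ob Tle_Ob N by auto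
  have mono: "x = Zero C Z N" if Z: "distinguished C V Q Z a b c" "V \<in> Wge" and x: "x \<in> Hom C Z N" "x \<cdot> b = Zero C Q N"
    for V Q Z a b c x
  proof -
    have c: "c \<in> Hom C Z (T V)" using distinguishedD[OF Z(1)] by blast
    obtain x' where x': "x' \<in> Hom C (T V) N" "x = x' \<cdot> c" using triangle_factor_right[OF rotate[OF Z(1)] x] .
    then have "x' = Zero C (T V) N" using t_orthogonal[OF Z(2) N x'(1)] by blast
    then show ?thesis using x'(2) Zero_Comp[OF c O(4)] by simp
  qed
  have x: "\<eta> p \<in> Hom C P N" using \<eta>[OF P(2) p] .
  \<comment> \<open>Naturality alone makes \<open>\<eta>\<close> preserve zero morphisms.\<close>
  have zero_\<eta>: "\<eta> (Zero C P' M) = Zero C P' N"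
  proof -
    have z: "Zero C P' P' \<in> Hom C P' P'" and zM: "Zero C P' M \<in> Hom C P' M" using Zero_Hom O W_Ob M by blast+
    have "\<eta> (Zero C P' M \<cdot> Zero C P' P') = \<eta> (Zero C P' M) \<cdot> Zero C P' P'" by (rule nat[OF P'(2) P'(2) zM z])
    then show ?thesis using Comp_Zero[OF zM O(2)] Comp_Zero[OF \<eta>[OF P'(2) zM] O(2)] by simp
  qed
  have up: "u \<cdot> p' \<in> Hom C P' P" using Comp_in_Hom[OF p' u] .
  have "\<eta> p \<cdot> u \<cdot> p' = \<eta> (p \<cdot> (u \<cdot> p'))"
    using nat[OF P'(2) P(2) p up] Comp_assoc[OF p' u x] by simp
  also have "p \<cdot> (u \<cdot> p') = Zero C P' M"
    using Comp_assoc[OF p' u p] triangle_Comp[OF P(3)] Zero_Comp[OF p'] W_Ob M by simp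
  finally have "\<eta> p \<cdot> u \<cdot> p' = Zero C P' N" using zero_\<eta> by simp
  then have "\<eta> p \<cdot> u = Zero C Y N" using mono[OF P'(3,1) Comp_in_Hom[OF u x]] by blast
  then obtain g where g: "g \<in> Hom C M N" "\<eta> p = g \<cdot> p" using triangle_factor_right[OF P(3) x] by blast
  have all: "\<eta> q = g \<cdot> q" if Q: "Q \<in> Hw" and q: "q \<in> Hom C Q M" for Q q
  proof -
    obtain q' where q': "q' \<in> Hom C Q P" "p \<cdot> q' = q" using cover_lift[OF P(3,1) Q q] .
    show ?thesis using nat[OF Q P(2) p q'(1)] q'(2) g(2) Comp_assoc[OF q'(1) p g(1)] by simp
  qed
  show ?thesis
  proof (rule ex1I[of _ g])
    show "g \<in> Hom C M N \<and> (\<forall>P\<in>Hw. \<forall>q \<in> Hom C P M. \<eta> q = g \<cdot> q)" using g all by blast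
    fix k assume k: "k \<in> Hom C M N \<and> (\<forall>P\<in>Hw. \<forall>q \<in> Hom C P M. \<eta> q = k \<cdot> q)"
    then have kH: "k \<in> Hom C M N" and kp: "k \<cdot> p = g \<cdot> p" using P(2) p g(2) by auto
    have "Sub C k g \<cdot> p = Zero C P N"
      using Sub_Comp[OF p kH g(1)] kp Sub_Zero_iff Comp_in_Hom[OF p g(1)] by simp
    then have "Sub C k g = Zero C M N" using mono[OF P(3,1) Sub_Hom[OF kH g(1)]] by blast
    then show "k = g" using Sub_Zero_iff[OF kH g(1)] by simp
  qed
qed

end

section \<open>Representing presheaves on the heart\<close>

locale heart_presheaf = smashing_adjacent C U Wle Wge Tle + F: presheaf C U "Wle \<inter> Wge" F r
  for C :: "('o, 'm, 'x) tricat_scheme" (structure) and U :: "'u itself" and Wle Wge Tle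
    and F :: "'o \<Rightarrow> 'g monoid" and r :: "'m \<Rightarrow> 'g \<Rightarrow> 'g" +
  assumes F_products: "\<lbrakk>small U (I :: 'u set); is_coproduct C I P S \<iota>; \<And>i. i \<in> I \<Longrightarrow> P i \<in> Wle \<inter> Wge;
      \<And>i. i \<in> I \<Longrightarrow> x i \<in> carrier (F (P i))\<rbrakk> \<Longrightarrow> \<exists>!s. s \<in> carrier (F S) \<and> (\<forall>i\<in>I. r (\<iota> i) s = x i)"
begin

text \<open>
  The objects of the category of elements of \<open>C(-, X)\<close> restricted to the heart.
\<close>
definition elements :: "'o \<Rightarrow> 'm set" where
  "elements X = {q \<in> Arr C. Dom C q \<in> Hw \<and> Cod C q = X}"

text \<open>
  Natural transformations from \<open>C(-, X)\<close>, restricted to the heart, to \<open>F\<close>, given as one function on all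
  elements.
\<close>
definition transf :: "'o \<Rightarrow> ('m \<Rightarrow> 'g) set" where
  "transf X = {\<theta> \<in> extensional (elements X).
     (\<forall>P\<in>Hw. \<forall>q \<in> Hom C P X. \<theta> q \<in> carrier (F P)) \<and>
     (\<forall>P\<in>Hw. \<forall>Q\<in>Hw. \<forall>q \<in> Hom C Q X. \<forall>f \<in> Hom C P Q. \<theta> (q \<cdot> f) = r f (\<theta> q)) \<and>
     (\<forall>P\<in>Hw. \<forall>q \<in> Hom C P X. \<forall>q' \<in> Hom C P X. \<theta> (Add C q q') = \<theta> q \<otimes>\<^bsub>F P\<^esub> \<theta> q')}"

definition Nat :: "'o \<Rightarrow> ('m \<Rightarrow> 'g) monoid" where
  "Nat X = \<lparr>carrier = transf X,
     mult = (\<lambda>\<theta> \<theta>'. \<lambda>q\<in>elements X. \<theta> q \<otimes>\<^bsub>F (Dom C q)\<^esub> \<theta>' q),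
     one = (\<lambda>q\<in>elements X. \<one>\<^bsub>F (Dom C q)\<^esub>)\<rparr>"

definition Nat_map :: "'m \<Rightarrow> ('m \<Rightarrow> 'g) \<Rightarrow> 'm \<Rightarrow> 'g" where
  "Nat_map f \<theta> = (\<lambda>q\<in>elements (Dom C f). \<theta> (f \<cdot> q))"

lemma elements_iff: "q \<in> elements X \<longleftrightarrow> (\<exists>P\<in>Hw. q \<in> Hom C P X)"
  by (auto simp: elements_def Hom_def)

lemma elements_HomI: "P \<in> Hw \<Longrightarrow> q \<in> Hom C P X \<Longrightarrow> q \<in> elements X \<and> Dom C q = P"
  by (auto simp: elements_def Hom_def)

lemma transfI:
  assumes "\<And>P q. P \<in> Hw \<Longrightarrow> q \<in> Hom C P X \<Longrightarrow> \<theta> q \<in> carrier (F P)"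
    and "\<And>P Q q f. P \<in> Hw \<Longrightarrow> Q \<in> Hw \<Longrightarrow> q \<in> Hom C Q X \<Longrightarrow> f \<in> Hom C P Q \<Longrightarrow> \<theta> (q \<cdot> f) = r f (\<theta> q)"
    and "\<And>P q q'. P \<in> Hw \<Longrightarrow> q \<in> Hom C P X \<Longrightarrow> q' \<in> Hom C P X \<Longrightarrow> \<theta> (Add C q q') = \<theta> q \<otimes>\<^bsub>F P\<^esub> \<theta> q'"
  shows "restrict \<theta> (elements X) \<in> transf X"
proof -
  have r: "restrict \<theta> (elements X) q = \<theta> q" if "P \<in> Hw" "q \<in> Hom C P X" for P q
    using elements_HomI[OF that] by simp
  show ?thesis unfolding transf_def
  proof (intro CollectI conjI ballI)
    fix P q assume P: "P \<in> Hw" and q: "q \<in> Hom C P X"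
    show "restrict \<theta> (elements X) q \<in> carrier (F P)" using assms(1) r P q by simp
    fix q' assume q': "q' \<in> Hom C P X"
    show "restrict \<theta> (elements X) (Add C q q') = restrict \<theta> (elements X) q \<otimes>\<^bsub>F P\<^esub> restrict \<theta> (elements X) q'"
      using assms(3)[OF P q q'] r[OF P q] r[OF P q'] r[OF P Add_Hom[OF q q']] by simp
  next
    fix P Q q f assume P: "P \<in> Hw" and Q: "Q \<in> Hw" and q: "q \<in> Hom C Q X" and f: "f \<in> Hom C P Q"
    show "restrict \<theta> (elements X) (q \<cdot> f) = r f (restrict \<theta> (elements X) q)"
      using assms(2)[OF P Q q f] r[OF Q q] r[OF P Comp_in_Hom[OF f q]] by simp
  qed simp
qed

lemma transfD:
  assumes "\<theta> \<in> transf X" "P \<in> Hw" "q \<in> Hom C P X"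
  shows transf_closed: "\<theta> q \<in> carrier (F P)"
    and transf_natural: "Q \<in> Hw \<Longrightarrow> f \<in> Hom C Q P \<Longrightarrow> \<theta> (q \<cdot> f) = r f (\<theta> q)"
    and transf_Add: "q' \<in> Hom C P X \<Longrightarrow> \<theta> (Add C q q') = \<theta> q \<otimes>\<^bsub>F P\<^esub> \<theta> q'"
  using assms unfolding transf_def by auto

lemma transf_ext:
  assumes "\<theta> \<in> transf X" "\<theta>' \<in> transf X" "\<And>P q. P \<in> Hw \<Longrightarrow> q \<in> Hom C P X \<Longrightarrow> \<theta> q = \<theta>' q"
  shows "\<theta> = \<theta>'"
proof (rule extensionalityI[of _ "elements X"])
  show "\<theta> \<in> extensional (elements X)" "\<theta>' \<in> extensional (elements X)" using assms(1,2) by (auto simp: transf_def)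
  show "\<theta> q = \<theta>' q" if "q \<in> elements X" for q using that assms(3) elements_iff by blast
qed

lemma Nat_carrier [simp]: "carrier (Nat X) = transf X" by (simp add: Nat_def)

lemma Nat_mult: "P \<in> Hw \<Longrightarrow> q \<in> Hom C P X \<Longrightarrow> (\<theta> \<otimes>\<^bsub>Nat X\<^esub> \<theta>') q = \<theta> q \<otimes>\<^bsub>F P\<^esub> \<theta>' q"
  using elements_HomI by (simp add: Nat_def)

lemma Nat_one: "P \<in> Hw \<Longrightarrow> q \<in> Hom C P X \<Longrightarrow> \<one>\<^bsub>Nat X\<^esub> q = \<one>\<^bsub>F P\<^esub>"
  using elements_HomI by (simp add: Nat_def)

lemma Nat_map_apply: "f \<in> Hom C X Y \<Longrightarrow> P \<in> Hw \<Longrightarrow> q \<in> Hom C P X \<Longrightarrow> Nat_map f \<theta> q = \<theta> (f \<cdot> q)"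
  using elements_HomI[of P q X] by (simp add: Nat_map_def Hom_def)

lemma Nat_closed:
  shows Nat_mult_closed: "\<theta> \<in> transf X \<Longrightarrow> \<theta>' \<in> transf X \<Longrightarrow> \<theta> \<otimes>\<^bsub>Nat X\<^esub> \<theta>' \<in> transf X"
    and Nat_one_closed: "\<one>\<^bsub>Nat X\<^esub> \<in> transf X"
    and Nat_inv_closed: "\<theta> \<in> transf X \<Longrightarrow> (\<lambda>q\<in>elements X. inv\<^bsub>F (Dom C q)\<^esub> \<theta> q) \<in> transf X"
proof -
  have G: "comm_group (F P)" if "P \<in> Hw" for P using F.G_comm that .
  have D: "Dom C q = P" if "q \<in> Hom C P X" for q P using that by (simp add: Hom_def)
  show "\<theta> \<otimes>\<^bsub>Nat X\<^esub> \<theta>' \<in> transf X" if t: "\<theta> \<in> transf X" "\<theta>' \<in> transf X"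
  proof -
    have "(\<lambda>q\<in>elements X. \<theta> q \<otimes>\<^bsub>F (Dom C q)\<^esub> \<theta>' q) \<in> transf X"
    proof (rule transfI)
      fix P q assume P: "P \<in> Hw" and q: "q \<in> Hom C P X"
      interpret FP: comm_group "F P" using G P .
      show "\<theta> q \<otimes>\<^bsub>F (Dom C q)\<^esub> \<theta>' q \<in> carrier (F P)"
        using transf_closed[OF t(1) P q] transf_closed[OF t(2) P q] D[OF q] by simp
      fix q' assume q': "q' \<in> Hom C P X"
      show "\<theta> (Add C q q') \<otimes>\<^bsub>F (Dom C (Add C q q'))\<^esub> \<theta>' (Add C q q') =
          \<theta> q \<otimes>\<^bsub>F (Dom C q)\<^esub> \<theta>' q \<otimes>\<^bsub>F P\<^esub> (\<theta> q' \<otimes>\<^bsub>F (Dom C q')\<^esub> \<theta>' q')"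
        using transf_Add[OF t(1) P q q'] transf_Add[OF t(2) P q q'] D[OF Add_Hom[OF q q']] D[OF q] D[OF q']
          transf_closed[OF t(1) P q] transf_closed[OF t(2) P q] transf_closed[OF t(1) P q'] transf_closed[OF t(2) P q']
          FP.m_ac by simp
    next
      fix P Q q f assume P: "P \<in> Hw" and Q: "Q \<in> Hw" and q: "q \<in> Hom C Q X" and f: "f \<in> Hom C P Q"
      show "\<theta> (q \<cdot> f) \<otimes>\<^bsub>F (Dom C (q \<cdot> f))\<^esub> \<theta>' (q \<cdot> f) = r f (\<theta> q \<otimes>\<^bsub>F (Dom C q)\<^esub> \<theta>' q)"
        using transf_natural[OF t(1) Q q P f] transf_natural[OF t(2) Q q P f] D[OF Comp_in_Hom[OF f q]] D[OF q]
          F.r_mult[OF f P Q transf_closed[OF t(1) Q q] transf_closed[OF t(2) Q q]] by simp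
    qed
    then show ?thesis by (simp add: Nat_def)
  qed
  have "(\<lambda>q\<in>elements X. \<one>\<^bsub>F (Dom C q)\<^esub>) \<in> transf X"
  proof (rule transfI)
    fix P q assume P: "P \<in> Hw" and q: "q \<in> Hom C P X"
    interpret FP: comm_group "F P" using G P .
    show "\<one>\<^bsub>F (Dom C q)\<^esub> \<in> carrier (F P)" using D[OF q] by simp
    fix q' assume q': "q' \<in> Hom C P X"
    show "\<one>\<^bsub>F (Dom C (Add C q q'))\<^esub> = \<one>\<^bsub>F (Dom C q)\<^esub> \<otimes>\<^bsub>F P\<^esub> \<one>\<^bsub>F (Dom C q')\<^esub>"
      using D[OF Add_Hom[OF q q']] D[OF q] D[OF q'] by simp
  next
    fix P Q q f assume P: "P \<in> Hw" and Q: "Q \<in> Hw" and q: "q \<in> Hom C Q X" and f: "f \<in> Hom C P Q"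
    show "\<one>\<^bsub>F (Dom C (q \<cdot> f))\<^esub> = r f \<one>\<^bsub>F (Dom C q)\<^esub>"
      using D[OF Comp_in_Hom[OF f q]] D[OF q] F.r_one[OF f P Q] by simp
  qed
  then show "\<one>\<^bsub>Nat X\<^esub> \<in> transf X" by (simp add: Nat_def)
  show "(\<lambda>q\<in>elements X. inv\<^bsub>F (Dom C q)\<^esub> \<theta> q) \<in> transf X" if t: "\<theta> \<in> transf X"
  proof (rule transfI)
    fix P q assume P: "P \<in> Hw" and q: "q \<in> Hom C P X"
    interpret FP: comm_group "F P" using G P .
    show "inv\<^bsub>F (Dom C q)\<^esub> \<theta> q \<in> carrier (F P)" using transf_closed[OF t P q] D[OF q] by simp
    fix q' assume q': "q' \<in> Hom C P X"
    show "inv\<^bsub>F (Dom C (Add C q q'))\<^esub> \<theta> (Add C q q') = inv\<^bsub>F (Dom C q)\<^esub> \<theta> q \<otimes>\<^bsub>F P\<^esub> inv\<^bsub>F (Dom C q')\<^esub> \<theta> q'"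
      using transf_Add[OF t P q q'] D[OF Add_Hom[OF q q']] D[OF q] D[OF q']
        FP.inv_mult transf_closed[OF t P q] transf_closed[OF t P q'] by simp
  next
    fix P Q q f assume P: "P \<in> Hw" and Q: "Q \<in> Hw" and q: "q \<in> Hom C Q X" and f: "f \<in> Hom C P Q"
    show "inv\<^bsub>F (Dom C (q \<cdot> f))\<^esub> \<theta> (q \<cdot> f) = r f (inv\<^bsub>F (Dom C q)\<^esub> \<theta> q)"
      using transf_natural[OF t Q q P f] D[OF Comp_in_Hom[OF f q]] D[OF q]
        F.r_inv[OF f P Q transf_closed[OF t Q q]] by simp
  qed
qed

lemma Nat_group: "comm_group (Nat X)"
proof (rule comm_groupI)
  have G: "comm_group (F P)" if "P \<in> Hw" for P using F.G_comm that .
  note cl = Nat_mult_closed Nat_one_closed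
  show "\<theta> \<otimes>\<^bsub>Nat X\<^esub> \<theta>' \<in> carrier (Nat X)" if "\<theta> \<in> carrier (Nat X)" "\<theta>' \<in> carrier (Nat X)" for \<theta> \<theta>'
    using that Nat_mult_closed by simp
  show "\<one>\<^bsub>Nat X\<^esub> \<in> carrier (Nat X)" using Nat_one_closed by simp
  show "\<theta> \<otimes>\<^bsub>Nat X\<^esub> \<theta>' \<otimes>\<^bsub>Nat X\<^esub> \<theta>'' = \<theta> \<otimes>\<^bsub>Nat X\<^esub> (\<theta>' \<otimes>\<^bsub>Nat X\<^esub> \<theta>'')"
    if t: "\<theta> \<in> carrier (Nat X)" "\<theta>' \<in> carrier (Nat X)" "\<theta>'' \<in> carrier (Nat X)" for \<theta> \<theta>' \<theta>''
  proof (rule transf_ext)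
    fix P q assume P: "P \<in> Hw" and q: "q \<in> Hom C P X"
    interpret FP: comm_group "F P" using G P .
    show "(\<theta> \<otimes>\<^bsub>Nat X\<^esub> \<theta>' \<otimes>\<^bsub>Nat X\<^esub> \<theta>'') q = (\<theta> \<otimes>\<^bsub>Nat X\<^esub> (\<theta>' \<otimes>\<^bsub>Nat X\<^esub> \<theta>'')) q"
      using t transf_closed[OF _ P q] by (simp add: Nat_mult[OF P q] FP.m_assoc)
  qed (use t cl in auto)
  show "\<theta> \<otimes>\<^bsub>Nat X\<^esub> \<theta>' = \<theta>' \<otimes>\<^bsub>Nat X\<^esub> \<theta>"
    if t: "\<theta> \<in> carrier (Nat X)" "\<theta>' \<in> carrier (Nat X)" for \<theta> \<theta>'
  proof (rule transf_ext)
    fix P q assume P: "P \<in> Hw" and q: "q \<in> Hom C P X"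
    interpret FP: comm_group "F P" using G P .
    show "(\<theta> \<otimes>\<^bsub>Nat X\<^esub> \<theta>') q = (\<theta>' \<otimes>\<^bsub>Nat X\<^esub> \<theta>) q"
      using t transf_closed[OF _ P q] by (simp add: Nat_mult[OF P q] FP.m_comm)
  qed (use t cl in auto)
  show "\<one>\<^bsub>Nat X\<^esub> \<otimes>\<^bsub>Nat X\<^esub> \<theta> = \<theta>" if t: "\<theta> \<in> carrier (Nat X)" for \<theta>
  proof (rule transf_ext)
    fix P q assume P: "P \<in> Hw" and q: "q \<in> Hom C P X"
    interpret FP: comm_group "F P" using G P .
    show "(\<one>\<^bsub>Nat X\<^esub> \<otimes>\<^bsub>Nat X\<^esub> \<theta>) q = \<theta> q"
      using t transf_closed[OF _ P q] by (simp add: Nat_mult[OF P q] Nat_one[OF P q])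
  qed (use t cl in auto)
  show "\<exists>\<theta>'\<in>carrier (Nat X). \<theta>' \<otimes>\<^bsub>Nat X\<^esub> \<theta> = \<one>\<^bsub>Nat X\<^esub>" if t: "\<theta> \<in> carrier (Nat X)" for \<theta>
  proof
    let ?i = "\<lambda>q\<in>elements X. inv\<^bsub>F (Dom C q)\<^esub> \<theta> q"
    show i: "?i \<in> carrier (Nat X)" using Nat_inv_closed t by simp
    show "?i \<otimes>\<^bsub>Nat X\<^esub> \<theta> = \<one>\<^bsub>Nat X\<^esub>"
    proof (rule transf_ext)
      fix P q assume P: "P \<in> Hw" and q: "q \<in> Hom C P X"
      interpret FP: comm_group "F P" using G P .
      show "(?i \<otimes>\<^bsub>Nat X\<^esub> \<theta>) q = \<one>\<^bsub>Nat X\<^esub> q"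
        using t transf_closed[OF _ P q] elements_HomI[OF P q] by (simp add: Nat_mult[OF P q] Nat_one[OF P q] FP.l_inv)
    qed (use i t cl in auto)
  qed
qed

lemma Nat_map_closed:
  assumes f: "f \<in> Hom C X Y" and t: "\<theta> \<in> transf Y" shows "Nat_map f \<theta> \<in> transf X"
proof -
  have D: "Dom C f = X" using f by (simp add: Hom_def)
  show ?thesis unfolding Nat_map_def D
  proof (rule transfI)
    fix P q assume P: "P \<in> Hw" and q: "q \<in> Hom C P X"
    show "\<theta> (f \<cdot> q) \<in> carrier (F P)" using transf_closed[OF t P Comp_in_Hom[OF q f]] .
    fix q' assume q': "q' \<in> Hom C P X"
    show "\<theta> (f \<cdot> Add C q q') = \<theta> (f \<cdot> q) \<otimes>\<^bsub>F P\<^esub> \<theta> (f \<cdot> q')"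
      using Comp_Add_right[OF q q' f] transf_Add[OF t P Comp_in_Hom[OF q f] Comp_in_Hom[OF q' f]] by simp
  next
    fix P Q q g assume P: "P \<in> Hw" and Q: "Q \<in> Hw" and q: "q \<in> Hom C Q X" and g: "g \<in> Hom C P Q"
    show "\<theta> (f \<cdot> (q \<cdot> g)) = r g (\<theta> (f \<cdot> q))"
      using Comp_assoc[OF g q f] transf_natural[OF t Q Comp_in_Hom[OF q f] P g] by simp
  qed
qed

text \<open>
  A transformation is determined by its value at a cover; this also bounds the size of \<open>Nat X\<close>.
\<close>
lemma transf_cover_inj:
  assumes D: "distinguished C Y P X u p h" and Y: "Y \<in> Wge" and P: "P \<in> Hw"
    and t: "\<theta> \<in> transf X" "\<theta>' \<in> transf X" and eq: "\<theta> p = \<theta>' p"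
  shows "\<theta> = \<theta>'"
proof (rule transf_ext[OF t])
  fix Q q assume Q: "Q \<in> Hw" and q: "q \<in> Hom C Q X"
  have p: "p \<in> Hom C P X" using distinguishedD[OF D] by blast
  obtain q' where q': "q' \<in> Hom C Q P" "p \<cdot> q' = q" using cover_lift[OF D Y Q q] .
  show "\<theta> q = \<theta>' q" using transf_natural[OF t(1) P p Q q'(1)] transf_natural[OF t(2) P p Q q'(1)] q'(2) eq by simp
qed

lemma Nat_presheaf: "presheaf C U Wge Nat Nat_map"
proof (intro presheaf.intro presheaf_axioms.intro preadditive_category_axioms)
  show "Wge \<subseteq> Ob C" using W_Ob by blast
  show "comm_group (Nat X)" for X by (rule Nat_group)
  show "small U (carrier (Nat X))" if X: "X \<in> Wge" for X
  proof -
    obtain Y P u p h where P: "Y \<in> Wge" "P \<in> Hw" "distinguished C Y P X u p h" using cover[OF X] .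
    have p: "p \<in> Hom C P X" using distinguishedD[OF P(3)] by blast
    show ?thesis
    proof (rule small_inj_on[of "\<lambda>\<theta>. \<theta> p"])
      show "inj_on (\<lambda>\<theta>. \<theta> p) (carrier (Nat X))" using transf_cover_inj[OF P(3,1,2)] by (auto intro: inj_onI)
      show "(\<lambda>\<theta>. \<theta> p) ` carrier (Nat X) \<subseteq> carrier (F P)" using transf_closed[OF _ P(2) p] by auto
      show "small U (carrier (F P))" using F.G_small P(2) .
    qed
  qed
  show "Nat_map f \<in> hom (Nat Y) (Nat X)" if f: "f \<in> Hom C X Y" for f X Y
  proof (rule homI)
    fix \<theta> \<theta>' assume t: "\<theta> \<in> carrier (Nat Y)" "\<theta>' \<in> carrier (Nat Y)"
    show "Nat_map f (\<theta> \<otimes>\<^bsub>Nat Y\<^esub> \<theta>') = Nat_map f \<theta> \<otimes>\<^bsub>Nat X\<^esub> Nat_map f \<theta>'"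
    proof (rule transf_ext)
      fix P q assume P: "P \<in> Hw" and q: "q \<in> Hom C P X"
      show "Nat_map f (\<theta> \<otimes>\<^bsub>Nat Y\<^esub> \<theta>') q = (Nat_map f \<theta> \<otimes>\<^bsub>Nat X\<^esub> Nat_map f \<theta>') q"
        by (simp add: Nat_map_apply[OF f P q] Nat_mult[OF P q] Nat_mult[OF P Comp_in_Hom[OF q f]])
    qed (use t Nat_map_closed[OF f] Nat_mult_closed in auto)
  qed (use Nat_map_closed[OF f] in auto)
  show "Nat_map (Idn C X) \<theta> = \<theta>" if X: "X \<in> Wge" and t: "\<theta> \<in> carrier (Nat X)" for X \<theta>
  proof (rule transf_ext[of _ X])
    have I: "Idn C X \<in> Hom C X X" using Idn_in_Hom W_Ob X by blast
    show "Nat_map (Idn C X) \<theta> \<in> transf X" "\<theta> \<in> transf X" using Nat_map_closed[OF I] t by auto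
    show "Nat_map (Idn C X) \<theta> q = \<theta> q" if "P \<in> Hw" "q \<in> Hom C P X" for P q
      using Nat_map_apply[OF I that] Comp_Idn_left[OF that(2)] by simp
  qed
  show "Nat_map (g \<cdot> f) \<theta> = Nat_map f (Nat_map g \<theta>)"
    if f: "f \<in> Hom C X Y" and g: "g \<in> Hom C Y Z" and t: "\<theta> \<in> carrier (Nat Z)" for f g X Y Z \<theta>
  proof (rule transf_ext[of _ X])
    show "Nat_map (g \<cdot> f) \<theta> \<in> transf X" "Nat_map f (Nat_map g \<theta>) \<in> transf X"
      using Nat_map_closed[OF Comp_in_Hom[OF f g]] Nat_map_closed[OF f Nat_map_closed[OF g]] t by auto
    show "Nat_map (g \<cdot> f) \<theta> q = Nat_map f (Nat_map g \<theta>) q" if P: "P \<in> Hw" and q: "q \<in> Hom C P X" for P q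
      using Nat_map_apply[OF Comp_in_Hom[OF f g] P q] Nat_map_apply[OF f P q] Nat_map_apply[OF g P Comp_in_Hom[OF q f]]
        Comp_assoc[OF q f g] by simp
  qed
  show "Nat_map (Add C f g) \<theta> = Nat_map f \<theta> \<otimes>\<^bsub>Nat X\<^esub> Nat_map g \<theta>"
    if f: "f \<in> Hom C X Y" and g: "g \<in> Hom C X Y" and t: "\<theta> \<in> carrier (Nat Y)" for f g X Y \<theta>
  proof (rule transf_ext[of _ X])
    show "Nat_map (Add C f g) \<theta> \<in> transf X" "Nat_map f \<theta> \<otimes>\<^bsub>Nat X\<^esub> Nat_map g \<theta> \<in> transf X"
      using Nat_map_closed[OF Add_Hom[OF f g]] Nat_map_closed[OF f] Nat_map_closed[OF g] t Nat_mult_closed by auto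
    show "Nat_map (Add C f g) \<theta> q = (Nat_map f \<theta> \<otimes>\<^bsub>Nat X\<^esub> Nat_map g \<theta>) q" if P: "P \<in> Hw" and q: "q \<in> Hom C P X" for P q
      using Nat_map_apply[OF Add_Hom[OF f g] P q] Nat_map_apply[OF f P q] Nat_map_apply[OF g P q] Nat_mult[OF P q]
        Comp_Add_left[OF q f g] transf_Add[OF _ P Comp_in_Hom[OF q f] Comp_in_Hom[OF q g]] t by simp
  qed
qed

lemma transf_eq_if_Sub:
  assumes t: "\<theta> \<in> transf X" and P: "P \<in> Hw" and q: "q \<in> Hom C P X" and q': "q' \<in> Hom C P X"
    and z: "\<theta> (Sub C q q') = \<one>\<^bsub>F P\<^esub>"
  shows "\<theta> q = \<theta> q'"
proof -
  interpret FP: comm_group "F P" using F.G_comm P .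
  have "\<theta> (Add C (Sub C q q') q') = \<theta> (Sub C q q') \<otimes>\<^bsub>F P\<^esub> \<theta> q'" using transf_Add[OF t P Sub_Hom[OF q q'] q'] .
  then show ?thesis using Add_Sub[OF q q'] z transf_closed[OF t P q'] by simp
qed

text \<open>
  For \<open>X\<close> in \<open>Wge\<close> every morphism from the heart to \<open>Z\<close> lifts to \<open>Y\<close>, and two lifts differ by a morphism
  through \<open>X\<close>, on which \<open>\<theta>\<close> vanishes; so \<open>\<theta>\<close> descends to \<open>Z\<close>.
\<close>
lemma Nat_half_exact:
  assumes D: "distinguished C X Y Z f g h" and X: "X \<in> Wge" and t: "\<theta> \<in> transf Y" and z: "Nat_map f \<theta> = \<one>\<^bsub>Nat X\<^esub>"
  shows "\<exists>\<zeta>\<in>transf Z. Nat_map g \<zeta> = \<theta>"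
proof -
  have f: "f \<in> Hom C X Y" and g: "g \<in> Hom C Y Z" and h: "h \<in> Hom C Z (T X)" using distinguishedD[OF D] by auto
  have eq: "\<theta> y = \<theta> y'" if P: "P \<in> Hw" and y: "y \<in> Hom C P Y" and y': "y' \<in> Hom C P Y" and gy: "g \<cdot> y = g \<cdot> y'" for P y y'
  proof (rule transf_eq_if_Sub[OF t P y y'])
    have "g \<cdot> Sub C y y' = Zero C P Z"
      using Comp_Sub[OF y y' g] gy Sub_Zero_iff Comp_in_Hom[OF y' g] by simp
    then obtain x where x: "x \<in> Hom C P X" "Sub C y y' = f \<cdot> x" using triangle_factor_left[OF D Sub_Hom[OF y y']] by blast
    show "\<theta> (Sub C y y') = \<one>\<^bsub>F P\<^esub>" using Nat_map_apply[OF f P x(1)] z Nat_one[OF P x(1)] x(2) by metis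
  qed
  have lift: "\<exists>y. y \<in> Hom C P Y \<and> g \<cdot> y = q" if P: "P \<in> Hw" and q: "q \<in> Hom C P Z" for P q
  proof -
    have "h \<cdot> q = Zero C P (T X)" using W_orthogonal[OF _ X Comp_in_Hom[OF q h]] P by blast
    then show ?thesis using triangle_factor_left[OF rotate[OF D] q] by metis
  qed
  define \<zeta> where "\<zeta> q = \<theta> (SOME y. y \<in> Hom C (Dom C q) Y \<and> g \<cdot> y = q)" for q
  have \<zeta>: "\<zeta> (g \<cdot> y) = \<theta> y" if P: "P \<in> Hw" and y: "y \<in> Hom C P Y" for P y
  proof -
    have Dm: "Dom C (g \<cdot> y) = P" using Comp_in_Hom[OF y g] by (simp add: Hom_def)
    have "(SOME y'. y' \<in> Hom C P Y \<and> g \<cdot> y' = g \<cdot> y) \<in> Hom C P Y \<and>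
        g \<cdot> (SOME y'. y' \<in> Hom C P Y \<and> g \<cdot> y' = g \<cdot> y) = g \<cdot> y"
      by (rule someI[of "\<lambda>y'. y' \<in> Hom C P Y \<and> g \<cdot> y' = g \<cdot> y" y]) (simp add: y)
    then show ?thesis unfolding \<zeta>_def Dm using eq[OF P _ y] by blast
  qed
  have tr: "restrict \<zeta> (elements Z) \<in> transf Z"
  proof (rule transfI)
    fix P q assume P: "P \<in> Hw" and q: "q \<in> Hom C P Z"
    obtain y where y: "y \<in> Hom C P Y" "g \<cdot> y = q" using lift[OF P q] by blast
    show "\<zeta> q \<in> carrier (F P)" using \<zeta>[OF P y(1)] y(2) transf_closed[OF t P y(1)] by simp
    fix q' assume q': "q' \<in> Hom C P Z"
    obtain y' where y': "y' \<in> Hom C P Y" "g \<cdot> y' = q'" using lift[OF P q'] by blast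
    show "\<zeta> (Add C q q') = \<zeta> q \<otimes>\<^bsub>F P\<^esub> \<zeta> q'"
      using \<zeta>[OF P Add_Hom[OF y(1) y'(1)]] \<zeta>[OF P y(1)] \<zeta>[OF P y'(1)] Comp_Add_right[OF y(1) y'(1) g] y(2) y'(2)
        transf_Add[OF t P y(1) y'(1)] by simp
  next
    fix P Q q k assume P: "P \<in> Hw" and Q: "Q \<in> Hw" and q: "q \<in> Hom C Q Z" and k: "k \<in> Hom C P Q"
    obtain y where y: "y \<in> Hom C Q Y" "g \<cdot> y = q" using lift[OF Q q] by blast
    show "\<zeta> (q \<cdot> k) = r k (\<zeta> q)"
      using \<zeta>[OF P Comp_in_Hom[OF k y(1)]] \<zeta>[OF Q y(1)] y(2) Comp_assoc[OF k y(1) g] transf_natural[OF t Q y(1) P k] by simp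
  qed
  have "Nat_map g (restrict \<zeta> (elements Z)) = \<theta>"
  proof (rule transf_ext[OF Nat_map_closed[OF g tr] t])
    show "Nat_map g (restrict \<zeta> (elements Z)) q = \<theta> q" if P: "P \<in> Hw" and q: "q \<in> Hom C P Y" for P q
      using Nat_map_apply[OF g P q] elements_HomI[OF P Comp_in_Hom[OF q g]] \<zeta>[OF P q] by simp
  qed
  then show ?thesis using tr by blast
qed

lemma F_products_eq:
  assumes "small U (I :: 'u set)" "is_coproduct C I P S \<iota>" "\<And>i. i \<in> I \<Longrightarrow> P i \<in> Hw"
    "x \<in> carrier (F S)" "y \<in> carrier (F S)" "\<And>i. i \<in> I \<Longrightarrow> r (\<iota> i) x = r (\<iota> i) y"
  shows "x = y"
proof -
  have "r (\<iota> i) y \<in> carrier (F (P i))" if "i \<in> I" for i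
    using F.r_closed[OF coproductD(3)[OF assms(2) that] assms(3)[OF that] Hw_coproducts[OF assms(2,1,3)] assms(5)] .
  then have "\<exists>!s. s \<in> carrier (F S) \<and> (\<forall>i\<in>I. r (\<iota> i) s = r (\<iota> i) y)"
    using F_products[OF assms(1,2,3), of "\<lambda>i. r (\<iota> i) y"] by blast
  then show ?thesis using assms(4-6) by blast
qed

text \<open>
  Each \<open>X i\<close> is presented by two covers. Their coproducts present \<open>S\<close>, as coproducts of triangles are
  distinguished, and \<open>F\<close> turns them into products. Hence a transformation on \<open>S\<close> is determined by the
  values at the covers of the summands, and the values prescribed by the \<open>\<theta> i\<close> are compatible.
\<close>
lemma Nat_products:
  assumes I: "small U (I :: 'u set)" and S: "is_coproduct C I X S \<iota>" and X: "\<And>i. i \<in> I \<Longrightarrow> X i \<in> Wge"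
    and x: "\<And>i. i \<in> I \<Longrightarrow> \<theta> i \<in> transf (X i)"
  shows "\<exists>!s. s \<in> transf S \<and> (\<forall>i\<in>I. Nat_map (\<iota> i) s = \<theta> i)"
proof -
  have \<iota>: "\<iota> i \<in> Hom C (X i) S" if "i \<in> I" for i using coproductD(3)[OF S that] .
  have "\<forall>i\<in>I. \<exists>Y P u p h. Y \<in> Wge \<and> P \<in> Hw \<and> distinguished C Y P (X i) u p h" using cover X by metis
  then obtain Y P u p h where c: "\<And>i. i \<in> I \<Longrightarrow> Y i \<in> Wge" "\<And>i. i \<in> I \<Longrightarrow> P i \<in> Hw"
    "\<And>i. i \<in> I \<Longrightarrow> distinguished C (Y i) (P i) (X i) (u i) (p i) (h i)" by metis
  have "\<forall>i\<in>I. \<exists>Y' P' u' p' h'. Y' \<in> Wge \<and> P' \<in> Hw \<and> distinguished C Y' P' (Y i) u' p' h'" using cover c(1) by metis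
  then obtain Y' P' u' p' h' where c': "\<And>i. i \<in> I \<Longrightarrow> Y' i \<in> Wge" "\<And>i. i \<in> I \<Longrightarrow> P' i \<in> Hw"
    "\<And>i. i \<in> I \<Longrightarrow> distinguished C (Y' i) (P' i) (Y i) (u' i) (p' i) (h' i)" by metis
  have u: "u i \<in> Hom C (Y i) (P i)" and p: "p i \<in> Hom C (P i) (X i)" and p': "p' i \<in> Hom C (P' i) (Y i)" if "i \<in> I" for i
    using distinguishedD[OF c(3)[OF that]] distinguishedD[OF c'(3)[OF that]] by auto
  obtain SY \<kappa> where SY: "is_coproduct C I Y SY \<kappa>" "SY \<in> Wge" using coproduct_in_A[OF I, of Y] c(1) by blast
  obtain SP l where SP: "is_coproduct C I P SP l" "SP \<in> Wge" using coproduct_in_A[OF I, of P] c(2) by blast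
  obtain SY' \<kappa>' where SY': "is_coproduct C I Y' SY' \<kappa>'" "SY' \<in> Wge" using coproduct_in_A[OF I, of Y'] c'(1) by blast
  obtain SP' l' where SP': "is_coproduct C I P' SP' l'" "SP' \<in> Wge" using coproduct_in_A[OF I, of P'] c'(2) by blast
  have SPH: "SP \<in> Hw" using Hw_coproducts[OF SP(1) I c(2)] .
  have SPH': "SP' \<in> Hw" using Hw_coproducts[OF SP'(1) I c'(2)] .
  obtain v q k where D: "distinguished C SY SP S v q k" "\<And>i. i \<in> I \<Longrightarrow> v \<cdot> \<kappa> i = l i \<cdot> u i"
    "\<And>i. i \<in> I \<Longrightarrow> q \<cdot> l i = \<iota> i \<cdot> p i"
    by (rule coproduct_of_triangles[OF SY(1) SP(1) S c(3)]) (assumption, rule that)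
  obtain v' q' k' where D': "distinguished C SY' SP' SY v' q' k'" "\<And>i. i \<in> I \<Longrightarrow> v' \<cdot> \<kappa>' i = l' i \<cdot> u' i"
    "\<And>i. i \<in> I \<Longrightarrow> q' \<cdot> l' i = \<kappa> i \<cdot> p' i"
    by (rule coproduct_of_triangles[OF SY'(1) SP'(1) SY(1) c'(3)]) (assumption, rule that)
  have v: "v \<in> Hom C SY SP" and q: "q \<in> Hom C SP S" and q': "q' \<in> Hom C SP' SY"
    using distinguishedD[OF D(1)] distinguishedD[OF D'(1)] by auto
  have \<kappa>: "\<kappa> i \<in> Hom C (Y i) SY" and l: "l i \<in> Hom C (P i) SP" and l': "l' i \<in> Hom C (P' i) SP'" if "i \<in> I" for i
    using coproductD(3)[OF SY(1) that] coproductD(3)[OF SP(1) that] coproductD(3)[OF SP'(1) that] by auto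
  have inj: "s = t" if s: "s \<in> transf S" and t: "t \<in> transf S" and e: "\<And>i. i \<in> I \<Longrightarrow> Nat_map (\<iota> i) s = Nat_map (\<iota> i) t" for s t
  proof (rule transf_cover_inj[OF D(1) SY(2) SPH s t])
    show "s q = t q"
    proof (rule F_products_eq[OF I SP(1) c(2) transf_closed[OF s SPH q] transf_closed[OF t SPH q]])
      fix i assume i: "i \<in> I"
      have "r (l i) (s q) = Nat_map (\<iota> i) s (p i)"
        using transf_natural[OF s SPH q c(2)[OF i] l[OF i]] D(3)[OF i] Nat_map_apply[OF \<iota>[OF i] c(2)[OF i] p[OF i]] by simp
      also have "\<dots> = Nat_map (\<iota> i) t (p i)" using e[OF i] by simp
      also have "\<dots> = r (l i) (t q)"
        using transf_natural[OF t SPH q c(2)[OF i] l[OF i]] D(3)[OF i] Nat_map_apply[OF \<iota>[OF i] c(2)[OF i] p[OF i]] by simp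
      finally show "r (l i) (s q) = r (l i) (t q)" .
    qed
  qed
  have "\<exists>!s. s \<in> carrier (F SP) \<and> (\<forall>i\<in>I. r (l i) s = \<theta> i (p i))"
    by (rule F_products[OF I SP(1) c(2)]) (use transf_closed[OF x c(2) p] in auto)
  then obtain z where z: "z \<in> carrier (F SP)" "\<And>i. i \<in> I \<Longrightarrow> r (l i) z = \<theta> i (p i)" by blast
  have qv: "v \<cdot> q' \<in> Hom C SP' SP" using Comp_in_Hom[OF q' v] .
  have rz: "r (v \<cdot> q') z = \<one>\<^bsub>F SP'\<^esub>"
  proof (rule F_products_eq[OF I SP'(1) c'(2)])
    interpret FS: comm_group "F SP'" using F.G_comm SPH' .
    show "r (v \<cdot> q') z \<in> carrier (F SP')" using F.r_closed[OF qv SPH' SPH z(1)] .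
    show "\<one>\<^bsub>F SP'\<^esub> \<in> carrier (F SP')" by simp
    fix i assume i: "i \<in> I"
    interpret FP: comm_group "F (P' i)" using F.G_comm c'(2) i .
    have up: "u i \<cdot> p' i \<in> Hom C (P' i) (P i)" using Comp_in_Hom[OF p'[OF i] u[OF i]] .
    have zM: "Zero C (P' i) (P' i) \<in> Hom C (P' i) (P' i)" and zX: "Zero C (P' i) (X i) \<in> Hom C (P' i) (X i)"
      using Zero_Hom W_Ob c'(2)[OF i] X[OF i] by blast+
    have "r (l' i) (r (v \<cdot> q') z) = r (v \<cdot> q' \<cdot> l' i) z"
      using F.r_Comp[OF l'[OF i] qv c'(2)[OF i] SPH' SPH z(1)] by simp
    also have "v \<cdot> q' \<cdot> l' i = l i \<cdot> (u i \<cdot> p' i)"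
      using Comp_assoc[OF l'[OF i] q' v] D'(3)[OF i] Comp_assoc[OF p'[OF i] \<kappa>[OF i] v] D(2)[OF i]
        Comp_assoc[OF p'[OF i] u[OF i] l[OF i]] by simp
    also have "r (l i \<cdot> (u i \<cdot> p' i)) z = r (u i \<cdot> p' i) (\<theta> i (p i))"
      using F.r_Comp[OF up l[OF i] c'(2)[OF i] c(2)[OF i] SPH z(1)] z(2)[OF i] by simp
    also have "\<dots> = \<theta> i (p i \<cdot> (u i \<cdot> p' i))"
      using transf_natural[OF x[OF i] c(2)[OF i] p[OF i] c'(2)[OF i] up] by simp
    also have "p i \<cdot> (u i \<cdot> p' i) = Zero C (P' i) (X i)"
      using Comp_assoc[OF p'[OF i] u[OF i] p[OF i]] triangle_Comp[OF c(3)[OF i]] Zero_Comp[OF p'[OF i] W_Ob(2)[OF X[OF i]]] by simp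
    also have "\<theta> i (Zero C (P' i) (X i)) = \<one>\<^bsub>F (P' i)\<^esub>"
      using transf_Add[OF x[OF i] c'(2)[OF i] zX zX] Add_Zero[OF zX] transf_closed[OF x[OF i] c'(2)[OF i] zX]
        FP.r_cancel_one' by metis
    also have "\<dots> = r (l' i) \<one>\<^bsub>F SP'\<^esub>" using F.r_one[OF l'[OF i] c'(2)[OF i] SPH'] by simp
    finally show "r (l' i) (r (v \<cdot> q') z) = r (l' i) \<one>\<^bsub>F SP'\<^esub>" .
  qed
  \<comment> \<open>A morphism to \<open>SP\<close> that dies in \<open>S\<close> factors through the second coproduct of covers.\<close>
  have kill: "r m z = \<one>\<^bsub>F Q\<^esub>" if Q: "Q \<in> Hw" and m: "m \<in> Hom C Q SP" and qm: "q \<cdot> m = Zero C Q S" for Q m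
  proof -
    obtain y where y: "y \<in> Hom C Q SY" "m = v \<cdot> y" using triangle_factor_left[OF D(1) m qm] .
    obtain y' where y': "y' \<in> Hom C Q SP'" "q' \<cdot> y' = y" using cover_lift[OF D'(1) SY'(2) Q y(1)] .
    have "m = v \<cdot> q' \<cdot> y'" using y y' Comp_assoc[OF y'(1) q' v] by simp
    then show ?thesis using F.r_Comp[OF y'(1) qv Q SPH' SPH z(1)] rz F.r_one[OF y'(1) Q SPH'] by simp
  qed
  have eq: "r m z = r m' z" if Q: "Q \<in> Hw" and m: "m \<in> Hom C Q SP" "m' \<in> Hom C Q SP" and qm: "q \<cdot> m = q \<cdot> m'" for Q m m'
  proof -
    interpret FQ: comm_group "F Q" using F.G_comm Q .
    have "q \<cdot> Sub C m m' = Zero C Q S" using Comp_Sub[OF m q] qm Sub_Zero_iff Comp_in_Hom[OF m(2) q] by simp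
    then have "r m z \<otimes>\<^bsub>F Q\<^esub> inv\<^bsub>F Q\<^esub> r m' z = \<one>\<^bsub>F Q\<^esub>"
      using kill[OF Q Sub_Hom[OF m]] F.r_Sub[OF m Q SPH z(1)] by simp
    then show ?thesis using FQ.inv_solve_right' F.r_closed[OF m(1) Q SPH z(1)] F.r_closed[OF m(2) Q SPH z(1)] by simp
  qed
  have lift: "\<exists>m. m \<in> Hom C Q SP \<and> q \<cdot> m = w" if Q: "Q \<in> Hw" and w: "w \<in> Hom C Q S" for Q w
    using cover_lift[OF D(1) SY(2) Q w] by metis
  define s where "s w = r (SOME m. m \<in> Hom C (Dom C w) SP \<and> q \<cdot> m = w) z" for w
  have sq: "s (q \<cdot> m) = r m z" if Q: "Q \<in> Hw" and m: "m \<in> Hom C Q SP" for Q m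
  proof -
    have Dm: "Dom C (q \<cdot> m) = Q" using Comp_in_Hom[OF m q] by (simp add: Hom_def)
    have "(SOME m'. m' \<in> Hom C Q SP \<and> q \<cdot> m' = q \<cdot> m) \<in> Hom C Q SP \<and>
        q \<cdot> (SOME m'. m' \<in> Hom C Q SP \<and> q \<cdot> m' = q \<cdot> m) = q \<cdot> m"
      by (rule someI[of "\<lambda>m'. m' \<in> Hom C Q SP \<and> q \<cdot> m' = q \<cdot> m" m]) (simp add: m)
    then show ?thesis unfolding s_def Dm using eq[OF Q _ m] by blast
  qed
  have st: "restrict s (elements S) \<in> transf S"
  proof (rule transfI)
    fix Q w assume Q: "Q \<in> Hw" and w: "w \<in> Hom C Q S"
    obtain m where m: "m \<in> Hom C Q SP" "q \<cdot> m = w" using lift[OF Q w] by blast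
    show "s w \<in> carrier (F Q)" using sq[OF Q m(1)] m(2) F.r_closed[OF m(1) Q SPH z(1)] by simp
    fix w' assume w': "w' \<in> Hom C Q S"
    obtain m' where m': "m' \<in> Hom C Q SP" "q \<cdot> m' = w'" using lift[OF Q w'] by blast
    show "s (Add C w w') = s w \<otimes>\<^bsub>F Q\<^esub> s w'"
      using sq[OF Q Add_Hom[OF m(1) m'(1)]] sq[OF Q m(1)] sq[OF Q m'(1)] Comp_Add_right[OF m(1) m'(1) q] m(2) m'(2)
        F.r_Add[OF m(1) m'(1) Q SPH z(1)] by simp
  next
    fix Q R w f assume Q: "Q \<in> Hw" and R: "R \<in> Hw" and w: "w \<in> Hom C R S" and f: "f \<in> Hom C Q R"
    obtain m where m: "m \<in> Hom C R SP" "q \<cdot> m = w" using lift[OF R w] by blast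
    show "s (w \<cdot> f) = r f (s w)"
      using sq[OF Q Comp_in_Hom[OF f m(1)]] sq[OF R m(1)] m(2) Comp_assoc[OF f m(1) q] F.r_Comp[OF f m(1) Q R SPH z(1)] by simp
  qed
  have "Nat_map (\<iota> i) (restrict s (elements S)) = \<theta> i" if i: "i \<in> I" for i
  proof (rule transf_cover_inj[OF c(3)[OF i] c(1)[OF i] c(2)[OF i] Nat_map_closed[OF \<iota>[OF i] st] x[OF i]])
    show "Nat_map (\<iota> i) (restrict s (elements S)) (p i) = \<theta> i (p i)"
      using Nat_map_apply[OF \<iota>[OF i] c(2)[OF i] p[OF i]] elements_HomI[OF c(2)[OF i] Comp_in_Hom[OF p[OF i] \<iota>[OF i]]]
        D(3)[OF i] sq[OF c(2)[OF i] l[OF i]] z(2)[OF i] by simp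
  qed
  then show ?thesis using st inj by (metis (no_types, lifting))
qed

text \<open>
  The extension \<open>Nat\<close> of \<open>F\<close> vanishes on \<open>Wge[1]\<close>, as there are no nonzero morphisms from the heart to
  \<open>Wge[1]\<close>; therefore the representing object is right orthogonal to \<open>Wge[1]\<close>. On the heart itself
  \<open>Nat\<close> is \<open>F\<close> by the Yoneda lemma.
\<close>
theorem heart_presheaf_representable:
  obtains N \<xi> where "N \<in> Tle" "N \<in> Wge"
    "\<And>P. P \<in> Hw \<Longrightarrow> bij_betw \<xi> (Hom C P N) (carrier (F P))"
    "\<And>P Q q f. \<lbrakk>P \<in> Hw; Q \<in> Hw; q \<in> Hom C Q N; f \<in> Hom C P Q\<rbrakk> \<Longrightarrow> \<xi> (q \<cdot> f) = r f (\<xi> q)"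
    "\<And>P q q'. \<lbrakk>P \<in> Hw; q \<in> Hom C P N; q' \<in> Hom C P N\<rbrakk> \<Longrightarrow> \<xi> (Add C q q') = \<xi> q \<otimes>\<^bsub>F P\<^esub> \<xi> q'"
proof -
  interpret N: aisle_presheaf C U Wge Nat Nat_map
  proof (intro aisle_presheaf.intro aisle_presheaf_axioms.intro reflective_aisle_axioms Nat_presheaf)
    show "\<exists>z\<in>carrier (Nat Z). Nat_map g z = y"
      if "distinguished C X Y Z f g h" "X \<in> Wge" "y \<in> carrier (Nat Y)" "Nat_map f y = \<one>\<^bsub>Nat X\<^esub>" for X Y Z f g h y
      using Nat_half_exact[OF that(1,2) _ that(4)] that(3) by simp
    show "\<exists>!s. s \<in> carrier (Nat S) \<and> (\<forall>i\<in>I. Nat_map (\<iota> i) s = x i)"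
      if "small U I" "is_coproduct C I X S \<iota>" "\<And>i. i \<in> I \<Longrightarrow> X i \<in> Wge" "\<And>i. i \<in> I \<Longrightarrow> x i \<in> carrier (Nat (X i))"
      for I :: "'u set" and X S \<iota> x
      using Nat_products[OF that(1-3), of x] that(4) by simp
  qed
  obtain N \<xi> where N: "N \<in> Wge" "\<xi> \<in> carrier (Nat N)"
    "\<And>X. X \<in> Wge \<Longrightarrow> bij_betw (\<lambda>f. Nat_map f \<xi>) (Hom C X N) (carrier (Nat X))"
    by (rule N.aisle_brown_representability[OF brown]) (rule that)
  have \<xi>: "\<xi> \<in> transf N" using N(2) by simp
  have NO: "N \<in> Ob C" using W_Ob N(1) by blast
  have "N \<in> Tle" unfolding Tle_eq coaisle_def
  proof (intro CollectI conjI ballI NO)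
    fix X f assume X: "X \<in> Wge" and f: "f \<in> Hom C (T X) N"
    have TX: "T X \<in> Wge" using Wge_shift X .
    \<comment> \<open>\<open>f\<close> and the zero morphism give the same transformation, since the heart has no morphisms to \<open>X[1]\<close>.\<close>
    have Z: "Zero C (T X) N \<in> Hom C (T X) N" using Zero_Hom W_Ob(2)[OF TX] NO .
    have "Nat_map f \<xi> = Nat_map (Zero C (T X) N) \<xi>"
    proof (rule transf_ext[OF Nat_map_closed[OF f \<xi>] Nat_map_closed[OF Z \<xi>]])
      fix P q assume P: "P \<in> Hw" and q: "q \<in> Hom C P (T X)"
      have "q = Zero C P (T X)" using W_orthogonal[OF _ X q] P by blast
      then show "Nat_map f \<xi> q = Nat_map (Zero C (T X) N) \<xi> q"
        using Nat_map_apply[OF f P q] Nat_map_apply[OF Z P q] Comp_Zero[OF f] Comp_Zero[OF Z] W_Ob P by simp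
    qed
    then show "f = Zero C (T X) N" using N(3)[OF TX] f Z unfolding bij_betw_def inj_on_def by blast
  qed
  moreover have "bij_betw \<xi> (Hom C P N) (carrier (F P))" if P: "P \<in> Hw" for P
  proof -
    have PO: "P \<in> Ob C" and PW: "P \<in> Wge" using P W_Ob by auto
    have I: "Idn C P \<in> Hom C P P" using Idn_in_Hom PO .
    show ?thesis unfolding bij_betw_def
    proof
      show "inj_on \<xi> (Hom C P N)"
      proof (rule inj_onI)
        fix f f' assume f: "f \<in> Hom C P N" and f': "f' \<in> Hom C P N" and eq: "\<xi> f = \<xi> f'"
        have "Nat_map f \<xi> = Nat_map f' \<xi>"
        proof (rule transf_ext[OF Nat_map_closed[OF f \<xi>] Nat_map_closed[OF f' \<xi>]])
          fix Q q assume Q: "Q \<in> Hw" and q: "q \<in> Hom C Q P"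
          show "Nat_map f \<xi> q = Nat_map f' \<xi> q"
            using Nat_map_apply[OF f Q q] Nat_map_apply[OF f' Q q] transf_natural[OF \<xi> P f Q q] transf_natural[OF \<xi> P f' Q q] eq by simp
        qed
        then show "f = f'" using N(3)[OF PW] f f' unfolding bij_betw_def inj_on_def by blast
      qed
      show "\<xi> ` Hom C P N = carrier (F P)"
      proof (intro equalityI subsetI)
        show "x \<in> carrier (F P)" if "x \<in> \<xi> ` Hom C P N" for x using that transf_closed[OF \<xi> P] by blast
        fix x assume x: "x \<in> carrier (F P)"
        have "(\<lambda>q\<in>elements P. r q x) \<in> transf P"
          by (rule transfI) (simp_all add: F.r_closed[OF _ _ P x] F.r_Comp[OF _ _ _ _ P x] F.r_Add[OF _ _ _ P x])
        then obtain f where f: "f \<in> Hom C P N" "Nat_map f \<xi> = (\<lambda>q\<in>elements P. r q x)"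
          using N(3)[OF PW] unfolding bij_betw_def Nat_carrier by (metis (no_types, lifting) image_iff)
        have "\<xi> f = Nat_map f \<xi> (Idn C P)" using Nat_map_apply[OF f(1) P I] Comp_Idn_right[OF f(1)] by simp
        also have "\<dots> = x" using f(2) elements_HomI[OF P I] F.r_Idn[OF P x] by simp
        finally show "x \<in> \<xi> ` Hom C P N" using f(1) by blast
      qed
    qed
  qed
  ultimately show ?thesis
    using that[of N \<xi>] N(1) transf_natural[OF \<xi>] transf_Add[OF \<xi>] by blast
qed

end

section \<open>Functor categories and equivalences\<close>

lemma equivalence_if_fully_faithful_essentially_surjective:
  assumes A: "category A" and B: "category B" and F: "is_functor A B F"
    and ff: "\<And>X Y. X \<in> Ob A \<Longrightarrow> Y \<in> Ob A \<Longrightarrow> bij_betw (FArr F) (Hom A X Y) (Hom B (FOb F X) (FOb F Y))"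
    and es: "\<And>Z. Z \<in> Ob B \<Longrightarrow> \<exists>X\<in>Ob A. \<exists>e \<in> Hom B (FOb F X) Z. is_isomorphism B e"
  shows "equivalent_categories A B"
proof -
  interpret A: category A by fact
  interpret B: category B by fact
  have FO: "FOb F X \<in> Ob B" if "X \<in> Ob A" for X using F that unfolding is_functor_def by blast
  have FH: "FArr F f \<in> Hom B (FOb F X) (FOb F Y)" if "f \<in> Hom A X Y" for f X Y
    using F A.Hom_Ob[OF that] that unfolding is_functor_def by blast
  have FI: "FArr F (Idn A X) = Idn B (FOb F X)" if "X \<in> Ob A" for X using F that unfolding is_functor_def by blast
  have FC: "FArr F (Comp A g f) = Comp B (FArr F g) (FArr F f)" if "f \<in> Hom A X Y" "g \<in> Hom A Y Z" for f g X Y Z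
    using F A.Hom_Ob[OF that(1)] A.Hom_Ob[OF that(2)] that unfolding is_functor_def by blast
  have inj: "f = g" if "f \<in> Hom A X Y" "g \<in> Hom A X Y" "FArr F f = FArr F g" for f g X Y
    using ff[of X Y] A.Hom_Ob[OF that(1)] that unfolding bij_betw_def inj_on_def by blast
  have full: "\<exists>f. f \<in> Hom A X Y \<and> FArr F f = b" if "X \<in> Ob A" "Y \<in> Ob A" "b \<in> Hom B (FOb F X) (FOb F Y)" for X Y b
    using ff[OF that(1,2)] that(3) unfolding bij_betw_def by (metis (no_types, lifting) image_iff)
  have "\<forall>Z\<in>Ob B. \<exists>X e d. X \<in> Ob A \<and> e \<in> Hom B (FOb F X) Z \<and> d \<in> Hom B Z (FOb F X) \<and>
      Comp B d e = Idn B (FOb F X) \<and> Comp B e d = Idn B Z"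
  proof
    fix Z assume "Z \<in> Ob B"
    then obtain X e where Xe: "X \<in> Ob A" "e \<in> Hom B (FOb F X) Z" "is_isomorphism B e" using es by blast
    then obtain d where "d \<in> Hom B Z (FOb F X)" "Comp B d e = Idn B (FOb F X)" "Comp B e d = Idn B Z"
      by (auto simp: is_isomorphism_def Hom_def)
    with Xe show "\<exists>X e d. X \<in> Ob A \<and> e \<in> Hom B (FOb F X) Z \<and> d \<in> Hom B Z (FOb F X) \<and>
      Comp B d e = Idn B (FOb F X) \<and> Comp B e d = Idn B Z" by blast
  qed
  then obtain g e d where g: "\<And>Z. Z \<in> Ob B \<Longrightarrow> g Z \<in> Ob A" and e: "\<And>Z. Z \<in> Ob B \<Longrightarrow> e Z \<in> Hom B (FOb F (g Z)) Z"
    and d: "\<And>Z. Z \<in> Ob B \<Longrightarrow> d Z \<in> Hom B Z (FOb F (g Z))"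
    and de: "\<And>Z. Z \<in> Ob B \<Longrightarrow> Comp B (d Z) (e Z) = Idn B (FOb F (g Z))"
    and ed: "\<And>Z. Z \<in> Ob B \<Longrightarrow> Comp B (e Z) (d Z) = Idn B Z" by metis
  define h where "h b = (SOME a. a \<in> Hom A (g (Dom B b)) (g (Cod B b)) \<and>
    FArr F a = Comp B (d (Cod B b)) (Comp B b (e (Dom B b))))" for b
  have h: "h b \<in> Hom A (g Y) (g Z) \<and> FArr F (h b) = Comp B (d Z) (Comp B b (e Y))" if b: "b \<in> Hom B Y Z" for b Y Z
  proof -
    have O: "Y \<in> Ob B" "Z \<in> Ob B" using B.Hom_Ob[OF b] by auto
    have DC: "Dom B b = Y" "Cod B b = Z" using b by (auto simp: Hom_def)
    have "Comp B (d Z) (Comp B b (e Y)) \<in> Hom B (FOb F (g Y)) (FOb F (g Z))"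
      using B.Comp_in_Hom[OF B.Comp_in_Hom[OF e[OF O(1)] b] d[OF O(2)]] .
    from full[OF g[OF O(1)] g[OF O(2)] this] show ?thesis unfolding h_def DC by (rule someI_ex)
  qed
  have eh: "Comp B (e Z) (FArr F (h b)) = Comp B b (e Y)" if b: "b \<in> Hom B Y Z" for b Y Z
  proof -
    have O: "Y \<in> Ob B" "Z \<in> Ob B" using B.Hom_Ob[OF b] by auto
    note be = B.Comp_in_Hom[OF e[OF O(1)] b]
    show ?thesis using h[OF b] B.Comp_assoc[OF be d[OF O(2)] e[OF O(2)]] ed[OF O(2)] B.Comp_Idn_left[OF be] by simp
  qed
  have mono: "x = y" if Z: "Z \<in> Ob B" and x: "x \<in> Hom B W (FOb F (g Z))" "y \<in> Hom B W (FOb F (g Z))"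
      "Comp B (e Z) x = Comp B (e Z) y" for x y W Z
    using B.Comp_assoc[OF x(1) e[OF Z] d[OF Z]] B.Comp_assoc[OF x(2) e[OF Z] d[OF Z]] de[OF Z] x(3)
      B.Comp_Idn_left[OF x(1)] B.Comp_Idn_left[OF x(2)] by simp
  define G where "G = \<lparr>FOb = g, FArr = h\<rparr>"
  have G [simp]: "FOb G = g" "FArr G = h" by (simp_all add: G_def)
  have Gf: "is_functor B A G"
    unfolding is_functor_def G
  proof (intro conjI ballI)
    fix X assume X: "X \<in> Ob B"
    show "g X \<in> Ob A" using g X .
    note I = B.Idn_in_Hom[OF X]
    have "FArr F (h (Idn B X)) = FArr F (Idn A (g X))"
    proof (rule mono[OF X])
      show "Comp B (e X) (FArr F (h (Idn B X))) = Comp B (e X) (FArr F (Idn A (g X)))"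
        using eh[OF I] B.Comp_Idn_left[OF e[OF X]] FI[OF g[OF X]] B.Comp_Idn_right[OF e[OF X]] by simp
    qed (use FH h[OF I] A.Idn_in_Hom[OF g[OF X]] in blast)+
    then show "h (Idn B X) = Idn A (g X)" using inj h[OF I] A.Idn_in_Hom[OF g[OF X]] by blast
    fix Y assume Y: "Y \<in> Ob B"
    show "h f \<in> Hom A (g X) (g Y)" if "f \<in> Hom B X Y" for f using h[OF that] by blast
    fix Z f k assume Z: "Z \<in> Ob B" and f: "f \<in> Hom B X Y" and k: "k \<in> Hom B Y Z"
    have hf: "h f \<in> Hom A (g X) (g Y)" and hk: "h k \<in> Hom A (g Y) (g Z)" and hkf: "h (Comp B k f) \<in> Hom A (g X) (g Z)"
      using h f k B.Comp_in_Hom[OF f k] by blast+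
    have "FArr F (h (Comp B k f)) = FArr F (Comp A (h k) (h f))"
    proof (rule mono[OF Z FH[OF hkf] FH[OF A.Comp_in_Hom[OF hf hk]]])
      have "Comp B (e Z) (FArr F (Comp A (h k) (h f))) = Comp B (Comp B (e Z) (FArr F (h k))) (FArr F (h f))"
        using FC[OF hf hk] B.Comp_assoc[OF FH[OF hf] FH[OF hk] e[OF Z]] by simp
      also have "\<dots> = Comp B k (Comp B (e Y) (FArr F (h f)))"
        using eh[OF k] B.Comp_assoc[OF FH[OF hf] e[OF Y] k] by simp
      also have "\<dots> = Comp B (Comp B k f) (e X)" using eh[OF f] B.Comp_assoc[OF e[OF X] f k] by simp
      finally show "Comp B (e Z) (FArr F (h (Comp B k f))) = Comp B (e Z) (FArr F (Comp A (h k) (h f)))"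
        using eh[OF B.Comp_in_Hom[OF f k]] by simp
    qed
    then show "h (Comp B k f) = Comp A (h k) (h f)" using inj[OF hkf A.Comp_in_Hom[OF hf hk]] by blast
  qed
  have "\<forall>X\<in>Ob A. \<exists>a b. a \<in> Hom A (g (FOb F X)) X \<and> FArr F a = e (FOb F X) \<and> b \<in> Hom A X (g (FOb F X)) \<and> FArr F b = d (FOb F X)"
    using full[OF g[OF FO] _ e[OF FO]] full[OF _ g[OF FO] d[OF FO]] by metis
  then obtain a b where a: "\<And>X. X \<in> Ob A \<Longrightarrow> a X \<in> Hom A (g (FOb F X)) X" "\<And>X. X \<in> Ob A \<Longrightarrow> FArr F (a X) = e (FOb F X)"
    and b: "\<And>X. X \<in> Ob A \<Longrightarrow> b X \<in> Hom A X (g (FOb F X))" "\<And>X. X \<in> Ob A \<Longrightarrow> FArr F (b X) = d (FOb F X)" by metis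
  have 1: "nat_isomorphic A A (comp_functor G F) id_functor"
    unfolding nat_isomorphic_def is_nat_trans_def comp_functor_def id_functor_def
  proof (intro exI[of _ a] conjI ballI)
    fix X assume X: "X \<in> Ob A"
    show "a X \<in> Hom A (FOb \<lparr>FOb = FOb G \<circ> FOb F, FArr = FArr G \<circ> FArr F\<rparr> X) (FOb \<lparr>FOb = id, FArr = id\<rparr> X)"
      using a(1)[OF X] by simp
    note FX = FO[OF X]
    have "Comp A (b X) (a X) = Idn A (g (FOb F X))"
      by (rule inj[OF A.Comp_in_Hom[OF a(1)[OF X] b(1)[OF X]] A.Idn_in_Hom[OF g[OF FX]]])
        (simp add: FC[OF a(1)[OF X] b(1)[OF X]] a(2)[OF X] b(2)[OF X] de[OF FX] FI[OF g[OF FX]])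
    moreover have "Comp A (a X) (b X) = Idn A X"
      by (rule inj[OF A.Comp_in_Hom[OF b(1)[OF X] a(1)[OF X]] A.Idn_in_Hom[OF X]])
        (simp add: FC[OF b(1)[OF X] a(1)[OF X]] a(2)[OF X] b(2)[OF X] ed[OF FX] FI[OF X])
    ultimately show "is_isomorphism A (a X)" using a(1)[OF X] b(1)[OF X] unfolding is_isomorphism_def Hom_def by auto
    fix Y f assume Y: "Y \<in> Ob A" and f: "f \<in> Hom A X Y"
    have hf: "h (FArr F f) \<in> Hom A (g (FOb F X)) (g (FOb F Y))" using h[OF FH[OF f]] by blast
    have "Comp A (a Y) (h (FArr F f)) = Comp A f (a X)"
      by (rule inj[OF A.Comp_in_Hom[OF hf a(1)[OF Y]] A.Comp_in_Hom[OF a(1)[OF X] f]])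
        (simp add: FC[OF hf a(1)[OF Y]] FC[OF a(1)[OF X] f] a(2)[OF X] a(2)[OF Y] eh[OF FH[OF f]])
    then show "Comp A (a Y) (FArr \<lparr>FOb = FOb G \<circ> FOb F, FArr = FArr G \<circ> FArr F\<rparr> f) =
        Comp A (FArr \<lparr>FOb = id, FArr = id\<rparr> f) (a X)" by simp
  qed
  have 2: "nat_isomorphic B B (comp_functor F G) id_functor"
    unfolding nat_isomorphic_def is_nat_trans_def comp_functor_def id_functor_def
  proof (intro exI[of _ e] conjI ballI)
    fix X assume X: "X \<in> Ob B"
    show "e X \<in> Hom B (FOb \<lparr>FOb = FOb F \<circ> FOb G, FArr = FArr F \<circ> FArr G\<rparr> X) (FOb \<lparr>FOb = id, FArr = id\<rparr> X)"
      using e[OF X] by simp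
    show "is_isomorphism B (e X)" using e[OF X] d[OF X] de[OF X] ed[OF X] unfolding is_isomorphism_def Hom_def by auto
    fix Y f assume Y: "Y \<in> Ob B" and f: "f \<in> Hom B X Y"
    show "Comp B (e Y) (FArr \<lparr>FOb = FOb F \<circ> FOb G, FArr = FArr F \<circ> FArr G\<rparr> f) =
        Comp B (FArr \<lparr>FOb = id, FArr = id\<rparr> f) (e X)" using eh[OF f] by simp
  qed
  show ?thesis unfolding equivalent_categories_def using F Gf 1 2 by blast
qed

lemma category_full_subcategory:
  assumes "category C" shows "category (full_subcategory C D)"
proof -
  interpret category C by fact
  show ?thesis
    by unfold_locales
      (auto simp: Hom_full Comp_in_Hom Idn_in_Hom Comp_Idn_left Comp_Idn_right Comp_assoc split: if_splits,
       auto simp: full_subcategory_def Dom_in_Ob Cod_in_Ob)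
qed

lemma category_op: assumes "category C" shows "category (op_category C)"
proof -
  interpret category C by fact
  show ?thesis
    by unfold_locales
      (auto simp: Hom_op Comp_in_Hom Idn_in_Hom Comp_Idn_left Comp_Idn_right Comp_assoc,
       auto simp: op_category_def Dom_in_Ob Cod_in_Ob)
qed

lemma category_Ab: "category (Ab :: ('u monoid, 'u ab_arrow) addcat)"
proof
  show "f \<in> Arr Ab \<Longrightarrow> Dom Ab f \<in> Ob Ab" "f \<in> Arr Ab \<Longrightarrow> Cod Ab f \<in> Ob Ab" for f :: "'u ab_arrow"
    by (auto simp: Ab_def)
  show "Idn Ab X \<in> Hom Ab X X" if "X \<in> Ob Ab" for X :: "'u monoid"
    using that by (auto simp: Hom_Ab hom_def Ob_Ab intro: group.is_monoid comm_group.axioms monoid.m_closed)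
  show "Comp Ab g f \<in> Hom Ab X Z" if "f \<in> Hom Ab X Y" "g \<in> Hom Ab Y Z" for f g :: "'u ab_arrow" and X Y Z
    using that by (auto simp: Hom_Ab hom_def Pi_iff Ob_Ab comm_group_def group_def monoid.m_closed)
  show "Comp Ab (Idn Ab Y) f = f" if "f \<in> Hom Ab X Y" for f :: "'u ab_arrow" and X Y
    using that by (auto simp: Hom_Ab hom_def Pi_iff extensional_def restrict_def fun_eq_iff)
  show "Comp Ab f (Idn Ab X) = f" if "f \<in> Hom Ab X Y" for f :: "'u ab_arrow" and X Y
    using that by (auto simp: Hom_Ab hom_def Pi_iff extensional_def restrict_def fun_eq_iff)
  show "Comp Ab (Comp Ab h g) f = Comp Ab h (Comp Ab g f)"
    if "f \<in> Hom Ab X Y" "g \<in> Hom Ab Y Z" "h \<in> Hom Ab Z W" for f g h :: "'u ab_arrow" and X Y Z W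
    using that by (auto simp: Hom_Ab hom_def Pi_iff intro!: restrict_ext)
qed

lemma Hom_functor_category:
  "x \<in> Hom (functor_category A B P) F G \<longleftrightarrow> F \<in> P \<and> G \<in> P \<and>
     (\<exists>\<eta>. x = (F, G, \<eta>) \<and> is_nat_trans A B F G \<eta> \<and> \<eta> \<in> extensional (Ob A))"
  by (cases x) (auto simp: functor_category_def Hom_def)

lemma functor_category_simps [simp]:
  "Ob (functor_category A B P) = P"
  "Idn (functor_category A B P) F = (F, F, \<lambda>X\<in>Ob A. Idn B (FOb F X))"
  "Comp (functor_category A B P) (G', H, \<theta>) (F, G, \<eta>) = (F, H, \<lambda>X\<in>Ob A. Comp B (\<theta> X) (\<eta> X))"
  by (simp_all add: functor_category_def)

lemma category_functor_category:
  assumes A: "category A" and B: "category B" and P: "\<And>F. F \<in> P \<Longrightarrow> is_functor A B F"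
  shows "category (functor_category A B P)"
proof -
  interpret A: category A by fact
  interpret B: category B by fact
  have FO: "FOb F X \<in> Ob B" if "F \<in> P" "X \<in> Ob A" for F X using P that unfolding is_functor_def by blast
  have FH: "FArr F f \<in> Hom B (FOb F X) (FOb F Y)" if "F \<in> P" "f \<in> Hom A X Y" for F f X Y
    using P[OF that(1)] A.Hom_Ob[OF that(2)] that unfolding is_functor_def by blast
  have nH: "\<eta> X \<in> Hom B (FOb F X) (FOb G X)" if "is_nat_trans A B F G \<eta>" "X \<in> Ob A" for F G \<eta> X
    using that unfolding is_nat_trans_def by blast
  have nN: "Comp B (\<eta> Y) (FArr F f) = Comp B (FArr G f) (\<eta> X)" if "is_nat_trans A B F G \<eta>" "f \<in> Hom A X Y" for F G \<eta> f X Y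
    using that A.Hom_Ob[OF that(2)] unfolding is_nat_trans_def by blast
  show ?thesis
  proof
    show "f \<in> Arr (functor_category A B P) \<Longrightarrow> Dom (functor_category A B P) f \<in> Ob (functor_category A B P)"
      "f \<in> Arr (functor_category A B P) \<Longrightarrow> Cod (functor_category A B P) f \<in> Ob (functor_category A B P)" for f
      by (auto simp: functor_category_def)
    show "Idn (functor_category A B P) F \<in> Hom (functor_category A B P) F F" if "F \<in> Ob (functor_category A B P)" for F
    proof -
      have F: "F \<in> P" using that by simp
      show ?thesis
        using F FO[OF F] B.Idn_in_Hom B.Comp_Idn_left[OF FH[OF F]] B.Comp_Idn_right[OF FH[OF F]]
        by (auto simp: Hom_functor_category is_nat_trans_def)
    qed
    show "Comp (functor_category A B P) y x \<in> Hom (functor_category A B P) F H"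
      if x: "x \<in> Hom (functor_category A B P) F G" and y: "y \<in> Hom (functor_category A B P) G H" for x y F G H
    proof -
      obtain \<eta> \<theta> where n: "x = (F, G, \<eta>)" "is_nat_trans A B F G \<eta>" "y = (G, H, \<theta>)" "is_nat_trans A B G H \<theta>"
        "F \<in> P" "G \<in> P" "H \<in> P" using x y by (auto simp: Hom_functor_category)
      have "is_nat_trans A B F H (\<lambda>X\<in>Ob A. Comp B (\<theta> X) (\<eta> X))"
        unfolding is_nat_trans_def
      proof (intro conjI ballI)
        fix X assume X: "X \<in> Ob A"
        show "(\<lambda>X\<in>Ob A. Comp B (\<theta> X) (\<eta> X)) X \<in> Hom B (FOb F X) (FOb H X)"
          using B.Comp_in_Hom[OF nH[OF n(2) X] nH[OF n(4) X]] X by simp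
        fix Y f assume Y: "Y \<in> Ob A" and f: "f \<in> Hom A X Y"
        have "Comp B (Comp B (\<theta> Y) (\<eta> Y)) (FArr F f) = Comp B (\<theta> Y) (Comp B (\<eta> Y) (FArr F f))"
          by (rule B.Comp_assoc[OF FH[OF n(5) f] nH[OF n(2) Y] nH[OF n(4) Y]])
        also have "\<dots> = Comp B (Comp B (\<theta> Y) (FArr G f)) (\<eta> X)"
          using nN[OF n(2) f] B.Comp_assoc[OF nH[OF n(2) X] FH[OF n(6) f] nH[OF n(4) Y]] by simp
        also have "\<dots> = Comp B (FArr H f) (Comp B (\<theta> X) (\<eta> X))"
          using nN[OF n(4) f] B.Comp_assoc[OF nH[OF n(2) X] nH[OF n(4) X] FH[OF n(7) f]] by simp
        finally show "Comp B ((\<lambda>X\<in>Ob A. Comp B (\<theta> X) (\<eta> X)) Y) (FArr F f) =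
            Comp B (FArr H f) ((\<lambda>X\<in>Ob A. Comp B (\<theta> X) (\<eta> X)) X)" using X Y by simp
      qed
      then show ?thesis using n by (simp add: Hom_functor_category)
    qed
    show "Comp (functor_category A B P) (Idn (functor_category A B P) G) x = x" if "x \<in> Hom (functor_category A B P) F G" for x F G
      using that nH B.Comp_Idn_left by (fastforce simp: Hom_functor_category extensional_def)
    show "Comp (functor_category A B P) x (Idn (functor_category A B P) F) = x" if "x \<in> Hom (functor_category A B P) F G" for x F G
      using that nH B.Comp_Idn_right by (fastforce simp: Hom_functor_category extensional_def)
    show "Comp (functor_category A B P) (Comp (functor_category A B P) z y) x = Comp (functor_category A B P) z (Comp (functor_category A B P) y x)"
      if xyz: "x \<in> Hom (functor_category A B P) F G" "y \<in> Hom (functor_category A B P) G H" "z \<in> Hom (functor_category A B P) H K" for x y z F G H K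
    proof -
      obtain \<eta> \<theta> \<zeta> where n: "x = (F, G, \<eta>)" "is_nat_trans A B F G \<eta>" "y = (G, H, \<theta>)" "is_nat_trans A B G H \<theta>"
        "z = (H, K, \<zeta>)" "is_nat_trans A B H K \<zeta>"
        using xyz by (auto simp: Hom_functor_category)
      show ?thesis
        by (auto simp: n intro!: restrict_ext B.Comp_assoc[OF nH[OF n(2)] nH[OF n(4)] nH[OF n(6)]])
    qed
  qed
qed

section \<open>The heart of the t-structure\<close>

context smashing_adjacent
begin

abbreviation "HC \<equiv> heart C Wle Wge"
abbreviation "PP \<equiv> product_preserving_presheaves U HC"

lemma HC_simps [simp]:
  "Ob HC = Hw" "Ob (op_category HC) = Hw"
  using W_Ob by (auto simp: heart_def)

lemma Ob_PP: "F \<in> Ob PP \<longleftrightarrow> is_additive_functor (op_category HC) Ab F \<and> respects_products HC F"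
  by (simp add: product_preserving_presheaves_def)

lemma category_PP: "category PP"
  unfolding product_preserving_presheaves_def
proof (rule category_functor_category[OF category_op category_Ab])
  show "category HC" unfolding heart_def by (rule category_full_subcategory) (rule category_axioms)
qed (simp add: is_additive_functor_def)

lemma PP_presheaf:
  assumes "F \<in> Ob PP"
  shows "presheaf C U Hw (FOb F) (\<lambda>f. ab_map (FArr F f))"
    and "f \<in> Hom C P Q \<Longrightarrow> P \<in> Hw \<Longrightarrow> Q \<in> Hw \<Longrightarrow> FArr F f = (FOb F Q, FOb F P, ab_map (FArr F f))"
proof -
  have "is_additive_functor (op_category (full_subcategory C Hw)) Ab F"
    using assms unfolding Ob_PP by (simp add: heart_def)
  moreover have "Hw \<subseteq> Ob C" using W_Ob by blast
  ultimately have a: "presheaf C U Hw (FOb F) (\<lambda>f. ab_map (FArr F f))"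
    "\<And>f P Q. f \<in> Hom C P Q \<Longrightarrow> P \<in> Hw \<Longrightarrow> Q \<in> Hw \<Longrightarrow> FArr F f \<in> Hom Ab (FOb F Q) (FOb F P)"
    using presheaf_of_functor[OF preadditive_category_axioms] by blast+
  show "presheaf C U Hw (FOb F) (\<lambda>f. ab_map (FArr F f))" by (rule a(1))
  show "FArr F f = (FOb F Q, FOb F P, ab_map (FArr F f))" if "f \<in> Hom C P Q" "P \<in> Hw" "Q \<in> Hw"
    using a(2)[OF that] by (auto simp: Hom_Ab)
qed

text \<open>
  The morphism of the functor category with components \<open>m\<close>, cut down to the carriers.
\<close>
definition presheaf_arrow where
  "presheaf_arrow F G m = (F, G, \<lambda>P\<in>Hw. (FOb F P, FOb G P, restrict (m P) (carrier (FOb F P))))"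

definition natural_family where
  "natural_family F G m \<longleftrightarrow> (\<forall>P\<in>Hw. m P \<in> hom (FOb F P) (FOb G P)) \<and>
     (\<forall>P\<in>Hw. \<forall>Q\<in>Hw. \<forall>f \<in> Hom C P Q. \<forall>y \<in> carrier (FOb F Q).
        m P (ab_map (FArr F f) y) = ab_map (FArr G f) (m Q y))"

lemma presheaf_arrow_cong:
  "(\<And>P x. P \<in> Hw \<Longrightarrow> x \<in> carrier (FOb F P) \<Longrightarrow> m P x = m' P x) \<Longrightarrow> presheaf_arrow F G m = presheaf_arrow F G m'"
  by (auto simp: presheaf_arrow_def intro!: restrict_ext)

lemma presheaf_arrow_eqD:
  assumes "presheaf_arrow F G m = presheaf_arrow F G m'" "P \<in> Hw" "x \<in> carrier (FOb F P)"
  shows "m P x = m' P x"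
proof -
  have "(\<lambda>P\<in>Hw. (FOb F P, FOb G P, restrict (m P) (carrier (FOb F P)))) P =
      (\<lambda>P\<in>Hw. (FOb F P, FOb G P, restrict (m' P) (carrier (FOb F P)))) P"
    using assms(1) by (simp add: presheaf_arrow_def)
  then have "restrict (m P) (carrier (FOb F P)) x = restrict (m' P) (carrier (FOb F P)) x" using assms(2) by simp
  then show ?thesis using assms(3) by simp
qed

lemma presheaf_arrow_Hom:
  assumes F: "F \<in> Ob PP" and G: "G \<in> Ob PP" and n: "natural_family F G m"
  shows "presheaf_arrow F G m \<in> Hom PP F G"
proof -
  interpret F: presheaf C U Hw "FOb F" "\<lambda>f. ab_map (FArr F f)" by (rule PP_presheaf(1)[OF F])
  interpret G: presheaf C U Hw "FOb G" "\<lambda>f. ab_map (FArr G f)" by (rule PP_presheaf(1)[OF G])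
  have m: "m P \<in> hom (FOb F P) (FOb G P)" if "P \<in> Hw" for P using n that unfolding natural_family_def by blast
  let ?\<eta> = "\<lambda>P\<in>Hw. (FOb F P, FOb G P, restrict (m P) (carrier (FOb F P)))"
  have O: "FOb F P \<in> Ob Ab" "FOb G P \<in> Ob Ab" if "P \<in> Hw" for P
    using F.G_comm[OF that] F.small_G[OF that] G.G_comm[OF that] G.small_G[OF that] by (auto simp: Ob_Ab)
  have "is_nat_trans (op_category HC) Ab F G ?\<eta>"
    unfolding is_nat_trans_def HC_simps
  proof (intro conjI ballI)
    fix P assume P: "P \<in> Hw"
    interpret FP: comm_group "FOb F P" using F.G_comm P .
    have "restrict (m P) (carrier (FOb F P)) \<in> hom (FOb F P) (FOb G P)"
      using m[OF P] by (auto simp: hom_def)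
    then show "?\<eta> P \<in> Hom Ab (FOb F P) (FOb G P)" using P O[OF P] by (simp add: Hom_Ab)
  next
    fix Q P f assume Q: "Q \<in> Hw" and P: "P \<in> Hw" and "f \<in> Hom (op_category HC) Q P"
    then have f: "f \<in> Hom C P Q" by (simp add: Hom_op heart_Hom)
    have "m P (ab_map (FArr F f) y) = ab_map (FArr G f) (m Q y)" if "y \<in> carrier (FOb F Q)" for y
      using n P Q f that unfolding natural_family_def by blast
    then show "Comp Ab (?\<eta> P) (FArr F f) = Comp Ab (FArr G f) (?\<eta> Q)"
      using P Q F.r_closed[OF f P Q]
      by (subst PP_presheaf(2)[OF F f P Q], subst PP_presheaf(2)[OF G f P Q]) (auto intro!: restrict_ext)
  qed
  then show ?thesis using F G unfolding product_preserving_presheaves_def Hom_functor_category presheaf_arrow_def HC_simps by simp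
qed

lemma presheaf_arrow_cases:
  assumes x: "x \<in> Hom PP F G"
  obtains m where "x = presheaf_arrow F G m" "natural_family F G m"
proof -
  have FG: "F \<in> Ob PP" "G \<in> Ob PP" using x category.Hom_Ob[OF category_PP] by blast+
  obtain \<eta> where \<eta>: "x = (F, G, \<eta>)" "is_nat_trans (op_category HC) Ab F G \<eta>" "\<eta> \<in> extensional Hw"
    using x unfolding product_preserving_presheaves_def Hom_functor_category HC_simps by blast
  define m where "m P = ab_map (\<eta> P)" for P
  have m: "\<eta> P = (FOb F P, FOb G P, m P)" "m P \<in> hom (FOb F P) (FOb G P)" "m P \<in> extensional (carrier (FOb F P))"
    if "P \<in> Hw" for P
  proof -
    have "\<eta> P \<in> Hom Ab (FOb F P) (FOb G P)" using \<eta>(2) that unfolding is_nat_trans_def HC_simps by blast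
    then show "\<eta> P = (FOb F P, FOb G P, m P)" "m P \<in> hom (FOb F P) (FOb G P)" "m P \<in> extensional (carrier (FOb F P))"
      unfolding m_def by (auto simp: Hom_Ab)
  qed
  have e: "restrict (m P) (carrier (FOb F P)) = m P" if "P \<in> Hw" for P using extensional_restrict[OF m(3)[OF that]] .
  have "\<eta> = (\<lambda>P\<in>Hw. (FOb F P, FOb G P, restrict (m P) (carrier (FOb F P))))"
    by (rule extensionalityI[OF \<eta>(3)]) (simp_all add: m(1) e)
  then have 1: "x = presheaf_arrow F G m" using \<eta>(1) by (simp add: presheaf_arrow_def)
  have "natural_family F G m" unfolding natural_family_def
  proof (intro conjI ballI)
    fix P assume P: "P \<in> Hw" show "m P \<in> hom (FOb F P) (FOb G P)" using m(2)[OF P] .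
    fix Q f y assume Q: "Q \<in> Hw" and f: "f \<in> Hom C P Q" and y: "y \<in> carrier (FOb F Q)"
    have eq: "Comp Ab (\<eta> P) (FArr F f) = Comp Ab (FArr G f) (\<eta> Q)"
      using \<eta>(2) P Q f unfolding is_nat_trans_def HC_simps by (simp add: Hom_op heart_Hom)
    obtain \<phi> \<psi> where a: "FArr F f = (FOb F Q, FOb F P, \<phi>)" "FArr G f = (FOb G Q, FOb G P, \<psi>)"
      using PP_presheaf(2)[OF FG(1) f P Q] PP_presheaf(2)[OF FG(2) f P Q] by blast
    have "(\<lambda>x\<in>carrier (FOb F Q). m P (\<phi> x)) = (\<lambda>x\<in>carrier (FOb F Q). \<psi> (m Q x))"
      using eq by (simp add: a m(1)[OF P] m(1)[OF Q])
    from fun_cong[OF this, of y] show "m P (ab_map (FArr F f) y) = ab_map (FArr G f) (m Q y)" using y by (simp add: a)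
  qed
  then show ?thesis using that 1 by blast
qed

lemma presheaf_arrow_Comp:
  assumes "\<And>P x. P \<in> Hw \<Longrightarrow> x \<in> carrier (FOb F P) \<Longrightarrow> m P x \<in> carrier (FOb G P)"
  shows "Comp PP (presheaf_arrow G K n) (presheaf_arrow F G m) = presheaf_arrow F K (\<lambda>P x. n P (m P x))"
  using assms unfolding product_preserving_presheaves_def presheaf_arrow_def functor_category_simps HC_simps
  by (auto intro!: restrict_ext)

lemma presheaf_arrow_Idn: "Idn PP F = presheaf_arrow F F (\<lambda>P x. x)"
  unfolding product_preserving_presheaves_def presheaf_arrow_def functor_category_simps HC_simps
  by (auto intro!: restrict_ext)

lemma presheaf_arrow_isomorphism:
  assumes F: "F \<in> Ob PP" and G: "G \<in> Ob PP" and n: "natural_family F G m"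
    and bij: "\<And>P. P \<in> Hw \<Longrightarrow> bij_betw (m P) (carrier (FOb F P)) (carrier (FOb G P))"
  shows "is_isomorphism PP (presheaf_arrow F G m)"
proof -
  interpret F: presheaf C U Hw "FOb F" "\<lambda>f. ab_map (FArr F f)" by (rule PP_presheaf(1)[OF F])
  interpret G: presheaf C U Hw "FOb G" "\<lambda>f. ab_map (FArr G f)" by (rule PP_presheaf(1)[OF G])
  define d where "d P = inv_into (carrier (FOb F P)) (m P)" for P
  have m: "m P \<in> hom (FOb F P) (FOb G P)" if "P \<in> Hw" for P using n that unfolding natural_family_def by blast
  have dm: "d P (m P x) = x" if "P \<in> Hw" "x \<in> carrier (FOb F P)" for P x
    using bij[OF that(1)] that(2) unfolding d_def bij_betw_def by simp
  have md: "m P (d P y) = y" "d P y \<in> carrier (FOb F P)" if "P \<in> Hw" "y \<in> carrier (FOb G P)" for P y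
    using bij[OF that(1)] that(2) unfolding d_def bij_betw_def by (auto simp: f_inv_into_f inv_into_into)
  have nd: "natural_family G F d"
    unfolding natural_family_def
  proof (intro conjI ballI)
    fix P assume P: "P \<in> Hw"
    have "m P \<in> iso (FOb F P) (FOb G P)" using m[OF P] bij[OF P] by (simp add: iso_def)
    then have "d P \<in> iso (FOb G P) (FOb F P)" unfolding d_def using group.iso_set_sym[OF F.G_group[OF P]] by blast
    then show "d P \<in> hom (FOb G P) (FOb F P)" by (simp add: iso_def)
    fix Q f y assume Q: "Q \<in> Hw" and f: "f \<in> Hom C P Q" and y: "y \<in> carrier (FOb G Q)"
    have "m P (ab_map (FArr F f) (d Q y)) = ab_map (FArr G f) y"
      using n P Q f md[OF Q y] unfolding natural_family_def by metis
    then show "d P (ab_map (FArr G f) y) = ab_map (FArr F f) (d Q y)"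
      using dm[OF P F.r_closed[OF f P Q md(2)[OF Q y]]] by simp
  qed
  have H: "presheaf_arrow F G m \<in> Hom PP F G" "presheaf_arrow G F d \<in> Hom PP G F"
    using presheaf_arrow_Hom[OF F G n] presheaf_arrow_Hom[OF G F nd] .
  have "Comp PP (presheaf_arrow G F d) (presheaf_arrow F G m) = presheaf_arrow F F (\<lambda>P x. d P (m P x))"
    by (rule presheaf_arrow_Comp) (use m hom_in_carrier in metis)
  also have "\<dots> = Idn PP F" unfolding presheaf_arrow_Idn by (rule presheaf_arrow_cong) (rule dm)
  finally have 1: "Comp PP (presheaf_arrow G F d) (presheaf_arrow F G m) = Idn PP F" .
  have "Comp PP (presheaf_arrow F G m) (presheaf_arrow G F d) = presheaf_arrow G G (\<lambda>P x. m P (d P x))"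
    by (rule presheaf_arrow_Comp) (rule md(2))
  also have "\<dots> = Idn PP G" unfolding presheaf_arrow_Idn by (rule presheaf_arrow_cong) (rule md(1))
  finally have 2: "Comp PP (presheaf_arrow F G m) (presheaf_arrow G F d) = Idn PP G" .
  show ?thesis unfolding is_isomorphism_def using H 1 2 by (auto simp: Hom_iff)
qed

text \<open>
  The restriction of the represented functor \<open>C(-, N)\<close> to the heart of the weight structure.
\<close>
definition yoneda :: "'o \<Rightarrow> ('o, 'm, 'u monoid, 'u ab_arrow) functr" where
  "yoneda N = presheaf_functor C (\<lambda>P. hom_group C P N) (\<lambda>f m. m \<cdot> f)"

definition yoneda_map :: "'m \<Rightarrow> 'o \<Rightarrow> 'u \<Rightarrow> 'u" where
  "yoneda_map g P u = copy_map (hom_group C P (Cod C g)) (g \<cdot> copy_inv (hom_group C P (Dom C g)) u)"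

lemma yoneda_presheaf: "N \<in> Ob C \<Longrightarrow> presheaf C U Hw (\<lambda>P. hom_group C P N) (\<lambda>f m. m \<cdot> f)"
  by (rule representable_presheaf[OF hom_small]) (use W_Ob in blast)+

lemma yoneda_copy:
  assumes N: "N \<in> Ob C" and P: "P \<in> Hw"
  shows yoneda_carrier: "carrier (FOb (yoneda N) P) = copy_map (hom_group C P N) ` Hom C P N"
    and yoneda_inv: "q \<in> Hom C P N \<Longrightarrow> copy_inv (hom_group C P N) (copy_map (hom_group C P N) q :: 'u) = q"
    and yoneda_mult: "q \<in> Hom C P N \<Longrightarrow> q' \<in> Hom C P N \<Longrightarrow>
      copy_map (hom_group C P N) q \<otimes>\<^bsub>FOb (yoneda N) P\<^esub> copy_map (hom_group C P N) q' = copy_map (hom_group C P N) (Add C q q')"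
    and yoneda_arr: "Q \<in> Hw \<Longrightarrow> f \<in> Hom C Q P \<Longrightarrow> q \<in> Hom C P N \<Longrightarrow>
      ab_map (FArr (yoneda N) f) (copy_map (hom_group C P N) q) = copy_map (hom_group C Q N) (q \<cdot> f)"
proof -
  interpret Y: presheaf C U Hw "\<lambda>P. hom_group C P N" "\<lambda>f m. m \<cdot> f" by (rule yoneda_presheaf[OF N])
  show "carrier (FOb (yoneda N) P) = copy_map (hom_group C P N) ` Hom C P N"
    "q \<in> Hom C P N \<Longrightarrow> copy_inv (hom_group C P N) (copy_map (hom_group C P N) q :: 'u) = q"
    "q \<in> Hom C P N \<Longrightarrow> q' \<in> Hom C P N \<Longrightarrow>
      copy_map (hom_group C P N) q \<otimes>\<^bsub>FOb (yoneda N) P\<^esub> copy_map (hom_group C P N) q' = copy_map (hom_group C P N) (Add C q q')"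
    using Y.copy_G[OF P] by (simp_all add: yoneda_def)
  show "Q \<in> Hw \<Longrightarrow> f \<in> Hom C Q P \<Longrightarrow> q \<in> Hom C P N \<Longrightarrow>
      ab_map (FArr (yoneda N) f) (copy_map (hom_group C P N) q) = copy_map (hom_group C Q N) (q \<cdot> f)"
    using Y.presheaf_functor_map[of f Q P q] P by (simp add: yoneda_def)
qed

lemma yoneda_PP: assumes N: "N \<in> Ob C" shows "yoneda N \<in> Ob PP"
proof -
  interpret Y: presheaf C U Hw "\<lambda>P. hom_group C P N" "\<lambda>f m. m \<cdot> f" by (rule yoneda_presheaf[OF N])
  have "is_additive_functor (op_category HC) Ab (yoneda N)"
    unfolding yoneda_def heart_def by (rule Y.presheaf_functor_additive)
  moreover have "respects_products HC (yoneda N)"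
    unfolding respects_products_def
  proof (intro allI impI, elim conjE)
    fix I :: "'u set" and P S \<iota>
    assume I: "small TYPE('u) I" and cp: "is_coproduct HC I P S \<iota>"
    have I': "small U I" using I by (simp add: small_def)
    have cC: "is_coproduct C I P S \<iota>" by (rule heart_coproduct_is[OF I' cp])
    have P: "P i \<in> Hw" if "i \<in> I" for i using coproductD(2)[OF cp that] by simp
    have S: "S \<in> Hw" using coproductD(1)[OF cp] by simp
    have "(\<lambda>x. \<lambda>i\<in>I. ab_map (FArr (presheaf_functor C (\<lambda>P. hom_group C P N) (\<lambda>f m. m \<cdot> f)) (\<iota> i)) x)
      \<in> iso (small_copy (hom_group C S N) :: 'u monoid) (product_group I (\<lambda>i. small_copy (hom_group C (P i) N)))"
    proof (rule Y.presheaf_functor_product_iso[OF S P coproductD(3)[OF cC]])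
      show "\<exists>!s. s \<in> carrier (hom_group C S N) \<and> (\<forall>i\<in>I. s \<cdot> \<iota> i = x i)"
        if "\<And>i. i \<in> I \<Longrightarrow> x i \<in> carrier (hom_group C (P i) N)" for x
        using coproduct_Hom_bijection[OF cC N, of x] that by simp
    qed
    then show "(\<lambda>x. \<lambda>i\<in>I. ab_map (FArr (yoneda N) (\<iota> i)) x) \<in> iso (FOb (yoneda N) S) (product_group I (\<lambda>i. FOb (yoneda N) (P i)))"
      by (simp add: yoneda_def)
  qed
  ultimately show ?thesis by (simp add: Ob_PP)
qed

lemma yoneda_map_apply:
  assumes g: "g \<in> Hom C N N'" and P: "P \<in> Hw" and q: "q \<in> Hom C P N"
  shows "yoneda_map g P (copy_map (hom_group C P N) q) = copy_map (hom_group C P N') (g \<cdot> q)"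
  using yoneda_inv[OF _ P q] Hom_Ob[OF g] g by (simp add: yoneda_map_def Hom_def)

lemma yoneda_map_natural:
  assumes g: "g \<in> Hom C N N'" shows "natural_family (yoneda N) (yoneda N') (yoneda_map g)"
  unfolding natural_family_def
proof (intro conjI ballI)
  have N: "N \<in> Ob C" "N' \<in> Ob C" using Hom_Ob[OF g] by auto
  fix P assume P: "P \<in> Hw"
  note cN = yoneda_carrier[OF N(1) P] and cN' = yoneda_carrier[OF N(2) P]
  show "yoneda_map g P \<in> hom (FOb (yoneda N) P) (FOb (yoneda N') P)"
  proof (rule homI)
    fix u assume "u \<in> carrier (FOb (yoneda N) P)"
    then obtain q where q: "q \<in> Hom C P N" "u = copy_map (hom_group C P N) q" unfolding cN by blast
    note gq = Comp_in_Hom[OF q(1) g]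
    show "yoneda_map g P u \<in> carrier (FOb (yoneda N') P)" using yoneda_map_apply[OF g P q(1)] gq q(2) cN' by simp
    fix v assume "v \<in> carrier (FOb (yoneda N) P)"
    then obtain p where p: "p \<in> Hom C P N" "v = copy_map (hom_group C P N) p" unfolding cN by blast
    note gp = Comp_in_Hom[OF p(1) g]
    show "yoneda_map g P (u \<otimes>\<^bsub>FOb (yoneda N) P\<^esub> v) = yoneda_map g P u \<otimes>\<^bsub>FOb (yoneda N') P\<^esub> yoneda_map g P v"
      unfolding q(2) p(2) yoneda_mult[OF N(1) P q(1) p(1)] yoneda_map_apply[OF g P q(1)] yoneda_map_apply[OF g P p(1)]
        yoneda_map_apply[OF g P Add_Hom[OF q(1) p(1)]] Comp_Add_right[OF q(1) p(1) g] yoneda_mult[OF N(2) P gq gp] by (rule refl)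
  qed
  fix Q f y assume Q: "Q \<in> Hw" and f: "f \<in> Hom C P Q" and "y \<in> carrier (FOb (yoneda N) Q)"
  then obtain q where q: "q \<in> Hom C Q N" "y = copy_map (hom_group C Q N) q" unfolding yoneda_carrier[OF N(1) Q] by blast
  show "yoneda_map g P (ab_map (FArr (yoneda N) f) y) = ab_map (FArr (yoneda N') f) (yoneda_map g Q y)"
    unfolding q(2) yoneda_arr[OF N(1) Q P f q(1)] yoneda_map_apply[OF g P Comp_in_Hom[OF f q(1)]] yoneda_map_apply[OF g Q q(1)]
      yoneda_arr[OF N(2) Q P f Comp_in_Hom[OF q(1) g]] Comp_assoc[OF f q(1) g] by (rule refl)
qed

definition yoneda_functor ::
  "('o, 'm, ('o, 'm, 'u monoid, 'u ab_arrow) functr,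
    ('o, 'm, 'u monoid, 'u ab_arrow) functr \<times> ('o, 'm, 'u monoid, 'u ab_arrow) functr \<times> ('o \<Rightarrow> 'u ab_arrow)) functr" where
  "yoneda_functor = \<lparr>FOb = yoneda, FArr = (\<lambda>g. presheaf_arrow (yoneda (Dom C g)) (yoneda (Cod C g)) (yoneda_map g))\<rparr>"

lemma yoneda_functor_arr: "g \<in> Hom C N N' \<Longrightarrow> FArr yoneda_functor g = presheaf_arrow (yoneda N) (yoneda N') (yoneda_map g)"
  by (auto simp: yoneda_functor_def Hom_def)

abbreviation "Ht \<equiv> Tle \<inter> Wge"

lemma yoneda_is_functor: "is_functor (heart C Tle Wge) PP yoneda_functor"
proof -
  have FO: "FOb yoneda_functor = yoneda" by (simp add: yoneda_functor_def)
  have O: "N \<in> Ob C" if "N \<in> Ht" for N using that W_Ob by blast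
  have idn: "FArr yoneda_functor (Idn C N) = Idn PP (yoneda N)" if N: "N \<in> Ht" for N
  proof -
    note I = Idn_in_Hom[OF O[OF N]]
    show ?thesis unfolding yoneda_functor_arr[OF I] presheaf_arrow_Idn
    proof (rule presheaf_arrow_cong)
      fix P x assume P: "P \<in> Hw" and "x \<in> carrier (FOb (yoneda N) P)"
      then obtain q where q: "q \<in> Hom C P N" "x = copy_map (hom_group C P N) q"
        unfolding yoneda_carrier[OF O[OF N] P] by blast
      show "yoneda_map (Idn C N) P x = x" unfolding q(2) yoneda_map_apply[OF I P q(1)] Comp_Idn_left[OF q(1)] by (rule refl)
    qed
  qed
  have comp: "FArr yoneda_functor (g \<cdot> f) = Comp PP (FArr yoneda_functor g) (FArr yoneda_functor f)"
    if f: "f \<in> Hom C N N'" and g: "g \<in> Hom C N' N''" for f g N N' N''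
  proof -
    have N: "N \<in> Ob C" "N' \<in> Ob C" "N'' \<in> Ob C" using Hom_Ob f g by auto
    have cl: "yoneda_map f P x \<in> carrier (FOb (yoneda N') P)" if "P \<in> Hw" "x \<in> carrier (FOb (yoneda N) P)" for P x
      using yoneda_map_natural[OF f] that unfolding natural_family_def by (blast intro: hom_in_carrier)
    have c: "Comp PP (presheaf_arrow (yoneda N') (yoneda N'') (yoneda_map g)) (presheaf_arrow (yoneda N) (yoneda N') (yoneda_map f)) =
        presheaf_arrow (yoneda N) (yoneda N'') (\<lambda>P x. yoneda_map g P (yoneda_map f P x))"
      by (rule presheaf_arrow_Comp) (rule cl)
    show ?thesis
      unfolding yoneda_functor_arr[OF f] yoneda_functor_arr[OF g] yoneda_functor_arr[OF Comp_in_Hom[OF f g]] c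
    proof (rule presheaf_arrow_cong)
      fix P x assume P: "P \<in> Hw" and "x \<in> carrier (FOb (yoneda N) P)"
      then obtain q where q: "q \<in> Hom C P N" "x = copy_map (hom_group C P N) q" unfolding yoneda_carrier[OF N(1) P] by blast
      show "yoneda_map (g \<cdot> f) P x = yoneda_map g P (yoneda_map f P x)"
        unfolding q(2) yoneda_map_apply[OF Comp_in_Hom[OF f g] P q(1)] yoneda_map_apply[OF f P q(1)]
          yoneda_map_apply[OF g P Comp_in_Hom[OF q(1) f]] Comp_assoc[OF q(1) f g] by (rule refl)
    qed
  qed
  have arr: "FArr yoneda_functor f \<in> Hom PP (yoneda N) (yoneda N')" if f: "f \<in> Hom C N N'" for f N N'
    unfolding yoneda_functor_arr[OF f] using presheaf_arrow_Hom[OF yoneda_PP yoneda_PP yoneda_map_natural[OF f]] Hom_Ob[OF f] by blast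
  have hs: "Ob (heart C Tle Wge) = Ht" "Idn (heart C Tle Wge) = Idn C" "Comp (heart C Tle Wge) = Comp C"
    using W_Ob by (auto simp: heart_def)
  have hH: "Hom (heart C Tle Wge) X Y = Hom C X Y" if "X \<in> Ht" "Y \<in> Ht" for X Y
    using that by (simp add: heart_def Hom_full)
  show ?thesis
    unfolding is_functor_def hs FO
    by (intro conjI ballI) (auto simp: hH O idn comp arr intro: yoneda_PP[OF O])
qed

lemma yoneda_fully_faithful:
  assumes M: "M \<in> Ht" and N: "N \<in> Ht"
  shows "bij_betw (FArr yoneda_functor) (Hom C M N) (Hom PP (yoneda M) (yoneda N))"
proof -
  have O: "M \<in> Ob C" "N \<in> Ob C" using M N W_Ob by auto
  have MW: "M \<in> Wge" and NT: "N \<in> Tle" using M N by auto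
  show ?thesis unfolding bij_betw_def
  proof
    show "inj_on (FArr yoneda_functor) (Hom C M N)"
    proof (rule inj_onI)
      fix g g' assume g: "g \<in> Hom C M N" and g': "g' \<in> Hom C M N" and eq: "FArr yoneda_functor g = FArr yoneda_functor g'"
      have eq': "g \<cdot> q = g' \<cdot> q" if P: "P \<in> Hw" and q: "q \<in> Hom C P M" for P q
      proof -
        have "copy_map (hom_group C P M) q \<in> carrier (FOb (yoneda M) P)" using yoneda_carrier[OF O(1) P] q by blast
        then have "yoneda_map g P (copy_map (hom_group C P M) q) = yoneda_map g' P (copy_map (hom_group C P M) q)"
          using presheaf_arrow_eqD[OF eq[unfolded yoneda_functor_arr[OF g] yoneda_functor_arr[OF g']] P] by blast
        then have "(copy_map (hom_group C P N) (g \<cdot> q) :: 'u) = copy_map (hom_group C P N) (g' \<cdot> q)"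
          unfolding yoneda_map_apply[OF g P q] yoneda_map_apply[OF g' P q] .
        then show ?thesis using yoneda_inv[OF O(2) P Comp_in_Hom[OF q g]] yoneda_inv[OF O(2) P Comp_in_Hom[OF q g']] by simp
      qed
      have "\<exists>!k. k \<in> Hom C M N \<and> (\<forall>P\<in>Hw. \<forall>q \<in> Hom C P M. g \<cdot> q = k \<cdot> q)"
        by (rule restricted_transformation_lift[OF MW NT]) (use Comp_in_Hom Comp_assoc g in auto)
      then show "g = g'" using g g' eq' by blast
    qed
    show "FArr yoneda_functor ` Hom C M N = Hom PP (yoneda M) (yoneda N)"
    proof (intro equalityI subsetI)
      show "x \<in> Hom PP (yoneda M) (yoneda N)" if "x \<in> FArr yoneda_functor ` Hom C M N" for x
        using that presheaf_arrow_Hom[OF yoneda_PP[OF O(1)] yoneda_PP[OF O(2)] yoneda_map_natural] yoneda_functor_arr by auto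
      fix x assume "x \<in> Hom PP (yoneda M) (yoneda N)"
      then obtain m where m: "x = presheaf_arrow (yoneda M) (yoneda N) m" "natural_family (yoneda M) (yoneda N) m" using presheaf_arrow_cases by blast
      define \<eta> where "\<eta> q = copy_inv (hom_group C (Dom C q) N) (m (Dom C q) (copy_map (hom_group C (Dom C q) M) q))" for q
      have \<eta>: "\<eta> q \<in> Hom C P N \<and> copy_map (hom_group C P N) (\<eta> q) = m P (copy_map (hom_group C P M) q)"
        if P: "P \<in> Hw" and q: "q \<in> Hom C P M" for P q
      proof -
        have Dq: "Dom C q = P" using q by (simp add: Hom_def)
        have "copy_map (hom_group C P M) q \<in> carrier (FOb (yoneda M) P)" using yoneda_carrier[OF O(1) P] q by blast
        then have "m P (copy_map (hom_group C P M) q) \<in> carrier (FOb (yoneda N) P)"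
          using m(2) P unfolding natural_family_def by (blast intro: hom_in_carrier)
        then obtain z where z: "z \<in> Hom C P N" "m P (copy_map (hom_group C P M) q) = copy_map (hom_group C P N) z"
          unfolding yoneda_carrier[OF O(2) P] by blast
        then have "\<eta> q = z" unfolding \<eta>_def Dq z(2) using yoneda_inv[OF O(2) P z(1)] by blast
        then show ?thesis using z by simp
      qed
      have nat: "\<eta> (q \<cdot> f) = \<eta> q \<cdot> f" if P: "P \<in> Hw" and Q: "Q \<in> Hw" and q: "q \<in> Hom C Q M" and f: "f \<in> Hom C P Q" for P Q q f
      proof -
        have qf: "q \<cdot> f \<in> Hom C P M" using Comp_in_Hom[OF f q] .
        have c: "copy_map (hom_group C Q M) q \<in> carrier (FOb (yoneda M) Q)" using yoneda_carrier[OF O(1) Q] q by blast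
        have "copy_map (hom_group C P N) (\<eta> (q \<cdot> f)) = m P (copy_map (hom_group C P M) (q \<cdot> f))" using \<eta>[OF P qf] by blast
        also have "\<dots> = m P (ab_map (FArr (yoneda M) f) (copy_map (hom_group C Q M) q))" using yoneda_arr[OF O(1) Q P f q] by simp
        also have "\<dots> = ab_map (FArr (yoneda N) f) (m Q (copy_map (hom_group C Q M) q))"
          using m(2) P Q f c unfolding natural_family_def by blast
        also have "\<dots> = ab_map (FArr (yoneda N) f) (copy_map (hom_group C Q N) (\<eta> q))" using \<eta>[OF Q q] by simp
        also have "\<dots> = copy_map (hom_group C P N) (\<eta> q \<cdot> f)" using yoneda_arr[OF O(2) Q P f] \<eta>[OF Q q] by blast
        finally show ?thesis
          using yoneda_inv[OF O(2) P] \<eta>[OF P qf] Comp_in_Hom[OF f] \<eta>[OF Q q] by metis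
      qed
      obtain g where g: "g \<in> Hom C M N" "\<And>P q. P \<in> Hw \<Longrightarrow> q \<in> Hom C P M \<Longrightarrow> \<eta> q = g \<cdot> q"
        using restricted_transformation_lift[OF MW NT, of \<eta>] \<eta> nat by blast
      have "presheaf_arrow (yoneda M) (yoneda N) m = presheaf_arrow (yoneda M) (yoneda N) (yoneda_map g)"
      proof (rule presheaf_arrow_cong)
        fix P x assume P: "P \<in> Hw" and "x \<in> carrier (FOb (yoneda M) P)"
        then obtain q where q: "q \<in> Hom C P M" "x = copy_map (hom_group C P M) q" unfolding yoneda_carrier[OF O(1) P] by blast
        show "m P x = yoneda_map g P x" unfolding q(2) yoneda_map_apply[OF g(1) P q(1)] using \<eta>[OF P q(1)] g(2)[OF P q(1)] by simp
      qed
      then show "x \<in> FArr yoneda_functor ` Hom C M N" using m(1) g(1) yoneda_functor_arr[OF g(1)] by (metis image_eqI)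
    qed
  qed
qed

text \<open>
  The universal element that represents \<open>F\<close>, read as a function on morphisms to \<open>N\<close>, is a natural
  isomorphism from the restriction of \<open>C(-, N)\<close> to \<open>F\<close>.
\<close>
lemma yoneda_essentially_surjective:
  assumes F: "F \<in> Ob PP"
  shows "\<exists>N\<in>Ht. \<exists>e \<in> Hom PP (yoneda N) F. is_isomorphism PP e"
proof -
  interpret P: presheaf C U Hw "FOb F" "\<lambda>f. ab_map (FArr F f)" by (rule PP_presheaf(1)[OF F])
  interpret heart_presheaf C U Wle Wge Tle "FOb F" "\<lambda>f. ab_map (FArr F f)"
  proof (intro heart_presheaf.intro heart_presheaf_axioms.intro smashing_adjacent_axioms P.presheaf_axioms)
    fix I :: "'u set" and P S \<iota> x
    assume I: "small U I" and S: "is_coproduct C I P S \<iota>" and P: "\<And>i. i \<in> I \<Longrightarrow> P i \<in> Wle \<inter> Wge"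
      and x: "\<And>i. i \<in> I \<Longrightarrow> x i \<in> carrier (FOb F (P i))"
    let ?f = "\<lambda>s. \<lambda>i\<in>I. ab_map (FArr F (\<iota> i)) s"
    have "?f \<in> iso (FOb F S) (product_group I (\<lambda>i. FOb F (P i)))"
      using F heart_coproduct_if[OF I S P] I unfolding Ob_PP respects_products_def by (simp add: small_def)
    then have b: "bij_betw ?f (carrier (FOb F S)) (\<Pi>\<^sub>E i\<in>I. carrier (FOb F (P i)))" by (simp add: iso_def)
    have eq: "?f s = restrict x I \<longleftrightarrow> (\<forall>i\<in>I. ab_map (FArr F (\<iota> i)) s = x i)" for s
      by (auto simp: fun_eq_iff restrict_def)
    have "restrict x I \<in> (\<Pi>\<^sub>E i\<in>I. carrier (FOb F (P i)))" using x by simp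
    then have "restrict x I \<in> ?f ` carrier (FOb F S)" using bij_betw_imp_surj_on[OF b] by simp
    then obtain s where s: "s \<in> carrier (FOb F S)" "?f s = restrict x I" by (elim imageE) simp
    have "\<exists>!s. s \<in> carrier (FOb F S) \<and> ?f s = restrict x I"
    proof (rule ex1I)
      show "s \<in> carrier (FOb F S) \<and> ?f s = restrict x I" by (rule conjI[OF s])
      fix t assume t: "t \<in> carrier (FOb F S) \<and> ?f t = restrict x I"
      show "t = s"
        by (rule inj_onD[OF bij_betw_imp_inj_on[OF b] _ conjunct1[OF t] s(1)])
          (rule trans[OF conjunct2[OF t] s(2)[symmetric]])
    qed
    then show "\<exists>!s. s \<in> carrier (FOb F S) \<and> (\<forall>i\<in>I. ab_map (FArr F (\<iota> i)) s = x i)" unfolding eq .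
  qed
  obtain N \<xi> where N: "N \<in> Tle" "N \<in> Wge"
    and bij: "\<And>P. P \<in> Hw \<Longrightarrow> bij_betw \<xi> (Hom C P N) (carrier (FOb F P))"
    and nat: "\<And>P Q q f. \<lbrakk>P \<in> Hw; Q \<in> Hw; q \<in> Hom C Q N; f \<in> Hom C P Q\<rbrakk> \<Longrightarrow> \<xi> (q \<cdot> f) = ab_map (FArr F f) (\<xi> q)"
    and add: "\<And>P q q'. \<lbrakk>P \<in> Hw; q \<in> Hom C P N; q' \<in> Hom C P N\<rbrakk> \<Longrightarrow> \<xi> (Add C q q') = \<xi> q \<otimes>\<^bsub>FOb F P\<^esub> \<xi> q'"
    by (rule heart_presheaf_representable) (rule that)
  have NO: "N \<in> Ob C" using W_Ob N by blast
  define m where "m P u = \<xi> (copy_inv (hom_group C P N) u)" for P and u :: 'u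
  have m: "m P (copy_map (hom_group C P N) q) = \<xi> q" if "P \<in> Hw" "q \<in> Hom C P N" for P q
    unfolding m_def using yoneda_inv[OF NO that] by simp
  have bm: "bij_betw (m P) (carrier (FOb (yoneda N) P)) (carrier (FOb F P))" if P: "P \<in> Hw" for P
    unfolding bij_betw_def
  proof
    show "inj_on (m P) (carrier (FOb (yoneda N) P))"
      unfolding yoneda_carrier[OF NO P] using bij[OF P] m[OF P] unfolding bij_betw_def inj_on_def by auto
    show "m P ` carrier (FOb (yoneda N) P) = carrier (FOb F P)"
      unfolding yoneda_carrier[OF NO P] image_image using bij[OF P] m[OF P] unfolding bij_betw_def by simp
  qed
  have n: "natural_family (yoneda N) F m"
    unfolding natural_family_def
  proof (intro conjI ballI)
    fix P assume P: "P \<in> Hw"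
    show "m P \<in> hom (FOb (yoneda N) P) (FOb F P)"
    proof (rule homI)
      fix u assume u: "u \<in> carrier (FOb (yoneda N) P)"
      then show "m P u \<in> carrier (FOb F P)" using bm[OF P] bij_betwE by blast
      fix v assume v: "v \<in> carrier (FOb (yoneda N) P)"
      obtain q q' where q: "q \<in> Hom C P N" "u = copy_map (hom_group C P N) q" and q': "q' \<in> Hom C P N" "v = copy_map (hom_group C P N) q'"
        using u v unfolding yoneda_carrier[OF NO P] by blast
      show "m P (u \<otimes>\<^bsub>FOb (yoneda N) P\<^esub> v) = m P u \<otimes>\<^bsub>FOb F P\<^esub> m P v"
        unfolding q(2) q'(2) yoneda_mult[OF NO P q(1) q'(1)] m[OF P q(1)] m[OF P q'(1)] m[OF P Add_Hom[OF q(1) q'(1)]]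
        by (rule add[OF P q(1) q'(1)])
    qed
    fix Q f y assume Q: "Q \<in> Hw" and f: "f \<in> Hom C P Q" and "y \<in> carrier (FOb (yoneda N) Q)"
    then obtain q where q: "q \<in> Hom C Q N" "y = copy_map (hom_group C Q N) q" unfolding yoneda_carrier[OF NO Q] by blast
    show "m P (ab_map (FArr (yoneda N) f) y) = ab_map (FArr F f) (m Q y)"
      unfolding q(2) yoneda_arr[OF NO Q P f q(1)] m[OF Q q(1)] m[OF P Comp_in_Hom[OF f q(1)]] by (rule nat[OF P Q q(1) f])
  qed
  show ?thesis
    using N presheaf_arrow_Hom[OF yoneda_PP[OF NO] F n] presheaf_arrow_isomorphism[OF yoneda_PP[OF NO] F n bm] by blast
qed

theorem heart_equivalence: "equivalent_categories (heart C Tle Wge) PP"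
proof (rule equivalence_if_fully_faithful_essentially_surjective)
  have Ob: "Ob (heart C Tle Wge) = Ht" using W_Ob by (auto simp: heart_def)
  have FO: "FOb yoneda_functor = yoneda" by (simp add: yoneda_functor_def)
  show "category (heart C Tle Wge)" unfolding heart_def by (rule category_full_subcategory) (rule category_axioms)
  show "category PP" by (rule category_PP)
  show "is_functor (heart C Tle Wge) PP yoneda_functor" by (rule yoneda_is_functor)
  show "bij_betw (FArr yoneda_functor) (Hom (heart C Tle Wge) X Y) (Hom PP (FOb yoneda_functor X) (FOb yoneda_functor Y))"
    if "X \<in> Ob (heart C Tle Wge)" "Y \<in> Ob (heart C Tle Wge)" for X Y
    using yoneda_fully_faithful[of X Y] that unfolding Ob FO by (simp add: heart_def Hom_full)
  show "\<exists>X\<in>Ob (heart C Tle Wge). \<exists>e \<in> Hom PP (FOb yoneda_functor X) Z. is_isomorphism PP e" if "Z \<in> Ob PP" for Z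
    using yoneda_essentially_surjective[OF that] unfolding Ob FO .
qed

end

theorem theorem0p1:
  fixes C :: "('o, 'm) tricat" and Wle Wge :: "'o set"
  assumes "universe TYPE('u)"
    and "smashing_triangulated TYPE('u) C"
    and "brown_representability TYPE('u) C"
    and "weight_structure C Wle Wge"
  shows "((\<exists>Tle Tge. t_structure C Tle Tge \<and> adjacent (Tle, Tge) (Wle, Wge))
            \<longleftrightarrow> smashing_weight_structure TYPE('u) C Wle Wge)
       \<and> (\<forall>Tle Tge. t_structure C Tle Tge \<and> adjacent (Tle, Tge) (Wle, Wge) \<longrightarrow>
            equivalent_categories
              (heart C Tle Tge)
              (product_preserving_presheaves TYPE('u) (heart C Wle Wge)))"
proof (intro conjI allI impI)
  show iff: "(\<exists>Tle Tge. t_structure C Tle Tge \<and> adjacent (Tle, Tge) (Wle, Wge))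
    \<longleftrightarrow> smashing_weight_structure TYPE('u) C Wle Wge"
    by (rule adjacent_t_structure_iff_smashing[OF assms])
  fix Tle Tge assume "t_structure C Tle Tge \<and> adjacent (Tle, Tge) (Wle, Wge)"
  then have t: "t_structure C Tle Wge" and eq: "Tge = Wge" by (auto simp: adjacent_def)
  interpret triangulated_category C using assms(2) by (simp add: smashing_triangulated_def)
  interpret weighted_category C Wle Wge by unfold_locales (rule assms(4))
  interpret adjacent_structures C Wle Wge Tle by unfold_locales (rule t)
  have "reflective_aisle C TYPE('u) Wge"
    by (rule Wge_reflective_aisle[OF assms(1) _ Wge_coproducts])
      (use assms(2) in \<open>simp add: smashing_triangulated_def\<close>)
  then interpret smashing_adjacent C "TYPE('u)" Wle Wge Tle
    by (intro smashing_adjacent.intro smashing_adjacent_axioms.intro adjacent_structures_axioms)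
      (use assms(2,3) in \<open>simp_all add: smashing_triangulated_def\<close>)
  show "equivalent_categories (heart C Tle Tge) (product_preserving_presheaves TYPE('u) (heart C Wle Wge))"
    unfolding eq by (rule heart_equivalence)
qed

end
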